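(* Let $1<\nu\le\frac32$ and $m>2\nu+\frac12$. Let $r_0,K_0$ be the constants fixed in the context (for $\mu=1$ and this $m$). Then there exists $K_3\ge 1$ such that, for every $\mathbf w_0\in\mathbb L^2(m)$ with $\|\mathbf w_0\|_m\le r_0$, the solution $\mathbf w\in C^0([0,\infty),\mathbb L^2(m))$ of the rescaled vorticity equation with $\mathbf w(0)=\mathbf w_0$ satisfies $$\Bigl\|\mathbf w(\tau)-\sum_{i=1}^3 b_i e^{-\tau}\mathbf f_i\Bigr\|_m\le K_3\,e^{-\nu\tau}\|\mathbf w_0\|_m,\qquad \tau\ge 0,$$ where $b_i=\int_{\mathbb R^3}\mathbf p_i\cdot\mathbf w_0\,d\xi$, $i=1,2,3$.
   Context: Notation: $\rho(\xi)=1+|\xi|$ on $\mathbb R^3$; $|\cdot|_p$ is the norm of $L^p(\mathbb R^3)$ (for a vector field, the $L^p$ norm of its Euclidean length). For $m\ge 0$, $\|f\|_m=|\rho^m f|_2$, $L^2(m)=\{f\in L^2(\mathbb R^3): \|f\|_m<\infty\}$, and $\mathbb L^2(m)=\{\mathbf f\in L^2(m)^3:\operatorname{div}\mathbf f=0\}$ (distributional divergence), with norm $\|\mathbf f\|_m=|\rho^m|\mathbf f||_2$. Biot-Savart law: the velocity field $\mathbf v$ obtained from $\mathbf w$ is $\mathbf v(\xi)=-\frac1{4\pi}\int_{\mathbb R^3}\frac{(\xi-\eta)\wedge\mathbf w(\eta)}{|\xi-\eta|^3}\,d\eta$ ($\wedge$ is the cross product). Rescaled vorticity equation: $\partial_\tau\mathbf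 w=\Lambda\mathbf w-(\mathbf v\cdot\nabla)\mathbf w+(\mathbf w\cdot\nabla)\mathbf v$, $\operatorname{div}\mathbf w=0$, with $\Lambda=\Delta_\xi+\frac12\xi\cdot\nabla_\xi+1$. A solution in $\mathbb L^2(m)$ means a mild solution: a continuous function of $\tau$ with values in $\mathbb L^2(m)$ such that, for $i=1,2,3$, $$w_i(\tau)=e^{\tau\Lambda}w_i(0)+\sum_{j=1}^3\int_0^\tau \partial_j e^{(\tau-s)(\Lambda-\frac12)}\bigl(w_j(s)v_i(s)-v_j(s)w_i(s)\bigr)ds,$$ where $(e^{\tau\Lambda}f)(\xi)=\frac{e^{\tau}}{(4\pi(1-e^{-\tau}))^{3/2}}\int_{\mathbb R^3}e^{-\frac{|\xi-\eta|^2}{4(1-e^{-\tau})}}f(\eta e^{\tau/2})\,d\eta$ for $\tau>0$ and $e^{\tau(\Lambda-\frac12)}=e^{-\tau/2}e^{\tau\Lambda}$. Constants: for $m>\frac52$, fix $r_0>0$ and $K_0\ge1$ such that for every $\mathbf w_0\in\mathbb L^2(m)$ with $\|\mathbf w_0\|_m\le r_0$ there is a unique global solution $\mathbf w\in C^0([0,\infty),\mathbb L^2(m))$ with $\mathbf w(0)=\mathbf w_0$, and it satisfies $\|\mathbf w(\tau)\|_m\le K_0e^{-\tau}\|\mathbf w_0\|_m$ for all $\tau\ge0$ (such constants exist; this is the global existence theorem with decay exponent $\mu=1$). With $\mathbf e_1,\mathbf e_2,\mathbf e_3$ the canonical basis of $\mathbb R^3$: $G(\xi)=(4\pi)^{-3/2}e^{-|\xi|^2/4}$,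 $\mathbf p_i(\xi)=\frac12\,\mathbf e_i\wedge\xi$, and $\mathbf f_i=\operatorname{rot}(G\mathbf e_i)=\mathbf p_iG$. *)

theory Defs
  imports "HOL-Analysis.Analysis"
begin

text \<open>
  Elements of function spaces are represented by Borel measurable functions; equality of two such
  elements is equality almost everywhere with respect to \<^term>\<open>lborel\<close>.
\<close>

section \<open>Weighted spaces\<close>

definition rho :: "real^3 \<Rightarrow> real"
  where "rho \<xi> = 1 + norm \<xi>"

text \<open>
  The integral is a Bochner integral, so this is the usual norm only if \<open>(norm f)\<^sup>2\<close> is integrable
  (otherwise it is 0); it is applied to functions in the spaces below and their differences.
\<close>

definition L2_norm :: "(real^3 \<Rightarrow> 'a::real_normed_vector) \<Rightarrow> real"
  where "L2_norm f = sqrt (LINT \<xi>|lborel. (norm (f \<xi>))\<^sup>2)"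

definition weighted_norm :: "real \<Rightarrow> (real^3 \<Rightarrow> 'a::real_normed_vector) \<Rightarrow> real"
  where "weighted_norm m f = L2_norm (\<lambda>\<xi>. rho \<xi> powr m *\<^sub>R f \<xi>)"

definition weighted_L2 :: "real \<Rightarrow> (real^3 \<Rightarrow> real) set"
  where "weighted_L2 m =
    {f. f \<in> borel_measurable lborel \<and> integrable lborel (\<lambda>\<xi>. (rho \<xi> powr m * f \<xi>)\<^sup>2)}"

definition partial :: "3 \<Rightarrow> (real^3 \<Rightarrow> real) \<Rightarrow> real^3 \<Rightarrow> real"
  where "partial j f \<xi> = frechet_derivative f (at \<xi>) (axis j 1)"

primrec C_k :: "nat \<Rightarrow> (real^3 \<Rightarrow> real) \<Rightarrow> bool"
  where
    "C_k 0 \<phi> \<longleftrightarrow> continuous_on UNIV \<phi>"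
  | "C_k (Suc k) \<phi> \<longleftrightarrow> (\<forall>\<xi>. \<phi> differentiable (at \<xi>)) \<and> (\<forall>j. C_k k (partial j \<phi>))"

definition test_function :: "(real^3 \<Rightarrow> real) \<Rightarrow> bool"
  where "test_function \<phi> \<longleftrightarrow> (\<forall>k. C_k k \<phi>) \<and> compact (closure {\<xi>. \<phi> \<xi> \<noteq> 0})"

definition distr_div_free :: "(real^3 \<Rightarrow> real^3) \<Rightarrow> bool"
  where "distr_div_free f \<longleftrightarrow>
    (\<forall>\<phi>. test_function \<phi> \<longrightarrow> (LINT \<xi>|lborel. (\<Sum>j\<in>UNIV. f \<xi> $ j * partial j \<phi> \<xi>)) = 0)"

definition solenoidal_L2 :: "real \<Rightarrow> (real^3 \<Rightarrow> real^3) set"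
  where "solenoidal_L2 m = {f. (\<forall>i. (\<lambda>\<xi>. f \<xi> $ i) \<in> weighted_L2 m) \<and> distr_div_free f}"


section \<open>The rescaled vorticity equation\<close>

text \<open>
  The integral converges absolutely for almost every \<open>\<xi>\<close> if \<open>w\<close> is in \<^term>\<open>solenoidal_L2 m\<close> with
  \<open>m > 3/2\<close>; at the exceptional points the value is 0.
\<close>

definition biot_savart :: "(real^3 \<Rightarrow> real^3) \<Rightarrow> real^3 \<Rightarrow> real^3"
  where "biot_savart w \<xi> =
    - (1 / (4 * pi)) *\<^sub>R (LINT \<eta>|lborel. (1 / norm (\<xi> - \<eta>) ^ 3) *\<^sub>R cross3 (\<xi> - \<eta>) (w \<eta>))"

text \<open>The semigroups generated by \<open>\<Lambda>\<close> and by \<open>\<Lambda> - 1/2\<close>; at time 0 they are the identity.\<close>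

definition exp_Lambda :: "real \<Rightarrow> (real^3 \<Rightarrow> real) \<Rightarrow> real^3 \<Rightarrow> real"
  where "exp_Lambda \<tau> f \<xi> =
    (if \<tau> > 0 then
       exp \<tau> / (4 * pi * (1 - exp (- \<tau>))) powr (3 / 2) *
       (LINT \<eta>|lborel. exp (- (norm (\<xi> - \<eta>))\<^sup>2 / (4 * (1 - exp (- \<tau>)))) * f (exp (\<tau> / 2) *\<^sub>R \<eta>))
     else f \<xi>)"

definition exp_Lambda_half :: "real \<Rightarrow> (real^3 \<Rightarrow> real) \<Rightarrow> real^3 \<Rightarrow> real"
  where "exp_Lambda_half \<tau> f \<xi> = exp (- \<tau> / 2) * exp_Lambda \<tau> f \<xi>"

text \<open>
  For \<open>w\<close> continuous with values in \<^term>\<open>solenoidal_L2 m\<close>, \<open>m > 3/2\<close>, the time integral converges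
  absolutely as an integral of functions with values in \<^term>\<open>weighted_L2 m\<close>, and its value is the
  function given, for almost every \<open>\<xi>\<close>, by the integral of the values at \<open>\<xi>\<close>.
\<close>

definition mild_equation :: "(real \<Rightarrow> real^3 \<Rightarrow> real^3) \<Rightarrow> bool"
  where "mild_equation w \<longleftrightarrow>
    (\<forall>\<tau>\<ge>0. \<forall>i. AE \<xi> in lborel.
       w \<tau> \<xi> $ i =
         exp_Lambda \<tau> (\<lambda>\<eta>. w 0 \<eta> $ i) \<xi> +
         (\<Sum>j\<in>UNIV. LINT s:{0..\<tau>}|lborel.
            partial j (exp_Lambda_half (\<tau> - s)
              (\<lambda>\<eta>. w s \<eta> $ j * biot_savart (w s) \<eta> $ i - biot_savart (w s) \<eta> $ j * w s \<eta> $ i)) \<xi>))"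

definition continuous_in_L2 :: "real \<Rightarrow> (real \<Rightarrow> real^3 \<Rightarrow> real^3) \<Rightarrow> bool"
  where "continuous_in_L2 m w \<longleftrightarrow>
    (\<forall>\<tau>\<ge>0. w \<tau> \<in> solenoidal_L2 m) \<and>
    (\<forall>\<tau>\<ge>0. ((\<lambda>s. weighted_norm m (\<lambda>\<xi>. w s \<xi> - w \<tau> \<xi>)) \<longlongrightarrow> 0) (at \<tau> within {0..}))"

definition global_solution ::
    "real \<Rightarrow> (real^3 \<Rightarrow> real^3) \<Rightarrow> (real \<Rightarrow> real^3 \<Rightarrow> real^3) \<Rightarrow> bool"
  where "global_solution m w0 w \<longleftrightarrow>
    continuous_in_L2 m w \<and> mild_equation w \<and> (AE \<xi> in lborel. w 0 \<xi> = w0 \<xi>)"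

definition global_existence_constants :: "real \<Rightarrow> real \<Rightarrow> real \<Rightarrow> bool"
  where "global_existence_constants m r0 K0 \<longleftrightarrow>
    r0 > 0 \<and> K0 \<ge> 1 \<and>
    (\<forall>w0\<in>solenoidal_L2 m. weighted_norm m w0 \<le> r0 \<longrightarrow>
      (\<exists>w. global_solution m w0 w \<and>
        (\<forall>w'. global_solution m w0 w' \<longrightarrow> (\<forall>\<tau>\<ge>0. AE \<xi> in lborel. w' \<tau> \<xi> = w \<tau> \<xi>)) \<and>
        (\<forall>\<tau>\<ge>0. weighted_norm m (w \<tau>) \<le> K0 * exp (- \<tau>) * weighted_norm m w0)))"


section \<open>The leading-order profile\<close>

definition gaussian :: "real^3 \<Rightarrow> real"
  where "gaussian \<xi> = (4 * pi) powr (- 3 / 2) * exp (- (norm \<xi>)\<^sup>2 / 4)"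

definition rot :: "(real^3 \<Rightarrow> real^3) \<Rightarrow> real^3 \<Rightarrow> real^3"
  where "rot F \<xi> = vector
    [partial 2 (\<lambda>\<eta>. F \<eta> $ 3) \<xi> - partial 3 (\<lambda>\<eta>. F \<eta> $ 2) \<xi>,
     partial 3 (\<lambda>\<eta>. F \<eta> $ 1) \<xi> - partial 1 (\<lambda>\<eta>. F \<eta> $ 3) \<xi>,
     partial 1 (\<lambda>\<eta>. F \<eta> $ 2) \<xi> - partial 2 (\<lambda>\<eta>. F \<eta> $ 1) \<xi>]"

definition p_field :: "3 \<Rightarrow> real^3 \<Rightarrow> real^3"
  where "p_field i \<xi> = (1 / 2) *\<^sub>R cross3 (axis i 1) \<xi>"

definition f_field :: "3 \<Rightarrow> real^3 \<Rightarrow> real^3"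
  where "f_field i = rot (\<lambda>\<xi>. gaussian \<xi> *\<^sub>R axis i 1)"

definition first_moment :: "3 \<Rightarrow> (real^3 \<Rightarrow> real^3) \<Rightarrow> real"
  where "first_moment i w0 = (LINT \<xi>|lborel. p_field i \<xi> \<bullet> w0 \<xi>)"

lemma partial_gaussian_mult:
  "partial j (\<lambda>\<eta>. gaussian \<eta> * c) \<xi> = - (\<xi> $ j / 2) * gaussian \<xi> * c"
proof -
  have "((\<lambda>\<eta>. gaussian \<eta> * c) has_derivative (\<lambda>h. - (\<xi> \<bullet> h / 2) * gaussian \<xi> * c)) (at \<xi>)"
    unfolding gaussian_def power2_norm_eq_inner
    by (auto intro!: derivative_eq_intros simp: inner_commute algebra_simps)
  then have "frechet_derivative (\<lambda>\<eta>. gaussian \<eta> * c) (at \<xi>) = (\<lambda>h. - (\<xi> \<bullet> h / 2) * gaussian \<xi> * c)"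
    by (rule frechet_derivative_at [symmetric])
  then show ?thesis
    by (simp add: partial_def inner_axis)
qed

lemma f_field_eq: "f_field i \<xi> = gaussian \<xi> *\<^sub>R p_field i \<xi>"
  using exhaust_3 [of i]
  by (auto simp: f_field_def rot_def p_field_def partial_gaussian_mult cross3_def vec_eq_iff
      forall_3 axis_def)

end

theory Submission
  imports Defs
begin

text \<open>
  In self-similar variables the linear semigroup is a convolution with a rescaled Gaussian. With
  \<open>\<epsilon> = exp (- t / 2)\<close> and \<open>a = 1 - \<epsilon>^2\<close>, the function \<open>exp_Lambda t f\<close> is \<open>\<epsilon>\<close> times the integral
  of \<open>heat a (x - \<epsilon> y) f(y)\<close> over \<open>y\<close> (\<open>exp_Lambda_eq\<close>). For large \<open>t\<close> the kernel depends slowly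
  on \<open>y\<close>, so its Taylor expansion in \<open>\<epsilon> y\<close> turns moment conditions on \<open>f\<close> into decay: each further
  order of vanishing moments gains a factor \<open>\<epsilon> = exp (- t / 2)\<close>.

  Linear part. A divergence-free field has mean zero, and its matrix of first moments is
  antisymmetric (\<open>solenoidal_mean_zero\<close>, \<open>solenoidal_first_moments_antisym\<close>). Hence the zeroth
  order Taylor term of the initial field disappears, and the first order term is exactly the
  profile \<open>\<Sum> b_i exp (- \<tau>) f_i\<close> (\<open>profile_component\<close>, \<open>linear_part_eq\<close>). The remainder is of
  second order. Interpolated to order \<open>2\<nu> - 1 \<le> 2\<close> it is controlled by the moment of that order,
  finite because \<open>m > 2\<nu> + 1/2\<close>, and has norm at most a multiple of
  \<open>\<epsilon> \<epsilon> powr (2\<nu> - 1) = exp (- \<nu>\<tau>)\<close> (\<open>linear_remainder_estimate\<close>).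

  Nonlinear part. The quadratic flux has mean zero too, because the integral of \<open>w \<times> v\<close> vanishes:
  inserting the Biot-Savart law and the Lagrange identity leaves a double integral that is
  antisymmetric under exchange of the variables and one that vanishes by the divergence condition
  (\<open>integral_cross_velocity_zero\<close>). So the Duhamel integrand gains a factor \<open>\<epsilon> powr (2\<nu> - 2)\<close>
  beyond the factor \<open>\<epsilon>^2\<close> of \<open>exp_Lambda_half\<close>, and decays like \<open>exp (- \<nu>(\<tau> - s))\<close> for \<open>\<tau> - s \<ge> 1\<close>
  (\<open>flux_long_time_estimate\<close>). For \<open>\<tau> - s \<le> 1\<close> its norm is at most a multiple of
  \<open>(\<tau> - s) powr (- 7/8)\<close>, which is integrable (\<open>flux_short_time_estimate\<close>). As the solution decays
  like \<open>exp (- s)\<close>, the flux decays like \<open>exp (- 2s)\<close>, and since \<open>\<nu> < 2\<close> the time integral is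
  bounded by a multiple of \<open>exp (- \<nu>\<tau>)\<close> (\<open>duhamel_estimate\<close>).

  Adding both parts proves the claim for \<open>\<tau> \<ge> 1\<close> (\<open>mild_solution_asymptotics\<close>); for \<open>\<tau> \<le> 1\<close> it is
  enough to bound the solution and the profile separately (\<open>difference_from_profile_bound\<close>).
\<close>

section \<open>Integrals over Euclidean space\<close>

text \<open>
  All norms are estimated through integrals of nonnegative functions with values in \<open>ennreal\<close>:
  they exist without any integrability assumption, so that finiteness is part of each estimate.
\<close>

abbreviation nn_lborel :: "('a::euclidean_space \<Rightarrow> ennreal) \<Rightarrow> ennreal"  (binder "NN " 10)
  where "nn_lborel f \<equiv> nn_integral lborel f"

lemma nn_integral_affine:
  fixes f :: "'a::euclidean_space \<Rightarrow> ennreal"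
  assumes [measurable]: "f \<in> borel_measurable borel" and c: "c \<noteq> 0"
  shows "(NN x. f x) = ennreal (\<bar>c\<bar> ^ DIM('a)) * (NN x. f (t + c *\<^sub>R x))"
  by (subst lborel_affine[OF c, of t])
     (simp add: nn_integral_density nn_integral_distr nn_integral_cmult)

lemma integral_affine:
  fixes f :: "'a::euclidean_space \<Rightarrow> real"
  assumes [measurable]: "f \<in> borel_measurable borel" and c: "c \<noteq> 0"
  shows "(LINT x|lborel. f x) = \<bar>c\<bar> ^ DIM('a) * (LINT x|lborel. f (t + c *\<^sub>R x))"
  by (subst lborel_affine[OF c, of t])
     (simp add: integral_density integral_distr)

lemma nn_integral_reflect_scale:
  fixes f :: "real^3 \<Rightarrow> ennreal"
  assumes [measurable]: "f \<in> borel_measurable borel" and c: "c > 0"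
  shows "(NN y. f (x - c *\<^sub>R y)) = ennreal (1 / c ^ 3) * (NN y. f y)"
proof -
  have "(NN y. f y) = ennreal (c ^ 3) * (NN y. f (x - c *\<^sub>R y))"
    using nn_integral_affine[of f "-c" x] c by simp
  then show ?thesis
    using c by (simp add: mult.assoc[symmetric] ennreal_mult[symmetric])
qed

lemma nn_integral_shift:
  fixes f :: "real^3 \<Rightarrow> ennreal"
  assumes [measurable]: "f \<in> borel_measurable borel"
  shows "(NN x. f (x - z)) = (NN y. f y)"
  using nn_integral_affine[of f 1 "-z"] by simp

lemma weighted_Cauchy_Schwarz:
  fixes h f g :: "'a \<Rightarrow> ennreal"
  assumes [measurable]: "h \<in> borel_measurable M" "f \<in> borel_measurable M" "g \<in> borel_measurable M"
  shows "(\<integral>\<^sup>+x. h x * f x * g x \<partial>M)^2 \<le> (\<integral>\<^sup>+x. h x * (f x)^2 \<partial>M) * (\<integral>\<^sup>+x. h x * (g x)^2 \<partial>M)"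
  using Cauchy_Schwarz_nn_integral[of f "density M h" g]
  by (simp add: nn_integral_density mult.assoc)

lemma nn_Tonelli:
  assumes "case_prod f \<in> borel_measurable (lborel \<Otimes>\<^sub>M lborel)"
  shows "(\<integral>\<^sup>+y. \<integral>\<^sup>+x. f x y \<partial>(lborel :: 'a::euclidean_space measure) \<partial>(lborel :: 'b::euclidean_space measure))
    = (NN x. NN y. f x y)"
  using assms by (rule lborel_pair.Fubini')

text \<open>
  Apply Cauchy-Schwarz with weight \<open>K x\<close>, then Tonelli. The second factor \<open>g\<close> is paired with the
  kernel before the supremum over \<open>x\<close> is taken: for the quadratic flux, \<open>g\<close> is a bound of the
  velocity, which may be infinite at some points, whereas its square is integrable against the
  kernels that occur.
\<close>

lemma schur_test:
  fixes K :: "real^3 \<Rightarrow> real^3 \<Rightarrow> ennreal"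
  assumes [measurable]: "case_prod K \<in> borel_measurable (lborel \<Otimes>\<^sub>M lborel)"
    "f \<in> borel_measurable lborel" "g \<in> borel_measurable lborel"
    and S: "\<And>x. (NN y. K x y * (g y)^2) \<le> S"
    and B: "\<And>y. (NN x. K x y) \<le> B"
  shows "(NN x. (NN y. K x y * f y * g y)^2) \<le> S * B * (NN y. (f y)^2)"
proof -
  have "(NN x. (NN y. K x y * f y * g y)^2)
     \<le> (NN x. (NN y. K x y * (f y)^2) * S)"
  proof (rule nn_integral_mono)
    fix x
    have "(NN y. K x y * f y * g y)^2
      \<le> (NN y. K x y * (f y)^2) * (NN y. K x y * (g y)^2)"
      by (rule weighted_Cauchy_Schwarz) measurable
    also have "\<dots> \<le> (NN y. K x y * (f y)^2) * S"
      by (intro mult_left_mono S) simp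
    finally show "(NN y. K x y * f y * g y)^2 \<le> \<dots>" .
  qed
  also have "\<dots> = (NN x. (NN y. K x y * (f y)^2)) * S"
    by (rule nn_integral_multc) measurable
  also have "(NN x. (NN y. K x y * (f y)^2))
      = (NN y. (NN x. K x y) * (f y)^2)"
    by (subst nn_Tonelli[symmetric], measurable) (intro nn_integral_cong nn_integral_multc, measurable)
  also have "\<dots> * S \<le> (NN y. B * (f y)^2) * S"
    by (intro mult_right_mono nn_integral_mono B) simp_all
  also have "(NN y. B * (f y)^2) = B * (NN y. (f y)^2)"
    by (rule nn_integral_cmult) measurable
  finally show ?thesis
    by (simp only: mult_ac)
qed

section \<open>Weights and weighted norms\<close>

lemma rho_ge_1: "rho x \<ge> 1"
  by (simp add: rho_def)

lemma rho_pos [simp]: "rho x > 0"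
  using rho_ge_1[of x] by linarith

lemma rho_nonneg [simp]: "rho x \<ge> 0"
  using rho_pos[of x] by linarith

lemma rho_powr_neg4_le_1: "rho x powr (-4) \<le> 1"
  using powr_mono2'[of "-4" 1 "rho x"] rho_ge_1[of x] by simp

lemma rho_measurable [measurable]: "rho \<in> borel_measurable borel"
  unfolding rho_def by measurable

lemma ennreal_term_le_suminf: "f k \<le> (\<Sum>k. f k :: ennreal)"
  using sum_le_suminf[of f "{k}"] by simp

text \<open>
  Integrability of power functions reduces to the volumes of dyadic balls: a function that is at
  each point below one of countably many multiples of indicators of balls is below their sum.
\<close>

lemma nn_integral_finite_of_balls:
  fixes f :: "real^3 \<Rightarrow> ennreal"
  assumes c: "\<And>k. c k \<ge> 0" and r: "\<And>k. r k \<ge> 0" and sum: "summable (\<lambda>k. c k * r k ^ 3)"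
    and dom: "\<And>x. \<exists>k. f x \<le> ennreal (c k) * indicator (ball 0 (r k)) x"
  shows "(NN x. f x) < \<infinity>"
proof -
  define v where "v = unit_ball_vol (real DIM(real^3))"
  have v: "v \<ge> 0" by (simp add: v_def)
  have le: "f x \<le> (\<Sum>k. ennreal (c k) * indicator (ball (0::real^3) (r k)) x)" for x
  proof -
    obtain k where "f x \<le> ennreal (c k) * indicator (ball 0 (r k)) x" using dom by blast
    then show ?thesis
      using ennreal_term_le_suminf[of "\<lambda>k. ennreal (c k) * indicator (ball 0 (r k)) x" k] by (rule order_trans)
  qed
  have "(NN x. f x) \<le> (NN x. (\<Sum>k. ennreal (c k) * indicator (ball (0::real^3) (r k)) x))"
    by (rule nn_integral_mono) (rule le)
  also have "\<dots> = (\<Sum>k. NN x. ennreal (c k) * indicator (ball (0::real^3) (r k)) x)"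
    by (rule nn_integral_suminf, rule borel_measurable_times_ennreal) (auto intro!: borel_measurable_indicator)
  also have "(\<lambda>k. NN x. ennreal (c k) * indicator (ball (0::real^3) (r k)) x) = (\<lambda>k. ennreal (v * (c k * r k ^ 3)))"
  proof
    fix k
    have "(NN x. ennreal (c k) * indicator (ball (0::real^3) (r k)) x) = ennreal (c k) * ennreal (v * r k ^ 3)"
      using emeasure_ball[OF r[of k], of "0::real^3"] by (subst nn_integral_cmult_indicator) (simp_all add: v_def)
    also have "\<dots> = ennreal (v * (c k * r k ^ 3))"
      using c[of k] r[of k] v by (subst ennreal_mult[symmetric]) (simp_all add: mult_ac)
    finally show "(NN x. ennreal (c k) * indicator (ball (0::real^3) (r k)) x) = ennreal (v * (c k * r k ^ 3))" .
  qed
  also have "(\<Sum>k. ennreal (v * (c k * r k ^ 3))) < \<infinity>"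
    using summable_mult[OF sum, of v] by (subst suminf_ennreal2) (auto simp: v c r)
  finally show ?thesis .
qed

lemma summable_geometric_powr:
  assumes "p < 0"
  shows "summable (\<lambda>k. (2::real) powr (p * real k))"
proof -
  have "2 powr p < (1::real)" using assms powr_less_mono[of p 0 "2::real"] by simp
  then have "summable (\<lambda>k. ((2::real) powr p) ^ k)" by (intro summable_geometric) simp
  then show ?thesis by (simp add: powr_powr flip: powr_realpow)
qed

lemma nn_integral_rho_powr_finite:
  assumes "p > 3"
  shows "(NN x. ennreal (rho x powr (-p))) < \<infinity>"
proof (rule nn_integral_finite_of_balls[where c="\<lambda>k. 2 powr (- p * real k)" and r="\<lambda>k. 2 powr (real k + 1)"])
  have "2 powr (- p * real k) * (2 powr (real k + 1)) ^ 3 = 8 * 2 powr ((3 - p) * real k)" for k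
  proof -
    have "(2 powr (real k + 1)) ^ 3 = (2::real) powr (3 * real k + 3)"
      by (simp add: powr_powr algebra_simps flip: powr_realpow)
    then have "2 powr (- p * real k) * (2 powr (real k + 1)) ^ 3 = (2::real) powr (- p * real k + (3 * real k + 3))"
      by (simp only: powr_add)
    also have "- p * real k + (3 * real k + 3) = 3 + (3 - p) * real k" by (simp add: algebra_simps)
    finally show ?thesis by (simp add: powr_add)
  qed
  then show "summable (\<lambda>k. 2 powr (- p * real k) * (2 powr (real k + 1)) ^ 3)"
    using summable_mult[OF summable_geometric_powr[of "3 - p"], of 8] assms by simp
  fix x :: "real^3"
  \<comment> \<open>The dyadic scale of \<open>rho x\<close>, which fixes the value up to a factor \<open>2 powr p\<close>.\<close>
  define k where "k = nat \<lfloor>log 2 (rho x)\<rfloor>"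
  have "real k \<le> log 2 (rho x)" "log 2 (rho x) < real k + 1"
    using rho_ge_1[of x] unfolding k_def by simp_all
  then have k: "2 powr real k \<le> rho x" "rho x < 2 powr (real k + 1)"
    by (auto simp: le_log_iff log_less_iff)
  then have "rho x powr (-p) \<le> (2 powr real k) powr (-p)"
    using assms by (intro powr_mono2') auto
  then have "rho x powr (-p) \<le> 2 powr (- p * real k)" by (simp add: powr_powr mult.commute)
  then have "ennreal (rho x powr (-p)) \<le> ennreal (2 powr (- p * real k)) * indicator (ball 0 (2 powr (real k + 1))) x"
    using k(2) by (simp add: rho_def ennreal_leI)
  then show "\<exists>k. ennreal (rho x powr (-p)) \<le> ennreal (2 powr (- p * real k)) * indicator (ball 0 (2 powr (real k + 1))) x" ..
qed simp_all

lemma nn_integral_norm_powr_ball_finite: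
  assumes "q < 3" "q \<ge> 0"
  shows "(NN x. ennreal (if norm (x :: real^3) < 1 then norm x powr (-q) else 0)) < \<infinity>"
proof (rule nn_integral_finite_of_balls[where c="\<lambda>k. 2 powr (q * real k)" and r="\<lambda>k. 2 powr (1 - real k)"])
  have "2 powr (q * real k) * (2 powr (1 - real k)) ^ 3 = 8 * 2 powr ((q - 3) * real k)" for k
  proof -
    have "(2 powr (1 - real k)) ^ 3 = (2::real) powr (3 - 3 * real k)"
      by (simp add: powr_powr algebra_simps flip: powr_realpow)
    then have "2 powr (q * real k) * (2 powr (1 - real k)) ^ 3 = (2::real) powr (q * real k + (3 - 3 * real k))"
      by (simp only: powr_add)
    also have "q * real k + (3 - 3 * real k) = 3 + (q - 3) * real k" by (simp add: algebra_simps)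
    finally show ?thesis by (simp add: powr_add)
  qed
  then show "summable (\<lambda>k. 2 powr (q * real k) * (2 powr (1 - real k)) ^ 3)"
    using summable_mult[OF summable_geometric_powr[of "q - 3"], of 8] assms by simp
  fix x :: "real^3"
  show "\<exists>k. ennreal (if norm x < 1 then norm x powr (-q) else 0) \<le> ennreal (2 powr (q * real k)) * indicator (ball 0 (2 powr (1 - real k))) x"
  proof (cases "x = 0 \<or> norm x \<ge> 1")
    case False
    then have n: "norm x > 0" "norm x < 1" by auto
    define k where "k = nat \<lceil>- log 2 (norm x)\<rceil>"
    have "- log 2 (norm x) \<ge> 0" using n by simp
    then have "- log 2 (norm x) \<le> real k" "real k - 1 < - log 2 (norm x)"
      unfolding k_def by linarith+
    then have "- real k \<le> log 2 (norm x)" "log 2 (norm x) < 1 - real k" by linarith+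
    then have k: "2 powr (- real k) \<le> norm x" "norm x < 2 powr (1 - real k)"
      using n by (auto simp: le_log_iff log_less_iff)
    then have "norm x powr (-q) \<le> (2 powr (-real k)) powr (-q)"
      using assms by (intro powr_mono2') auto
    then have "norm x powr (-q) \<le> 2 powr (q * real k)" by (simp add: powr_powr mult.commute)
    then have "ennreal (if norm x < 1 then norm x powr (-q) else 0) \<le> ennreal (2 powr (q * real k)) * indicator (ball 0 (2 powr (1 - real k))) x"
      using k(2) by (simp add: ennreal_leI)
    then show ?thesis ..
  qed auto
qed simp_all

lemma ennreal_le_of_square_le:
  assumes "X^2 \<le> ennreal (a^2)" "a \<ge> 0"
  shows "X \<le> ennreal a"
proof (cases X)
  case (real r)
  then have "ennreal (r^2) \<le> ennreal (a^2)"
    using assms by (simp add: ennreal_power)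
  then have "r^2 \<le> a^2" by (simp add: ennreal_le_iff)
  then have "r \<le> a" using assms(2) by (rule power2_le_imp_le)
  then show ?thesis using real by (simp add: ennreal_leI)
next
  case top
  then show ?thesis using assms by (simp add: ennreal_top_eq_mult_iff power2_eq_square top_unique)
qed

lemma ennreal_square_add_le: "(x + y)^2 \<le> 2 * x^2 + 2 * (y::ennreal)^2"
proof (cases "x = top \<or> y = top")
  case True
  then have "2 * x^2 + 2 * y^2 = top"
    by (auto simp: power2_eq_square ennreal_mult_top ennreal_top_mult)
  then show ?thesis by (metis top_greatest)
next
  case False
  then obtain a b where ab: "x = ennreal a" "a \<ge> 0" "y = ennreal b" "b \<ge> 0"
    by (metis ennreal_cases)
  have "(a + b)^2 \<le> 2 * a^2 + 2 * b^2"
    using sum_squares_ge_zero[of "a - b" 0] by (simp add: power2_eq_square algebra_simps)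
  then have "ennreal ((a + b)^2) \<le> ennreal (2 * a^2 + 2 * b^2)"
    by (rule ennreal_leI)
  also have "\<dots> = 2 * x^2 + 2 * y^2"
    using ab by (simp add: ennreal_plus ennreal_mult ennreal_power ennreal_numeral[symmetric] del: ennreal_numeral)
  finally show ?thesis
    using ab by (simp add: ennreal_power flip: ennreal_plus)
qed

lemma Cauchy_Schwarz_bound:
  assumes [measurable]: "f \<in> borel_measurable M" "g \<in> borel_measurable M"
    and "(\<integral>\<^sup>+x. (f x)^2 \<partial>M) \<le> ennreal (A^2)" "(\<integral>\<^sup>+x. (g x)^2 \<partial>M) \<le> ennreal (B^2)"
    and "A \<ge> 0" "B \<ge> 0"
  shows "(\<integral>\<^sup>+x. f x * g x \<partial>M) \<le> ennreal (A * B)"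
proof (rule ennreal_le_of_square_le)
  have "(\<integral>\<^sup>+x. f x * g x \<partial>M)^2 \<le> (\<integral>\<^sup>+x. (f x)^2 \<partial>M) * (\<integral>\<^sup>+x. (g x)^2 \<partial>M)"
    by (rule Cauchy_Schwarz_nn_integral) measurable
  also have "\<dots> \<le> ennreal (A^2) * ennreal (B^2)"
    by (intro mult_mono assms) simp_all
  finally show "(\<integral>\<^sup>+x. f x * g x \<partial>M)^2 \<le> ennreal ((A * B)^2)"
    by (simp add: ennreal_mult power_mult_distrib)
qed (use assms in simp)

text \<open>
  Bounds are later used both linearly and as squares of norms; a constant \<open>\<ge> 1\<close> serves both
  purposes.
\<close>

lemma finite_ennreal_bound:
  assumes "X < (\<infinity>::ennreal)"
  obtains c where "c \<ge> 1" "X \<le> ennreal (c^2)" "X \<le> ennreal c"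
proof -
  obtain r where r: "X = ennreal r" "r \<ge> 0"
    using assms by (cases X) auto
  let ?c = "max 1 r"
  have "?c \<le> ?c^2"
    by (rule self_le_power) simp_all
  then have "r \<le> ?c^2" by linarith
  then show ?thesis
    using r by (intro that[of ?c]) (simp_all add: ennreal_leI)
qed

text \<open>
  The norm \<open>weighted_norm\<close> is defined by a Bochner integral, which is 0 for a function of infinite
  norm. This predicate states the inequality \<open>weighted_norm m w \<le> N\<close> without that default value.
\<close>

definition weighted_bound :: "real \<Rightarrow> (real^3 \<Rightarrow> real^3) \<Rightarrow> real \<Rightarrow> bool"
  where "weighted_bound m w N \<longleftrightarrow> w \<in> borel_measurable borel \<and> N \<ge> 0 \<and>
    (NN x. ennreal ((rho x powr m * norm (w x))^2)) \<le> ennreal (N^2)"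

lemma weighted_boundD:
  assumes "weighted_bound m w N"
  shows "w \<in> borel_measurable borel" "N \<ge> 0"
    "(NN x. (ennreal (rho x powr m * norm (w x)))^2) \<le> ennreal (N^2)"
  using assms by (simp_all add: weighted_bound_def ennreal_power)

text \<open>
  Cauchy-Schwarz against \<open>rho powr (q - m)\<close>, which is square integrable on \<open>\<real>\<^sup>3\<close> because
  \<open>2 (m - q) > 3\<close>.
\<close>

lemma weighted_moment_bound:
  assumes "2 * (m - q) > 3"
  shows "\<exists>C\<ge>1. \<forall>w N. weighted_bound m w N \<longrightarrow>
    (NN x. ennreal (rho x powr q * norm (w x))) \<le> ennreal (C * N)"
proof -
  obtain C where C: "C \<ge> 1" "(NN x. ennreal (rho x powr (- (2 * (m - q))))) \<le> ennreal (C^2)"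
    using finite_ennreal_bound[OF nn_integral_rho_powr_finite[OF assms]] by metis
  show ?thesis
  proof (intro exI[of _ C] conjI allI impI C(1))
    fix w N assume w: "weighted_bound m w N"
    note [measurable] = weighted_boundD(1)[OF w]
    have eq: "ennreal (rho x powr q * norm (w x))
        = ennreal (rho x powr (q - m)) * ennreal (rho x powr m * norm (w x))" for x
      by (simp add: ennreal_mult[symmetric] mult.assoc[symmetric] powr_add[symmetric])
    have sq: "(ennreal (rho x powr (q - m)))^2 = ennreal (rho x powr (- (2 * (m - q))))" for x
    proof -
      have "(rho x powr (q - m))^2 = rho x powr (- (2 * (m - q)))"
        by (simp add: power2_eq_square powr_add[symmetric])
      then show ?thesis by (simp add: ennreal_power)
    qed
    show "(NN x. ennreal (rho x powr q * norm (w x))) \<le> ennreal (C * N)"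
      unfolding eq
      by (rule Cauchy_Schwarz_bound) (use C w weighted_boundD[OF w] in \<open>simp_all add: sq\<close>)
  qed
qed

lemma weighted_bound_L2:
  assumes "weighted_bound m w N" "m \<ge> 0"
  shows "(NN x. (ennreal (norm (w x)))^2) \<le> ennreal (N^2)"
proof -
  have "(NN x. (ennreal (norm (w x)))^2)
      \<le> (NN x. (ennreal (rho x powr m * norm (w x)))^2)"
  proof (intro nn_integral_mono power_mono ennreal_leI)
    fix x
    have "1 \<le> rho x powr m" using rho_ge_1 assms by (simp add: ge_one_powr_ge_zero)
    then show "norm (w x) \<le> rho x powr m * norm (w x)"
      using mult_right_mono[of 1 "rho x powr m" "norm (w x)"] by simp
  qed simp_all
  also have "\<dots> \<le> ennreal (N^2)" by (rule weighted_boundD[OF assms(1)])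
  finally show ?thesis .
qed

lemma rho_neq_0 [simp]: "rho x \<noteq> 0"
  using rho_pos[of x] by linarith

section \<open>The Biot-Savart potential\<close>

text \<open>
  The Biot-Savart kernel has size \<open>1 / norm (x - y)^2\<close>, so this Riesz potential of \<open>norm \<circ> w\<close>
  dominates the velocity field. Being a nonnegative integral it is defined at every point,
  including those where the Biot-Savart integral diverges.
\<close>

definition riesz :: "(real^3 \<Rightarrow> real^3) \<Rightarrow> real^3 \<Rightarrow> ennreal"
  where "riesz w x = (NN y. ennreal (norm (w y) / (norm (x - y))^2))"

text \<open>
  The potential is split at distance 1. Near the singularity different powers of the distance are
  needed, as the exponent is distributed by Cauchy-Schwarz; away from it only the exponent 2
  occurs.
\<close>

definition near :: "real \<Rightarrow> real^3 \<Rightarrow> ennreal"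
  where "near s x = ennreal (if norm x < 1 then norm x powr (-s) else 0)"

definition far :: "real^3 \<Rightarrow> ennreal"
  where "far x = ennreal (if norm x < 1 then 0 else norm x powr (-2))"

lemma near_measurable [measurable]: "near s \<in> borel_measurable borel"
  unfolding near_def by measurable

lemma far_measurable [measurable]: "far \<in> borel_measurable borel"
  unfolding far_def by measurable

lemma riesz_measurable [measurable]:
  assumes [measurable]: "w \<in> borel_measurable borel"
  shows "riesz w \<in> borel_measurable borel"
  unfolding riesz_def by measurable

lemma near_power: "near (s + t) x = near s x * near t x"
  by (auto simp: near_def ennreal_mult[symmetric] powr_add[symmetric])

lemma near_square: "(near s x)^2 = near (2 * s) x"
  using near_power[of s s x] by (simp add: power2_eq_square)

lemma near_minus: "near s (x - y) = near s (y - x)"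
  by (simp add: near_def norm_minus_commute)

lemma far_square_le: "(far x)^2 \<le> ennreal (16 * rho x powr (-4))"
proof (cases "norm x < 1")
  case False
  have "norm x powr (-4) \<le> (rho x / 2) powr (-4)"
    using False by (intro powr_mono2') (auto simp: rho_def)
  also have "\<dots> = 16 * rho x powr (-4)"
    by (simp add: powr_divide powr_minus divide_simps)
  finally have "(norm x powr (-2))^2 \<le> 16 * rho x powr (-4)"
    by (simp add: power2_eq_square powr_add[symmetric])
  then show ?thesis
    using False by (simp add: far_def ennreal_power ennreal_leI)
qed (simp add: far_def)

lemma riesz_split:
  assumes [measurable]: "w \<in> borel_measurable borel"
  shows "riesz w x = (NN y. near 2 (x - y) * ennreal (norm (w y)))
    + (NN y. far (x - y) * ennreal (norm (w y)))"
proof -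
  have "ennreal (norm (w y) / (norm (x - y))^2)
     = near 2 (x - y) * ennreal (norm (w y)) + far (x - y) * ennreal (norm (w y))" for y
    by (auto simp: near_def far_def powr_minus powr_numeral divide_inverse
        ennreal_mult[symmetric] mult.commute)
  then show ?thesis
    unfolding riesz_def by (simp add: nn_integral_add)
qed

lemma near_finite:
  assumes "0 \<le> s" "s < 3"
  obtains c where "c \<ge> 1" "\<And>x. (NN y. near s (x - y)) \<le> ennreal c"
    "\<And>x. (NN y. near s (y - x)) \<le> ennreal c"
    "\<And>x. (NN y. near s (y - x)) \<le> ennreal (c^2)"
proof -
  have "(NN y. near s y) < \<infinity>"
    using nn_integral_norm_powr_ball_finite[of s] assms by (simp add: near_def)
  from finite_ennreal_bound[OF this] obtain c where
    c: "c \<ge> 1" "(NN y. near s y) \<le> ennreal (c^2)" "(NN y. near s y) \<le> ennreal c"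
    by metis
  have 1: "(NN y. near s (y - x)) = (NN y. near s y)" for x
    by (rule nn_integral_shift) measurable
  have 2: "(NN y. near s (x - y)) = (NN y. near s y)" for x
    using 1[of x] by (simp add: near_minus)
  show ?thesis
    using c 1 2 by (intro that[of c]) simp_all
qed

text \<open>
  Tonelli moves the convolution with \<open>K\<close> from \<open>g\<close> to the test function \<open>h\<close>.
\<close>

lemma nn_convolution_duality:
  fixes h K g :: "real^3 \<Rightarrow> ennreal"
  assumes [measurable]: "h \<in> borel_measurable borel" "K \<in> borel_measurable borel" "g \<in> borel_measurable borel"
    and K: "\<And>y. (NN x. h x * K (x - y)) \<le> ennreal A" and g: "(NN y. g y) \<le> ennreal G"
    and pos: "A \<ge> 0" "G \<ge> 0" "c \<ge> 0"
  shows "(NN x. h x * (ennreal c * (NN y. K (x - y) * g y))) \<le> ennreal (c * A * G)"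
proof -
  have "h x * (ennreal c * (NN y. K (x - y) * g y)) = ennreal c * (NN y. h x * K (x - y) * g y)" for x
  proof -
    have "(NN y. h x * K (x - y) * g y) = h x * (NN y. K (x - y) * g y)"
      unfolding mult.assoc by (rule nn_integral_cmult) measurable
    then show ?thesis by (simp only: mult.left_commute)
  qed
  then have "(NN x. h x * (ennreal c * (NN y. K (x - y) * g y))) = ennreal c * (NN x. NN y. h x * K (x - y) * g y)"
    by (simp add: nn_integral_cmult)
  also have "(NN x. NN y. h x * K (x - y) * g y) = (NN y. (NN x. h x * K (x - y)) * g y)"
    by (subst nn_Tonelli[symmetric], measurable) (intro nn_integral_cong nn_integral_multc, measurable)
  also have "\<dots> \<le> (NN y. ennreal A * g y)"
    by (intro nn_integral_mono mult_right_mono K) simp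
  also have "\<dots> = ennreal A * (NN y. g y)" by (rule nn_integral_cmult) measurable
  also have "\<dots> \<le> ennreal A * ennreal G" by (intro mult_left_mono g) simp
  finally have "(NN x. h x * (ennreal c * (NN y. K (x - y) * g y))) \<le> ennreal c * (ennreal A * ennreal G)"
    by (simp add: mult_left_mono)
  then show ?thesis using pos by (simp add: ennreal_mult mult.assoc)
qed

text \<open>
  A bound for the square of the velocity tested against \<open>h\<close>. Near the singularity Cauchy-Schwarz
  is applied with \<open>2 = 4/3 + 2/3\<close>: then \<open>r powr (-4/3) (r powr (-2/3))^2 = r powr (-8/3)\<close> is still
  integrable, and the other factor carries the exponent \<open>4/3\<close>, so that \<open>h\<close> has to be integrated
  only against \<open>norm (x - y) powr (-4/3)\<close>. Far from it, Cauchy-Schwarz with weight \<open>norm \<circ> w\<close> uses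
  that \<open>w\<close> is integrable.
\<close>

lemma riesz_duality_bound:
  assumes m: "m > 3 / 2"
  shows "\<exists>C\<ge>1. \<forall>w N h A. weighted_bound m w N \<longrightarrow> h \<in> borel_measurable borel \<longrightarrow> A \<ge> 0 \<longrightarrow>
    (\<forall>y. (NN x. h x * near (4/3) (x - y)) \<le> ennreal A) \<longrightarrow>
    (\<forall>y. (NN x. h x * ennreal (rho (x - y) powr (-4))) \<le> ennreal A) \<longrightarrow>
    (NN x. h x * (riesz w x)^2) \<le> ennreal (C * A * N^2)"
proof -
  obtain c0 where c0: "c0 \<ge> 1" "\<And>w N. weighted_bound m w N \<Longrightarrow> (NN x. ennreal (norm (w x))) \<le> ennreal (c0 * N)"
    using weighted_moment_bound[of m 0] m by auto
  obtain c1 where c1: "c1 \<ge> 1" "\<And>x. (NN y. near (8/3) (x - y)) \<le> ennreal c1"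
    by (rule near_finite[of "8/3"], simp, simp) (rule that; assumption)
  show ?thesis
  proof (intro exI[of _ "2 * c1 + 32 * c0^2"] conjI allI impI)
    show "2 * c1 + 32 * c0^2 \<ge> 1" using c1(1) by (simp add: add_increasing2)
    fix w :: "real^3 \<Rightarrow> real^3" and h :: "real^3 \<Rightarrow> ennreal" and N A :: real
    assume w: "weighted_bound m w N" and [measurable]: "h \<in> borel_measurable borel" and A: "A \<ge> 0"
      and hn: "\<forall>y. (NN x. h x * near (4/3) (x - y)) \<le> ennreal A"
      and hr: "\<forall>y. (NN x. h x * ennreal (rho (x - y) powr (-4))) \<le> ennreal A"
    note [measurable] = weighted_boundD(1)[OF w]
    have N: "N \<ge> 0" by (rule weighted_boundD[OF w])
    let ?W = "\<lambda>y. ennreal (norm (w y))"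
    let ?near = "\<lambda>x. ennreal c1 * (NN y. near (4/3) (x - y) * (?W y)^2)"
    let ?far = "\<lambda>x. ennreal (16 * c0 * N) * (NN y. ennreal (rho (x - y) powr (-4)) * ?W y)"
    have near_sq: "(NN y. near 2 (x - y) * ?W y)^2 \<le> ?near x" for x :: "real^3"
    proof -
      have "(NN y. near 2 (x - y) * ?W y)^2 = (NN y. near (4/3) (x - y) * (near (2/3) (x - y)) * ?W y)^2"
        using near_power[of "4/3" "2/3"] by simp
      also have "\<dots> \<le> (NN y. near (4/3) (x - y) * (near (2/3) (x - y))^2) * (NN y. near (4/3) (x - y) * (?W y)^2)"
        by (rule weighted_Cauchy_Schwarz) measurable
      also have "(NN y. near (4/3) (x - y) * (near (2/3) (x - y))^2) = (NN y. near (8/3) (x - y))"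
        using near_power[of "4/3" "4/3"] by (simp add: near_square)
      also have "\<dots> * (NN y. near (4/3) (x - y) * (?W y)^2) \<le> ?near x"
        by (intro mult_right_mono c1) simp
      finally show ?thesis .
    qed
    have far_sq: "(NN y. far (x - y) * ?W y)^2 \<le> ?far x" for x
    proof -
      have "(NN y. ?W y * far (x - y) * 1)^2 \<le> (NN y. ?W y * (far (x - y))^2) * (NN y. ?W y * 1^2)"
        by (rule weighted_Cauchy_Schwarz) measurable
      also have "\<dots> \<le> (NN y. ?W y * ennreal (16 * rho (x - y) powr (-4))) * ennreal (c0 * N)"
        using c0(2)[OF w] by (intro mult_mono nn_integral_mono far_square_le) simp_all
      also have "(NN y. ?W y * ennreal (16 * rho (x - y) powr (-4))) = ennreal 16 * (NN y. ennreal (rho (x - y) powr (-4)) * ?W y)"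
        by (subst nn_integral_cmult[symmetric], measurable) (simp add: ennreal_mult mult_ac)
      also have "ennreal 16 * (NN y. ennreal (rho (x - y) powr (-4)) * ?W y) * ennreal (c0 * N) = ?far x"
      proof -
        have "ennreal (16 * c0 * N) = ennreal 16 * ennreal (c0 * N)"
          using c0(1) N by (subst ennreal_mult[symmetric]) (simp_all add: mult.assoc)
        then show ?thesis by (simp only: mult_ac)
      qed
      finally show ?thesis by (simp add: mult.commute[of "?W _"])
    qed
    have "(NN x. h x * (riesz w x)^2) \<le> (NN x. h x * (2 * ?near x + 2 * ?far x))"
    proof (intro nn_integral_mono mult_left_mono)
      fix x
      have "(riesz w x)^2 \<le> 2 * (NN y. near 2 (x - y) * ?W y)^2 + 2 * (NN y. far (x - y) * ?W y)^2"
        unfolding riesz_split[OF weighted_boundD(1)[OF w]] by (rule ennreal_square_add_le)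
      also have "\<dots> \<le> 2 * ?near x + 2 * ?far x"
        by (intro add_mono mult_left_mono near_sq far_sq) simp_all
      finally show "(riesz w x)^2 \<le> 2 * ?near x + 2 * ?far x" .
    qed simp
    also have "\<dots> = 2 * (NN x. h x * ?near x) + 2 * (NN x. h x * ?far x)"
      by (simp add: nn_integral_add nn_integral_cmult distrib_left mult.left_commute[of "h _" 2])
    also have "\<dots> \<le> 2 * ennreal (c1 * A * N^2) + 2 * ennreal (16 * c0 * N * A * (c0 * N))"
      using c0 c1(1) N A hn hr weighted_bound_L2[OF w] m w
      by (intro add_mono mult_left_mono nn_convolution_duality) auto
    also have "\<dots> = ennreal (2 * (c1 * A * N^2) + 2 * (16 * c0 * N * A * (c0 * N)))"
    proof -
      have "2 * ennreal u + 2 * ennreal v = ennreal (2 * u + 2 * v)" if "u \<ge> 0" "v \<ge> 0" for u v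
        using that by (simp add: ennreal_mult)
      then show ?thesis using c0(1) c1(1) N A by simp
    qed
    also have "2 * (c1 * A * N^2) + 2 * (16 * c0 * N * A * (c0 * N)) = (2 * c1 + 32 * c0^2) * A * N^2"
      by (simp add: power2_eq_square algebra_simps)
    finally show "(NN x. h x * (riesz w x)^2) \<le> ennreal ((2 * c1 + 32 * c0^2) * A * N^2)" .
  qed
qed

lemma riesz_L2_bound:
  assumes m: "m > 3 / 2"
  shows "\<exists>C\<ge>1. \<forall>w N. weighted_bound m w N \<longrightarrow> (NN x. (riesz w x)^2) \<le> ennreal ((C * N)^2)"
proof -
  obtain C where C: "C \<ge> 1" "\<And>w N h A. weighted_bound m w N \<Longrightarrow> h \<in> borel_measurable borel \<Longrightarrow> A \<ge> 0 \<Longrightarrow>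
    (\<forall>y. (NN x. h x * near (4/3) (x - y)) \<le> ennreal A) \<Longrightarrow>
    (\<forall>y. (NN x. h x * ennreal (rho (x - y) powr (-4))) \<le> ennreal A) \<Longrightarrow>
    (NN x. h x * (riesz w x)^2) \<le> ennreal (C * A * N^2)"
    using riesz_duality_bound[OF m] by blast
  obtain c1 where c1: "c1 \<ge> 1" "\<And>y. (NN x. near (4/3) (x - y)) \<le> ennreal c1"
    by (rule near_finite[of "4/3"], simp, simp) (rule that; assumption)
  obtain c2 where c2: "c2 \<ge> 1" "(NN x. ennreal (rho x powr (-4))) \<le> ennreal c2"
    using finite_ennreal_bound[OF nn_integral_rho_powr_finite[of 4]] by force
  define D where "D = C * (c1 + c2)"
  have D: "D \<ge> 1" unfolding D_def using C(1) c1(1) c2(1) by (intro mult_ge1_I) auto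
  show ?thesis
  proof (intro exI[of _ D] conjI allI impI D)
    fix w N assume w: "weighted_bound m w N"
    have "(NN x. 1 * near (4/3) (x - y)) \<le> ennreal (c1 + c2)" for y
      using order_trans[OF c1(2)[of y] ennreal_leI[of c1 "c1 + c2"]] c2(1) by simp
    moreover have "(NN x. 1 * ennreal (rho (x - y) powr (-4))) \<le> ennreal (c1 + c2)" for y
      using order_trans[OF c2(2) ennreal_leI[of c2 "c1 + c2"]] c1(1) nn_integral_shift[of "\<lambda>x. ennreal (rho x powr (-4))" y] by simp
    ultimately have "(NN x. 1 * (riesz w x)^2) \<le> ennreal (C * (c1 + c2) * N^2)"
      using c1(1) c2(1) by (intro C(2)[OF w]) auto
    also have "\<dots> \<le> ennreal ((D * N)^2)"
    proof (rule ennreal_leI)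
      have "D \<le> D^2" using D by (simp add: self_le_power)
      then show "C * (c1 + c2) * N^2 \<le> (D * N)^2"
        unfolding D_def[symmetric] power_mult_distrib by (intro mult_right_mono) auto
    qed
    finally show "(NN x. (riesz w x)^2) \<le> ennreal ((D * N)^2)" by simp
  qed
qed

text \<open>
  A bound of the square of the velocity in the dual of \<open>L\<^sup>1 \<inter> L\<^sup>2\<close>. The \<open>L\<^sup>2\<close> norm of \<open>h\<close> is
  enough near the singularity, because \<open>norm (x - y) powr (-4/3)\<close> is locally square integrable.
  This is what keeps the time singularity of the nonlinear term integrable: with a supremum of \<open>h\<close>
  in place of its \<open>L\<^sup>2\<close> norm, the heat kernel would produce a power of the time below \<open>- 1\<close>.
\<close>

lemma riesz_weighted_bound:
  assumes m: "m > 3 / 2"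
  shows "\<exists>C\<ge>1. \<forall>w N h A B. weighted_bound m w N \<longrightarrow> h \<in> borel_measurable borel \<longrightarrow> A \<ge> 0 \<longrightarrow> B \<ge> 0 \<longrightarrow>
    (NN x. h x) \<le> ennreal A \<longrightarrow> (NN x. (h x)^2) \<le> ennreal (B^2) \<longrightarrow>
    (NN x. h x * (riesz w x)^2) \<le> ennreal (C * (A + B) * N^2)"
proof -
  obtain C where C: "C \<ge> 1" "\<And>w N h A. weighted_bound m w N \<Longrightarrow> h \<in> borel_measurable borel \<Longrightarrow> A \<ge> 0 \<Longrightarrow>
    (\<forall>y. (NN x. h x * near (4/3) (x - y)) \<le> ennreal A) \<Longrightarrow>
    (\<forall>y. (NN x. h x * ennreal (rho (x - y) powr (-4))) \<le> ennreal A) \<Longrightarrow>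
    (NN x. h x * (riesz w x)^2) \<le> ennreal (C * A * N^2)"
    using riesz_duality_bound[OF m] by blast
  obtain c1 where c1: "c1 \<ge> 1" "\<And>y. (NN x. near (8/3) (x - y)) \<le> ennreal (c1^2)"
    by (rule near_finite[of "8/3"], simp, simp) (rule that; assumption)
  have C1: "C * c1 \<ge> 1" using C(1) c1(1) by (rule mult_ge1_I)
  show ?thesis
  proof (intro exI[of _ "C * c1"] conjI allI impI C1)
    fix w :: "real^3 \<Rightarrow> real^3" and h :: "real^3 \<Rightarrow> ennreal" and N A B :: real
    assume w: "weighted_bound m w N" and [measurable]: "h \<in> borel_measurable borel"
      and A: "A \<ge> 0" and B: "B \<ge> 0" and hA: "(NN x. h x) \<le> ennreal A" and hB: "(NN x. (h x)^2) \<le> ennreal (B^2)"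
    have "B * c1 \<le> (A + B) * c1" "A * 1 \<le> (A + B) * c1"
      using A B c1(1) by (intro mult_mono; simp)+
    then have le: "ennreal (B * c1) \<le> ennreal ((A + B) * c1)" "ennreal A \<le> ennreal ((A + B) * c1)"
      by (simp_all add: ennreal_leI)
    have "(NN x. h x * near (4/3) (x - y)) \<le> ennreal (B * c1)" for y
      by (rule Cauchy_Schwarz_bound) (use hB B c1 in \<open>simp_all add: near_square\<close>)
    then have 1: "(NN x. h x * near (4/3) (x - y)) \<le> ennreal ((A + B) * c1)" for y
      using le(1) by (rule order_trans)
    have 2: "(NN x. h x * ennreal (rho (x - y) powr (-4))) \<le> ennreal ((A + B) * c1)" for y
    proof -
      have "ennreal (rho z powr (-4)) \<le> 1" for z
        using ennreal_leI[OF rho_powr_neg4_le_1] by simp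
      then have "(NN x. h x * ennreal (rho (x - y) powr (-4))) \<le> (NN x. h x * 1)"
        by (intro nn_integral_mono mult_left_mono) auto
      also have "\<dots> \<le> ennreal ((A + B) * c1)" using order_trans[OF hA le(2)] by simp
      finally show ?thesis .
    qed
    have "(NN x. h x * (riesz w x)^2) \<le> ennreal (C * ((A + B) * c1) * N^2)"
      using 1 2 A B c1(1) by (intro C(2)[OF w]) auto
    then show "(NN x. h x * (riesz w x)^2) \<le> ennreal (C * c1 * (A + B) * N^2)" by (simp add: mult_ac)
  qed
qed

section \<open>Pointwise bounds for the heat kernel\<close>

definition heat :: "real \<Rightarrow> real^3 \<Rightarrow> real"
  where "heat a x = (4 * pi * a) powr (- 3 / 2) * exp (- ((norm x)^2 / (4 * a)))"

text \<open>
  The derivative of \<open>heat a\<close> at \<open>x\<close> in direction \<open>u\<close>.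
\<close>

definition heat_grad :: "real \<Rightarrow> real^3 \<Rightarrow> real^3 \<Rightarrow> real"
  where "heat_grad a u x = - ((u \<bullet> x) / (2 * a)) * heat a x"

text \<open>
  The remainder of the first order expansion of the kernel of the semigroup in \<open>\<epsilon> y\<close>. The first
  order term is taken with width 1 instead of \<open>1 - \<epsilon>^2\<close>, since the limit profile has a fixed
  width.
\<close>

abbreviation heat_remainder :: "real \<Rightarrow> real^3 \<Rightarrow> real^3 \<Rightarrow> real"
  where "heat_remainder \<epsilon> x y \<equiv>
    heat (1 - \<epsilon>^2) (x - \<epsilon> *\<^sub>R y) - heat (1 - \<epsilon>^2) x - \<epsilon> / 2 * (x \<bullet> y) * heat 1 x"

text \<open>
  The common majorant of the weighted kernels. The first summand bounds a Taylor remainder of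
  order \<open>p\<close> at \<open>x\<close>, and factorizes into functions of \<open>x\<close> and \<open>y\<close>. The second one appears only for
  \<open>\<epsilon> norm y > 1\<close>: there the kernel at \<open>x - \<epsilon> y\<close> is not compared with its value at \<open>x\<close>, and the
  weight at \<open>x\<close> is paid for by \<open>(\<epsilon> rho y) powr m\<close>. The exponents of decay make \<open>rho powr (-2)\<close>
  square integrable and \<open>rho powr (-4)\<close> integrable.
\<close>

abbreviation kernel_majorant :: "real \<Rightarrow> real \<Rightarrow> real \<Rightarrow> real^3 \<Rightarrow> real^3 \<Rightarrow> real"
  where "kernel_majorant m p \<epsilon> x y \<equiv>
    (\<epsilon> * rho y) powr p * rho x powr (-2) + (\<epsilon> * rho y) powr m * rho (x - \<epsilon> *\<^sub>R y) powr (-4)"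

lemma heat_1: "heat 1 = gaussian"
  by (auto simp: heat_def gaussian_def)

lemma heat_measurable [measurable]: "heat a \<in> borel_measurable borel"
  unfolding heat_def by measurable

lemma heat_grad_measurable [measurable]: "heat_grad a u \<in> borel_measurable borel"
  unfolding heat_grad_def by measurable

lemma heat_nonneg: "heat a x \<ge> 0"
  by (simp add: heat_def)

lemma rho_add_le: "rho (x + y) \<le> rho x * rho y"
proof -
  have "rho (x + y) \<le> 1 + norm x + norm y"
    using norm_triangle_ineq[of x y] by (simp add: rho_def)
  also have "\<dots> \<le> rho x * rho y" by (simp add: rho_def algebra_simps)
  finally show ?thesis .
qed

lemma rho_powr_add_le:
  assumes "m \<ge> 0"
  shows "rho x powr m \<le> rho (x - z) powr m * rho z powr m"
proof -
  have "rho x \<le> rho (x - z) * rho z"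
    using rho_add_le[of "x - z" z] by simp
  then have "rho x powr m \<le> (rho (x - z) * rho z) powr m"
    using assms by (intro powr_mono2) auto
  then show ?thesis by (simp add: powr_mult)
qed

text \<open>
  \<open>M ln (1 + r) \<le> M r \<le> r^2 / 4 + M^2\<close>.
\<close>

lemma exp_neg_square_le_rho_powr:
  assumes "M \<ge> 0"
  shows "exp (- ((norm x)^2 / 4)) \<le> exp (M^2) * rho x powr (-M)"
proof -
  have "rho x powr M = exp (M * ln (rho x))"
    by (simp add: powr_def)
  also have "\<dots> \<le> exp (M * norm x)"
    using assms ln_add_one_self_le_self[of "norm x"] by (simp add: rho_def mult_left_mono)
  also have "\<dots> \<le> exp ((norm x)^2 / 4 + M^2)"
    using zero_le_power2[of "norm x / 2 - M"] by (simp add: power2_eq_square algebra_simps)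
  finally have "exp (- ((norm x)^2 / 4)) * rho x powr M
     \<le> exp (- ((norm x)^2 / 4)) * exp ((norm x)^2 / 4 + M^2)"
    by (rule mult_left_mono) simp
  also have "\<dots> = exp (M^2)" by (simp add: exp_add[symmetric])
  finally show ?thesis by (simp add: powr_minus field_simps)
qed

text \<open>
  Taylor's formula of order 2 for the Gaussian along the segment from \<open>x\<close> to \<open>x - z\<close>.
\<close>

lemma exp_segment_taylor:
  fixes x z :: "'a::real_inner"
  shows "\<exists>\<theta>. 0 < \<theta> \<and> \<theta> < 1 \<and>
    exp (- (b * (norm (x - z))^2)) - exp (- (b * (norm x)^2)) - 2 * b * (z \<bullet> x) * exp (- (b * (norm x)^2))
    = (1/2) * (4 * b^2 * (z \<bullet> (x - \<theta> *\<^sub>R z))^2 - 2 * b * (norm z)^2) * exp (- (b * (norm (x - \<theta> *\<^sub>R z))^2))"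
proof -
  define f where "f \<theta> = exp (- (b * (norm (x - \<theta> *\<^sub>R z))^2))" for \<theta>
  define l where "l \<theta> = z \<bullet> (x - \<theta> *\<^sub>R z)" for \<theta>
  have l': "(l has_real_derivative - (norm z)\<^sup>2) (at \<theta>)" for \<theta>
    unfolding l_def inner_diff_right inner_scaleR_right power2_norm_eq_inner
    by (auto intro!: derivative_eq_intros)
  have f': "(f has_real_derivative 2 * b * l \<theta> * f \<theta>) (at \<theta>)" for \<theta>
  proof -
    have f_eq: "f = (\<lambda>\<theta>. exp (- (b * (x \<bullet> x - 2 * \<theta> * (x \<bullet> z) + \<theta>^2 * (z \<bullet> z)))))"
      unfolding f_def power2_norm_eq_inner
      by (auto simp: fun_eq_iff inner_diff_left inner_diff_right inner_commute power2_eq_square algebra_simps)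
    have "(f has_real_derivative (2 * b * (x \<bullet> z) - 2 * b * \<theta> * (z \<bullet> z)) * f \<theta>) (at \<theta>)"
      unfolding f_eq by (auto intro!: derivative_eq_intros simp: algebra_simps)
    then show ?thesis
      by (simp add: l_def inner_diff_right inner_commute algebra_simps)
  qed
  define f1 where "f1 \<theta> = 2 * b * l \<theta> * f \<theta>" for \<theta>
  define f2 where "f2 \<theta> = (4 * b^2 * (l \<theta>)^2 - 2 * b * (norm z)^2) * f \<theta>" for \<theta>
  have f1': "(f1 has_real_derivative f2 \<theta>) (at \<theta>)" for \<theta>
    unfolding f1_def f2_def
    by (rule derivative_eq_intros l' f' refl | simp add: power2_eq_square algebra_simps)+
  define diff where "diff n = (if n = 0 then f else if n = 1 then f1 else f2)" for n :: nat
  have "\<exists>t. 0 < t \<and> t < 1 \<and> f 1 = (\<Sum>k<2. diff k 0 / fact k * 1 ^ k) + diff 2 t / fact 2 * 1 ^ 2"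
  proof (rule Maclaurin)
    show "diff 0 = f" by (simp add: diff_def)
    show "\<forall>k t. k < 2 \<and> 0 \<le> t \<and> t \<le> 1 \<longrightarrow> (diff k has_real_derivative diff (Suc k) t) (at t)"
      using f' f1' by (auto simp: diff_def f1_def less_2_cases_iff)
  qed simp_all
  then obtain t where t: "0 < t" "t < 1" "f 1 = f 0 + f1 0 + f2 t / 2"
    by (auto simp: diff_def numeral_2_eq_2)
  then have "f 1 - f 0 - f1 0 = (1/2) * f2 t" by simp
  then show ?thesis
    using t(1,2) by (intro exI[of _ t]) (simp add: f_def f1_def f2_def l_def)
qed

text \<open>
  The mean value theorem along the same segment, for a component of the gradient of the Gaussian.
\<close>

lemma inner_exp_segment_mvt:
  fixes u x z :: "'a::real_inner"
  shows "\<exists>\<theta>. 0 < \<theta> \<and> \<theta> < 1 \<and>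
    (u \<bullet> (x - z)) * exp (- (b * (norm (x - z))^2)) - (u \<bullet> x) * exp (- (b * (norm x)^2))
    = (2 * b * (u \<bullet> (x - \<theta> *\<^sub>R z)) * (z \<bullet> (x - \<theta> *\<^sub>R z)) - u \<bullet> z) * exp (- (b * (norm (x - \<theta> *\<^sub>R z))^2))"
proof -
  define f where "f \<theta> = exp (- (b * (norm (x - \<theta> *\<^sub>R z))^2))" for \<theta>
  define g where "g \<theta> = (u \<bullet> (x - \<theta> *\<^sub>R z)) * f \<theta>" for \<theta>
  have f': "(f has_real_derivative 2 * b * (z \<bullet> (x - \<theta> *\<^sub>R z)) * f \<theta>) (at \<theta>)" for \<theta>
  proof -
    have f_eq: "f = (\<lambda>\<theta>. exp (- (b * (x \<bullet> x - 2 * \<theta> * (x \<bullet> z) + \<theta>^2 * (z \<bullet> z)))))"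
      unfolding f_def power2_norm_eq_inner
      by (auto simp: fun_eq_iff inner_diff_left inner_diff_right inner_commute power2_eq_square algebra_simps)
    have "(f has_real_derivative (2 * b * (x \<bullet> z) - 2 * b * \<theta> * (z \<bullet> z)) * f \<theta>) (at \<theta>)"
      unfolding f_eq by (auto intro!: derivative_eq_intros simp: algebra_simps)
    then show ?thesis
      by (simp add: inner_diff_right inner_commute algebra_simps)
  qed
  have l': "((\<lambda>\<theta>. u \<bullet> (x - \<theta> *\<^sub>R z)) has_real_derivative - (u \<bullet> z)) (at \<theta>)" for \<theta>
    unfolding inner_diff_right inner_scaleR_right by (auto intro!: derivative_eq_intros)
  have "(g has_real_derivative (2 * b * (u \<bullet> (x - \<theta> *\<^sub>R z)) * (z \<bullet> (x - \<theta> *\<^sub>R z)) - u \<bullet> z) * f \<theta>) (at \<theta>)" for \<theta>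
    unfolding g_def by (rule derivative_eq_intros l' f' refl | simp add: algebra_simps)+
  then have "\<exists>t>0. t < 1 \<and> g 1 - g 0 = (1 - 0) *
      ((2 * b * (u \<bullet> (x - t *\<^sub>R z)) * (z \<bullet> (x - t *\<^sub>R z)) - u \<bullet> z) * f t)"
    by (intro MVT2) auto
  then show ?thesis
    by (auto simp: g_def f_def)
qed

lemma heat_factor_le_1:
  assumes "a \<ge> 1 / 2"
  shows "(4 * pi * a) powr (- 3 / 2) \<le> 1"
proof -
  have "1 \<le> 4 * 3 * (1/2::real)" by simp
  also have "\<dots> \<le> 4 * pi * a"
    using assms pi_gt3 by (intro mult_mono) auto
  finally have "1 \<le> 4 * pi * a" .
  then have "(4 * pi * a) powr (- 3 / 2) \<le> 1 powr (- 3 / 2)"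
    by (intro powr_mono2') auto
  then show ?thesis by simp
qed

lemma exp_gauss_le:
  assumes "0 < a" "a \<le> 1" "M \<ge> 0"
  shows "exp (- ((norm x)^2 / (4 * a))) \<le> exp (M^2) * rho x powr (-M)"
proof -
  have "(norm x)^2 / 4 \<le> (norm x)^2 / (4 * a)"
    using assms by (intro divide_left_mono) auto
  then have "exp (- ((norm x)^2 / (4 * a))) \<le> exp (- ((norm x)^2 / 4))" by simp
  then show ?thesis using exp_neg_square_le_rho_powr[OF assms(3), of x] by linarith
qed

text \<open>
  A shift of length at most 1 changes \<open>rho\<close> at most by a factor 2, so the intermediate point of a
  Taylor formula can be replaced by \<open>x\<close>.
\<close>

lemma rho_powr_neg_segment:
  assumes "norm z \<le> 1" "0 \<le> \<theta>" "\<theta> \<le> 1" "M \<ge> 0"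
  shows "rho (x - \<theta> *\<^sub>R z) powr (-M) \<le> 2 powr M * rho x powr (-M)"
proof -
  have "norm (\<theta> *\<^sub>R z) \<le> 1"
    using assms by (simp add: mult_le_one)
  then have "norm x \<le> norm (x - \<theta> *\<^sub>R z) + 1"
    using norm_triangle_ineq[of "x - \<theta> *\<^sub>R z" "\<theta> *\<^sub>R z"] by simp
  then have "rho x / 2 \<le> rho (x - \<theta> *\<^sub>R z)"
  proof -
    have "0 \<le> norm (x - \<theta> *\<^sub>R z)" by (rule norm_ge_zero)
    with \<open>norm x \<le> norm (x - \<theta> *\<^sub>R z) + 1\<close> have "norm x \<le> 2 * norm (x - \<theta> *\<^sub>R z) + 1"
      by linarith
    then show ?thesis by (simp add: rho_def)
  qed
  then have "rho (x - \<theta> *\<^sub>R z) powr (-M) \<le> (rho x / 2) powr (-M)"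
    using assms by (intro powr_mono2') auto
  also have "\<dots> = 2 powr M * rho x powr (-M)"
    by (simp add: powr_divide powr_minus field_simps)
  finally show ?thesis .
qed

lemma quadratic_exp_gauss_le:
  assumes "0 < a" "a \<le> 1" "M \<ge> 0"
  shows "((norm x)^2 + 1) * exp (- ((norm x)^2 / (4 * a))) \<le> exp ((M + 2)^2) * rho x powr (-M)"
proof -
  have "(norm x)^2 + 1 \<le> (rho x)^2"
    by (simp add: rho_def power2_eq_square algebra_simps)
  then have "((norm x)^2 + 1) * exp (- ((norm x)^2 / (4 * a)))
      \<le> (rho x)^2 * (exp ((M + 2)^2) * rho x powr (-(M + 2)))"
    using assms by (intro mult_mono exp_gauss_le) auto
  also have "(rho x)^2 = rho x powr 2" by (simp add: powr_numeral)
  also have "rho x powr 2 * (exp ((M + 2)^2) * rho x powr (-(M + 2))) = exp ((M + 2)^2) * rho x powr (-M)"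
  proof -
    have "rho x powr 2 * rho x powr (-(M + 2)) = rho x powr (2 + (-(M + 2)))"
      by (rule powr_add[symmetric])
    also have "2 + (-(M + 2)) = -M" by simp
    finally show ?thesis by (simp only: mult.left_commute[of "rho x powr 2"])
  qed
  finally show ?thesis .
qed

lemma heat_taylor_near:
  assumes a: "1 / 2 \<le> a" "a \<le> 1" and M: "M \<ge> 0" and z: "norm z \<le> 1"
  shows "\<bar>heat a (x - z) - heat a x - (x \<bullet> z) / (2 * a) * heat a x\<bar>
    \<le> exp ((M + 2)^2) * 2 powr M * (norm z)^2 * rho x powr (-M)"
proof -
  define b where "b = 1 / (4 * a)"
  have b: "b > 0" "b \<le> 1 / 2" using a by (auto simp: b_def divide_simps)
  obtain \<theta> where \<theta>: "0 < \<theta>" "\<theta> < 1"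
    "exp (- (b * (norm (x - z))^2)) - exp (- (b * (norm x)^2)) - 2 * b * (z \<bullet> x) * exp (- (b * (norm x)^2))
    = (1/2) * (4 * b^2 * (z \<bullet> (x - \<theta> *\<^sub>R z))^2 - 2 * b * (norm z)^2) * exp (- (b * (norm (x - \<theta> *\<^sub>R z))^2))"
    using exp_segment_taylor[of b x z] by blast
  define X where "X = x - \<theta> *\<^sub>R z"
  let ?k = "(4 * pi * a) powr (- 3 / 2)"
  have b1: "(norm x)^2 / (4 * a) = b * (norm x)^2" for x :: "real^3" by (simp add: b_def)
  have b2: "(x \<bullet> z) / (2 * a) = 2 * b * (z \<bullet> x)" by (simp add: b_def inner_commute)
  have "\<bar>heat a (x - z) - heat a x - (x \<bullet> z) / (2 * a) * heat a x\<bar>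
     = \<bar>?k * (exp (- (b * (norm (x - z))^2)) - exp (- (b * (norm x)^2)) - 2 * b * (z \<bullet> x) * exp (- (b * (norm x)^2)))\<bar>"
    unfolding heat_def b1 b2 by (simp add: algebra_simps)
  also have "\<dots> = ?k * (1/2 * (\<bar>4 * b^2 * (z \<bullet> X)^2 - 2 * b * (norm z)^2\<bar> * exp (- (b * (norm X)^2))))"
    unfolding \<theta>(3) by (simp add: X_def abs_mult)
  also have "\<dots> \<le> 1 * (1 * ((norm z)^2 * ((norm X)^2 + 1) * exp (- (b * (norm X)^2))))"
  proof (intro mult_mono heat_factor_le_1 a mult_right_mono)
    have "(z \<bullet> X)^2 \<le> (norm z)^2 * (norm X)^2"
      using Cauchy_Schwarz_ineq[of z X] by (simp add: power2_norm_eq_inner)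
    moreover have "4 * b^2 \<le> 1"
      using power_mono[of b "1/2" 2] b by (simp add: power2_eq_square)
    ultimately have "4 * b^2 * (z \<bullet> X)^2 \<le> 1 * ((norm z)^2 * (norm X)^2)"
      by (intro mult_mono) auto
    moreover have "2 * b * (norm z)^2 \<le> 1 * (norm z)^2"
      using b by (intro mult_right_mono) auto
    moreover have "0 \<le> 4 * b^2 * (z \<bullet> X)^2" "0 \<le> 2 * b * (norm z)^2" "0 \<le> (norm z)^2 * (norm X)^2" using b by auto
    ultimately show "\<bar>4 * b^2 * (z \<bullet> X)^2 - 2 * b * (norm z)^2\<bar> \<le> (norm z)^2 * ((norm X)^2 + 1)"
      unfolding distrib_left by linarith
  qed auto
  also have "\<dots> = (norm z)^2 * (((norm X)^2 + 1) * exp (- ((norm X)^2 / (4 * a))))"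
    by (simp add: b1)
  also have "\<dots> \<le> (norm z)^2 * (exp ((M + 2)^2) * rho X powr (-M))"
    using a M by (intro mult_left_mono quadratic_exp_gauss_le) auto
  also have "\<dots> \<le> (norm z)^2 * (exp ((M + 2)^2) * (2 powr M * rho x powr (-M)))"
    unfolding X_def using z M \<theta> by (intro mult_left_mono rho_powr_neg_segment) auto
  finally show ?thesis by (simp add: mult_ac)
qed

lemma heat_grad_lipschitz_near:
  assumes a: "1 / 2 \<le> a" "a \<le> 1" and M: "M \<ge> 0" and z: "norm z \<le> 1" and u: "norm u \<le> 1"
  shows "\<bar>heat_grad a u (x - z) - heat_grad a u x\<bar>
    \<le> exp ((M + 2)^2) * 2 powr M * norm z * rho x powr (-M)"
proof -
  define b where "b = 1 / (4 * a)"
  have b: "b > 0" "b \<le> 1 / 2" using a by (auto simp: b_def divide_simps)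
  obtain \<theta> where \<theta>: "0 < \<theta>" "\<theta> < 1"
    "(u \<bullet> (x - z)) * exp (- (b * (norm (x - z))^2)) - (u \<bullet> x) * exp (- (b * (norm x)^2))
    = (2 * b * (u \<bullet> (x - \<theta> *\<^sub>R z)) * (z \<bullet> (x - \<theta> *\<^sub>R z)) - u \<bullet> z) * exp (- (b * (norm (x - \<theta> *\<^sub>R z))^2))"
    using inner_exp_segment_mvt[of u x z b] by blast
  define X where "X = x - \<theta> *\<^sub>R z"
  let ?k = "(4 * pi * a) powr (- 3 / 2)"
  have b1: "(norm x)^2 / (4 * a) = b * (norm x)^2" for x :: "real^3" by (simp add: b_def)
  have b2: "t / (2 * a) = 2 * b * t" for t by (simp add: b_def)
  have "\<bar>heat_grad a u (x - z) - heat_grad a u x\<bar>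
     = \<bar>- (?k * (2 * b) * ((u \<bullet> (x - z)) * exp (- (b * (norm (x - z))^2)) - (u \<bullet> x) * exp (- (b * (norm x)^2))))\<bar>"
    unfolding heat_grad_def heat_def b1 b2 by (simp add: algebra_simps)
  also have "\<dots> = ?k * (2 * b) * (\<bar>2 * b * (u \<bullet> X) * (z \<bullet> X) - u \<bullet> z\<bar> * exp (- (b * (norm X)^2)))"
    unfolding \<theta>(3) using b by (simp add: X_def abs_mult)
  also have "\<dots> \<le> 1 * 1 * ((norm z * ((norm X)^2 + 1)) * exp (- (b * (norm X)^2)))"
  proof (intro mult_mono heat_factor_le_1 a mult_right_mono)
    have uX: "\<bar>u \<bullet> X\<bar> \<le> norm X"
      using Cauchy_Schwarz_ineq2[of u X] mult_right_mono[OF u, of "norm X"] by simp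
    have uz: "\<bar>u \<bullet> z\<bar> \<le> norm z"
      using Cauchy_Schwarz_ineq2[of u z] mult_right_mono[OF u, of "norm z"] by simp
    have "\<bar>2 * b * (u \<bullet> X) * (z \<bullet> X)\<bar> = (2 * b) * (\<bar>u \<bullet> X\<bar> * \<bar>z \<bullet> X\<bar>)"
      using b by (simp add: abs_mult)
    also have "\<dots> \<le> 1 * (norm X * (norm z * norm X))"
      using b uX by (intro mult_mono Cauchy_Schwarz_ineq2) auto
    finally have "\<bar>2 * b * (u \<bullet> X) * (z \<bullet> X)\<bar> \<le> norm z * (norm X)^2"
      by (simp add: power2_eq_square mult_ac)
    with uz show "\<bar>2 * b * (u \<bullet> X) * (z \<bullet> X) - u \<bullet> z\<bar> \<le> norm z * ((norm X)^2 + 1)"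
      unfolding distrib_left by linarith
  qed (use b in auto)
  also have "\<dots> = norm z * (((norm X)^2 + 1) * exp (- ((norm X)^2 / (4 * a))))"
    by (simp add: b1)
  also have "\<dots> \<le> norm z * (exp ((M + 2)^2) * rho X powr (-M))"
    using a M by (intro mult_left_mono quadratic_exp_gauss_le) auto
  also have "\<dots> \<le> norm z * (exp ((M + 2)^2) * (2 powr M * rho x powr (-M)))"
    unfolding X_def using z M \<theta> by (intro mult_left_mono rho_powr_neg_segment) auto
  finally show ?thesis by (simp add: mult_ac)
qed

lemma heat_le_rho_powr:
  assumes "1 / 2 \<le> a" "a \<le> 1" "M \<ge> 0"
  shows "heat a x \<le> exp (M^2) * rho x powr (-M)"
proof -
  have "heat a x \<le> 1 * (exp (M^2) * rho x powr (-M))"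
    unfolding heat_def using assms by (intro mult_mono exp_gauss_le heat_factor_le_1) auto
  then show ?thesis by simp
qed

lemma quadratic_heat_le:
  assumes "1 / 2 \<le> a" "a \<le> 1" "M \<ge> 0"
  shows "((norm x)^2 + 1) * heat a x \<le> exp ((M + 2)^2) * rho x powr (-M)"
proof -
  have "((norm x)^2 + 1) * heat a x
      = (4 * pi * a) powr (- 3 / 2) * (((norm x)^2 + 1) * exp (- ((norm x)^2 / (4 * a))))"
    by (simp add: heat_def)
  also have "\<dots> \<le> 1 * (exp ((M + 2)^2) * rho x powr (-M))"
    using assms by (intro mult_mono quadratic_exp_gauss_le heat_factor_le_1) auto
  finally show ?thesis by simp
qed

lemma abs_inner_heat_le:
  assumes "1 / 2 \<le> a" "a \<le> 1" "M \<ge> 0"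
  shows "\<bar>(x \<bullet> z) / 2 * heat a x\<bar> \<le> norm z * (exp ((M + 2)^2) * rho x powr (-M))"
proof -
  have "norm x \<le> (norm x)^2 + 1"
    using zero_le_power2[of "norm x - 1/2"] by (simp add: power2_eq_square algebra_simps)
  then have "\<bar>x \<bullet> z\<bar> \<le> ((norm x)^2 + 1) * norm z"
    using Cauchy_Schwarz_ineq2[of x z] mult_right_mono[of "norm x" "(norm x)^2 + 1" "norm z"] by simp
  moreover have "\<bar>(x \<bullet> z) / 2\<bar> \<le> \<bar>x \<bullet> z\<bar>" by simp
  ultimately have "\<bar>(x \<bullet> z) / 2\<bar> \<le> ((norm x)^2 + 1) * norm z" by linarith
  then have "\<bar>(x \<bullet> z) / 2 * heat a x\<bar> \<le> ((norm x)^2 + 1) * norm z * heat a x"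
    unfolding abs_mult abs_of_nonneg[OF heat_nonneg] using heat_nonneg by (rule mult_right_mono)
  also have "\<dots> = norm z * (((norm x)^2 + 1) * heat a x)" by simp
  also have "\<dots> \<le> norm z * (exp ((M + 2)^2) * rho x powr (-M))"
    by (intro mult_left_mono quadratic_heat_le assms) simp
  finally show ?thesis .
qed

lemma abs_heat_grad_le:
  assumes a: "1 / 2 \<le> a" "a \<le> 1" and M: "M \<ge> 0" and u: "norm u \<le> 1"
  shows "\<bar>heat_grad a u x\<bar> \<le> 2 * exp ((M + 2)^2) * rho x powr (-M)"
proof -
  have "\<bar>heat_grad a u x\<bar> = (1 / a) * \<bar>(x \<bullet> u) / 2 * heat a x\<bar>"
    using a by (simp add: heat_grad_def abs_mult inner_commute)
  also have "\<dots> \<le> 2 * (norm u * (exp ((M + 2)^2) * rho x powr (-M)))"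
    using a by (intro mult_mono abs_inner_heat_le M) (auto simp: divide_simps)
  also have "\<dots> \<le> 2 * (1 * (exp ((M + 2)^2) * rho x powr (-M)))"
    by (intro mult_left_mono mult_right_mono u) auto
  finally show ?thesis by simp
qed

text \<open>
  The first order coefficient of the kernel of width \<open>a\<close> is \<open>x heat a x / (2a)\<close>; this is the error
  made when \<open>a\<close> is replaced by 1. It is of order \<open>1 - a = \<epsilon>^2\<close>.
\<close>

lemma heat_width_lipschitz:
  assumes a: "1 / 2 \<le> a" "a \<le> 1" and M: "M \<ge> 0"
  shows "\<bar>heat a x / a - heat 1 x\<bar> \<le> 24 * exp ((M + 2)^2) * (1 - a) * rho x powr (-M)"
proof -
  let ?q = "(norm x)^2"
  have a0: "a > 0" using a by simp
  have split: "heat a x / a = (4 * pi) powr (- 3 / 2) * (a powr (- 5 / 2) * exp (- (?q / (4 * a))))"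
  proof -
    have "(4 * pi * a) powr (- 3 / 2) = (4 * pi) powr (- 3 / 2) * a powr (- 3 / 2)"
      using a by (simp add: powr_mult)
    moreover have "a powr (- 5 / 2) = a powr (- 3 / 2) / a"
    proof -
      have "a powr (- 3 / 2 - 1) = a powr (- 3 / 2) / a powr 1" by (rule powr_diff)
      then show ?thesis using a0 by simp
    qed
    ultimately show ?thesis
      unfolding heat_def by (simp only: times_divide_eq_right times_divide_eq_left mult.assoc mult.commute mult.left_commute)
  qed
  have p1: "1 \<le> a powr (- 5 / 2)"
    using powr_mono2'[of "- 5 / 2" a 1] a by simp
  \<comment> \<open>\<open>(1 - a^3) / a^3 \<le> 3 (1 - a) / (1/2)^3\<close>, whence the constant 24.\<close>
  have p2: "a powr (- 5 / 2) - 1 \<le> 24 * (1 - a)"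
  proof -
    have "a powr (- 5 / 2) \<le> a powr (- 3)"
      using a powr_mono'[of "-3" "-5/2" a] by simp
    also have "\<dots> = 1 / a ^ 3" using a0 by (simp add: powr_minus powr_numeral divide_inverse)
    finally have "a powr (- 5 / 2) - 1 \<le> (1 - a ^ 3) / a ^ 3"
      using a0 by (simp add: field_simps)
    also have "\<dots> \<le> (3 * (1 - a)) / (1/2) ^ 3"
    proof (intro frac_le power_mono a)
      have "1 - a ^ 3 = (1 - a) * (1 + a + a^2)" by (simp add: power2_eq_square power3_eq_cube algebra_simps)
      also have "\<dots> \<le> (1 - a) * 3"
        using a power_le_one[of a 2] by (intro mult_left_mono) auto
      finally show "1 - a ^ 3 \<le> 3 * (1 - a)" by simp
    qed (use a in auto)
    finally show ?thesis by (simp add: power3_eq_cube)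
  qed
  have e1: "exp (- (?q / (4 * a))) \<le> exp (- (?q / 4))"
  proof -
    have "?q / 4 \<le> ?q / (4 * a)" using a by (intro divide_left_mono) auto
    then show ?thesis by simp
  qed
  have e2: "exp (- (?q / 4)) - exp (- (?q / (4 * a))) \<le> ?q * (1 - a) * exp (- (?q / 4))"
  proof -
    have "?q / (4 * a) = ?q / 4 + ?q * (1 - a) / (4 * a)"
      using a0 by (simp add: field_simps)
    then have "exp (- (?q / (4 * a))) = exp (- (?q / 4)) * exp (- (?q * (1 - a) / (4 * a)))"
      by (simp add: exp_add[symmetric])
    moreover have "1 - exp (- (?q * (1 - a) / (4 * a))) \<le> ?q * (1 - a) / (4 * a)"
      using exp_ge_add_one_self[of "- (?q * (1 - a) / (4 * a))"] by simp
    moreover have "?q * (1 - a) / (4 * a) \<le> ?q * (1 - a) / 1"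
      using a by (intro divide_left_mono) auto
    ultimately have "exp (- (?q / 4)) - exp (- (?q / (4 * a)))
        = exp (- (?q / 4)) * (1 - exp (- (?q * (1 - a) / (4 * a))))"
      and "1 - exp (- (?q * (1 - a) / (4 * a))) \<le> ?q * (1 - a)"
      by (simp_all add: algebra_simps)
    then show ?thesis by (simp add: mult.commute[of _ "exp (- (?q / 4))"] mult_left_mono)
  qed
  have "\<bar>a powr (- 5 / 2) * exp (- (?q / (4 * a))) - exp (- (?q / 4))\<bar>
      \<le> (a powr (- 5 / 2) - 1) * exp (- (?q / (4 * a))) + \<bar>exp (- (?q / (4 * a))) - exp (- (?q / 4))\<bar>"
  proof -
    have "a powr (- 5 / 2) * exp (- (?q / (4 * a))) - exp (- (?q / 4))
      = (a powr (- 5 / 2) - 1) * exp (- (?q / (4 * a))) + (exp (- (?q / (4 * a))) - exp (- (?q / 4)))"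
      by (simp add: algebra_simps)
    moreover have "(a powr (- 5 / 2) - 1) * exp (- (?q / (4 * a))) \<ge> 0" using p1 by simp
    ultimately show ?thesis by linarith
  qed
  also have "\<dots> \<le> 24 * (1 - a) * exp (- (?q / 4)) + ?q * (1 - a) * exp (- (?q / 4))"
  proof (rule add_mono)
    show "(a powr (- 5 / 2) - 1) * exp (- (?q / (4 * a))) \<le> 24 * (1 - a) * exp (- (?q / 4))"
      using p2 e1 a by (intro mult_mono) auto
    show "\<bar>exp (- (?q / (4 * a))) - exp (- (?q / 4))\<bar> \<le> ?q * (1 - a) * exp (- (?q / 4))"
      using e1 e2 by linarith
  qed
  also have "\<dots> \<le> 24 * (1 - a) * ((?q + 1) * exp (- (?q / (4 * 1))))"
  proof -
    have "0 \<le> 23 * ?q * (1 - a) * exp (- (?q / 4))" using a by simp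
    then show ?thesis by (simp add: algebra_simps)
  qed
  also have "\<dots> \<le> 24 * (1 - a) * (exp ((M + 2)^2) * rho x powr (-M))"
    using a M by (intro mult_left_mono quadratic_exp_gauss_le) auto
  finally have main: "\<bar>a powr (- 5 / 2) * exp (- (?q / (4 * a))) - exp (- (?q / 4))\<bar>
      \<le> 24 * (1 - a) * (exp ((M + 2)^2) * rho x powr (-M))" .
  have "\<bar>heat a x / a - heat 1 x\<bar>
     = (4 * pi) powr (- 3 / 2) * \<bar>a powr (- 5 / 2) * exp (- (?q / (4 * a))) - exp (- (?q / 4))\<bar>"
  proof -
    have "heat a x / a - heat 1 x
       = (4 * pi) powr (- 3 / 2) * (a powr (- 5 / 2) * exp (- (?q / (4 * a))) - exp (- (?q / 4)))"
      unfolding split by (simp add: heat_def right_diff_distrib)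
    then show ?thesis by (simp only: abs_mult abs_of_nonneg[OF powr_ge_zero])
  qed
  also have "\<dots> \<le> 1 * (24 * (1 - a) * (exp ((M + 2)^2) * rho x powr (-M)))"
    using heat_factor_le_1[of 1] by (intro mult_mono main) auto
  finally show ?thesis by (simp only: mult_ac mult_1_left)
qed

lemma weighted_shift_powr_le:
  assumes "m \<ge> 0" "norm z > 1"
  shows "rho x powr m * rho (x - z) powr (- (m + 4)) \<le> 2 powr m * norm z powr m * rho (x - z) powr (-4)"
proof -
  have "rho z powr m \<le> (2 * norm z) powr m"
    using assms by (intro powr_mono2) (auto simp: rho_def)
  then have z: "rho z powr m \<le> 2 powr m * norm z powr m" by (simp add: powr_mult)
  have "rho x powr m \<le> rho (x - z) powr m * (2 powr m * norm z powr m)"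
    using rho_powr_add_le[OF assms(1), of x z] mult_left_mono[OF z powr_ge_zero] by (rule order_trans)
  then have "rho x powr m * rho (x - z) powr (- (m + 4))
      \<le> rho (x - z) powr m * (2 powr m * norm z powr m) * rho (x - z) powr (- (m + 4))"
    by (rule mult_right_mono) simp
  also have "\<dots> = (2 powr m * norm z powr m) * (rho (x - z) powr m * rho (x - z) powr (- (m + 4)))"
    by (simp only: mult_ac)
  also have "rho (x - z) powr m * rho (x - z) powr (- (m + 4)) = rho (x - z) powr (m + (- (m + 4)))"
    by (rule powr_add[symmetric])
  finally show ?thesis by simp
qed

lemma weighted_powr_cancel: "rho x powr m * rho x powr (- (m + q)) = rho x powr (- q)"
proof -
  have "rho x powr m * rho x powr (- (m + q)) = rho x powr (m + (- (m + q)))"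
    by (rule powr_add[symmetric])
  then show ?thesis by simp
qed

text \<open>
  The weight \<open>rho x powr m\<close> is absorbed by the decay in \<open>x\<close> in the first summand. In the second
  one it is distributed by \<open>rho x \<le> rho (x - z) rho z\<close>, where \<open>rho z \<le> 2 norm z\<close> because
  \<open>norm z > 1\<close>.
\<close>

lemma weighted_kernel_majorant:
  assumes m: "m \<ge> 0" and e: "0 < \<epsilon>" and A: "A \<ge> 0" "B \<ge> 0"
    and k: "\<bar>k\<bar> \<le> A * ((\<epsilon> * rho y) powr p * rho x powr (- (m + 2)))
      + (if norm (\<epsilon> *\<^sub>R y) \<le> 1 then 0 else B * rho (x - \<epsilon> *\<^sub>R y) powr (- (m + 4)))"
  shows "rho x powr m * \<bar>k\<bar> \<le> (A + B * 2 powr m) * kernel_majorant m p \<epsilon> x y"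
proof -
  define z where "z = \<epsilon> *\<^sub>R y"
  define P where "P = (\<epsilon> * rho y) powr p * rho x powr (-2)"
  define Q where "Q = (\<epsilon> * rho y) powr m * rho (x - z) powr (-4)"
  have PQ: "P \<ge> 0" "Q \<ge> 0" by (auto simp: P_def Q_def)
  have z: "norm z \<le> \<epsilon> * rho y" using e by (simp add: z_def) (simp add: rho_def)
  have "rho x powr m * (if norm z \<le> 1 then 0 else B * rho (x - z) powr (- (m + 4))) \<le> B * (2 powr m * Q)"
  proof (cases "norm z \<le> 1")
    case False
    then have "rho x powr m * rho (x - z) powr (- (m + 4)) \<le> 2 powr m * norm z powr m * rho (x - z) powr (-4)"
      by (intro weighted_shift_powr_le m) simp
    also have "\<dots> \<le> 2 powr m * (\<epsilon> * rho y) powr m * rho (x - z) powr (-4)"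
      using z m by (intro mult_right_mono mult_left_mono powr_mono2) auto
    finally have "B * (rho x powr m * rho (x - z) powr (- (m + 4))) \<le> B * (2 powr m * Q)"
      unfolding Q_def mult.assoc using A by (intro mult_left_mono) auto
    then show ?thesis using False by (simp add: mult.left_commute)
  qed (use A PQ in simp)
  moreover have "rho x powr m * (A * ((\<epsilon> * rho y) powr p * rho x powr (- (m + 2)))) = A * P"
    unfolding P_def weighted_powr_cancel[of x m 2, symmetric] by (simp only: mult_ac)
  moreover have "rho x powr m * \<bar>k\<bar> \<le> rho x powr m * (A * ((\<epsilon> * rho y) powr p * rho x powr (- (m + 2)))
      + (if norm z \<le> 1 then 0 else B * rho (x - z) powr (- (m + 4))))"
    unfolding z_def by (intro mult_left_mono k) simp
  ultimately have "rho x powr m * \<bar>k\<bar> \<le> A * P + B * (2 powr m * Q)"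
    unfolding distrib_left by linarith
  also have "\<dots> \<le> (A + B * 2 powr m) * (P + Q)"
    using A PQ by (simp add: algebra_simps)
  finally show ?thesis by (simp only: P_def Q_def z_def)
qed

text \<open>
  The remainder is quadratic in \<open>z = \<epsilon> y\<close> for \<open>norm z \<le> 1\<close>, up to the change of width, which
  contributes \<open>norm z \<epsilon>^2\<close>; for \<open>norm z > 1\<close> its terms grow at most linearly in \<open>z\<close>. Hence it is
  at most of order \<open>(\<epsilon> rho y) powr p\<close> for every \<open>p\<close> between 1 and 2, except for the value of the
  kernel at \<open>x - z\<close>.
\<close>

lemma heat_remainder_kernel:
  assumes m: "m \<ge> 0" and p: "1 \<le> p" "p \<le> 2"
  shows "\<exists>C\<ge>1. \<forall>\<epsilon> x y. 0 < \<epsilon> \<longrightarrow> \<epsilon>^2 \<le> 1 / 2 \<longrightarrow>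
    rho x powr m * \<bar>heat_remainder \<epsilon> x y\<bar> \<le> C * kernel_majorant m p \<epsilon> x y"
proof -
  \<comment> \<open>The weight uses up the decay of order \<open>m\<close> and leaves \<open>rho x powr (-2)\<close>.\<close>
  define M where "M = m + 2"
  have M: "M \<ge> 0" using m by (simp add: M_def)
  define A1 where "A1 = exp ((M + 2)^2) * 2 powr M"
  define A2 where "A2 = 24 * exp ((M + 1 + 2)^2)"
  define A3 where "A3 = exp (M^2) + exp ((M + 2)^2)"
  define B where "B = exp ((m + 4)^2)"
  have A: "A1 \<ge> 0" "A2 \<ge> 1" "A3 \<ge> 0" "B \<ge> 0"
    by (auto simp: A1_def A2_def A3_def B_def mult_ge1_I)
  show ?thesis
  proof (intro exI[of _ "A1 + A2 + A3 + B * 2 powr m"] conjI allI impI weighted_kernel_majorant m)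
    show "1 \<le> A1 + A2 + A3 + B * 2 powr m" using A by (simp add: add_increasing add_increasing2)
    show "0 \<le> A1 + A2 + A3" "0 \<le> B" using A by auto
    fix \<epsilon> :: real and x y :: "real^3"
    assume e: "0 < \<epsilon>" "\<epsilon>^2 \<le> 1 / 2"
    define a where "a = 1 - \<epsilon>^2"
    define z where "z = \<epsilon> *\<^sub>R y"
    have a: "1 / 2 \<le> a" "a \<le> 1" using e by (auto simp: a_def)
    have e1: "\<epsilon> \<le> 1"
      using e by (intro power2_le_imp_le[of \<epsilon> 1]) auto
    define t where "t = \<epsilon> * rho y"
    have t: "norm z \<le> t" "t > 0"
      using e by (simp_all add: z_def t_def) (simp add: rho_def)
    define P where "P = t powr p * rho x powr (-M)"
    have P: "P \<ge> 0" by (simp add: P_def)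
    have rem: "heat_remainder \<epsilon> x y = heat a (x - z) - heat a x - (x \<bullet> z) / 2 * heat 1 x"
      by (simp add: z_def a_def)
    have "\<bar>heat a (x - z) - heat a x - (x \<bullet> z) / 2 * heat 1 x\<bar>
      \<le> (A1 + A2 + A3) * P + (if norm z \<le> 1 then 0 else B * rho (x - z) powr (- (m + 4)))"
    proof (cases "norm z \<le> 1")
      case True
      have zp: "(norm z)^2 \<le> t powr p"
      proof -
        have "(norm z)^2 = norm z powr 2" by (simp add: powr_numeral)
        also have "\<dots> \<le> norm z powr p" using True p by (intro powr_mono') auto
        also have "\<dots> \<le> t powr p" using t p by (intro powr_mono2) auto
        finally show ?thesis .
      qed
      have ep: "norm z * (1 - a) \<le> t powr p"
      proof -
        have "norm z * (1 - a) \<le> (\<epsilon> * rho y) * \<epsilon>^2"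
          using t by (simp add: a_def t_def mult_right_mono)
        also have "\<dots> = \<epsilon> powr 3 * rho y powr 1"
          using e by (simp add: powr_numeral power2_eq_square power3_eq_cube)
        also have "\<dots> \<le> \<epsilon> powr p * rho y powr p"
          using e e1 p rho_ge_1[of y] by (intro mult_mono powr_mono' powr_mono) auto
        also have "\<dots> = t powr p" using e by (simp add: t_def powr_mult)
        finally show ?thesis .
      qed
      have "heat a (x - z) - heat a x - (x \<bullet> z) / 2 * heat 1 x
        = (heat a (x - z) - heat a x - (x \<bullet> z) / (2 * a) * heat a x) + (x \<bullet> z) / 2 * (heat a x / a - heat 1 x)"
        using a by (simp add: field_simps)
      then have "\<bar>heat a (x - z) - heat a x - (x \<bullet> z) / 2 * heat 1 x\<bar>
        \<le> \<bar>heat a (x - z) - heat a x - (x \<bullet> z) / (2 * a) * heat a x\<bar> + \<bar>(x \<bullet> z) / 2 * (heat a x / a - heat 1 x)\<bar>"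
        using abs_triangle_ineq by metis
      also have "\<dots> \<le> A1 * P + A2 * P"
      proof (rule add_mono)
        have "\<bar>heat a (x - z) - heat a x - (x \<bullet> z) / (2 * a) * heat a x\<bar> \<le> A1 * (norm z)^2 * rho x powr (-M)"
          unfolding A1_def by (rule heat_taylor_near[OF a M True])
        also have "\<dots> \<le> A1 * t powr p * rho x powr (-M)"
          using A zp by (intro mult_right_mono mult_left_mono) auto
        finally show "\<bar>heat a (x - z) - heat a x - (x \<bullet> z) / (2 * a) * heat a x\<bar> \<le> A1 * P"
          by (simp only: P_def mult.assoc)
        have "\<bar>x \<bullet> z\<bar> \<le> norm x * norm z" by (rule Cauchy_Schwarz_ineq2)
        also have "\<dots> \<le> rho x * norm z" by (intro mult_right_mono) (auto simp: rho_def)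
        finally have "\<bar>(x \<bullet> z) / 2\<bar> \<le> rho x * norm z" by simp
        then have "\<bar>(x \<bullet> z) / 2 * (heat a x / a - heat 1 x)\<bar>
           \<le> (rho x * norm z) * (A2 * (1 - a) * rho x powr (-(M + 1)))"
          unfolding abs_mult A2_def using M by (intro mult_mono heat_width_lipschitz a) auto
        also have "\<dots> = A2 * (norm z * (1 - a)) * (rho x powr 1 * rho x powr (- (1 + M)))"
          by (simp add: mult_ac add.commute)
        also have "\<dots> \<le> A2 * t powr p * rho x powr (-M)"
          unfolding weighted_powr_cancel using A ep by (intro mult_right_mono mult_left_mono) auto
        finally show "\<bar>(x \<bullet> z) / 2 * (heat a x / a - heat 1 x)\<bar> \<le> A2 * P"
          by (simp only: P_def mult.assoc)
      qed
      also have "\<dots> \<le> (A1 + A2 + A3) * P"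
        using A P by (simp add: distrib_right)
      finally show ?thesis using True by simp
    next
      case False
      have "1 \<le> t" using t False by linarith
      then have t1: "1 \<le> t powr p" "norm z \<le> t powr p"
        using p t powr_mono[of 1 p t] by (auto simp: ge_one_powr_ge_zero)
      have "heat a x + \<bar>(x \<bullet> z) / 2 * heat 1 x\<bar>
         \<le> 1 * (exp (M^2) * rho x powr (-M)) + norm z * (exp ((M + 2)^2) * rho x powr (-M))"
        using heat_le_rho_powr[OF a M, of x] abs_inner_heat_le[of 1 M x z] M by simp
      also have "\<dots> \<le> t powr p * (exp (M^2) * rho x powr (-M)) + t powr p * (exp ((M + 2)^2) * rho x powr (-M))"
        using t1 by (intro add_mono mult_right_mono) auto
      also have "\<dots> = A3 * P"
        by (simp only: A3_def P_def distrib_left distrib_right mult_ac)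
      also have "\<dots> \<le> (A1 + A2 + A3) * P" using A P by (intro mult_right_mono) auto
      finally have "heat a x + \<bar>(x \<bullet> z) / 2 * heat 1 x\<bar> \<le> (A1 + A2 + A3) * P" .
      moreover have "heat a (x - z) \<le> B * rho (x - z) powr (- (m + 4))"
        unfolding B_def using a m by (intro heat_le_rho_powr) auto
      moreover have "\<bar>heat a (x - z) - heat a x - (x \<bullet> z) / 2 * heat 1 x\<bar>
         \<le> heat a (x - z) + (heat a x + \<bar>(x \<bullet> z) / 2 * heat 1 x\<bar>)"
        using heat_nonneg[of a x] heat_nonneg[of a "x - z"] by linarith
      ultimately show ?thesis using False by simp
    qed
    then show "\<bar>heat_remainder \<epsilon> x y\<bar> \<le> (A1 + A2 + A3) * ((\<epsilon> * rho y) powr p * rho x powr (- (m + 2)))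
        + (if norm (\<epsilon> *\<^sub>R y) \<le> 1 then 0 else B * rho (x - \<epsilon> *\<^sub>R y) powr (- (m + 4)))"
      unfolding rem P_def t_def M_def z_def .
  qed
qed

text \<open>
  The same argument one order lower: the difference is linear in \<open>z = \<epsilon> y\<close> for small \<open>z\<close> and
  bounded for large \<open>z\<close>.
\<close>

lemma heat_grad_difference_kernel:
  assumes m: "m \<ge> 0" and p: "0 \<le> p" "p \<le> 1"
  shows "\<exists>C\<ge>1. \<forall>\<epsilon> u x y. 0 < \<epsilon> \<longrightarrow> \<epsilon>^2 \<le> 1 / 2 \<longrightarrow> norm u \<le> 1 \<longrightarrow>
    rho x powr m * \<bar>heat_grad (1 - \<epsilon>^2) u (x - \<epsilon> *\<^sub>R y) - heat_grad (1 - \<epsilon>^2) u x\<bar>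
    \<le> C * kernel_majorant m p \<epsilon> x y"
proof -
  define M where "M = m + 2"
  have M: "M \<ge> 0" using m by (simp add: M_def)
  define A1 where "A1 = exp ((M + 2)^2) * 2 powr M"
  define A2 where "A2 = 2 * exp ((M + 2)^2)"
  define B where "B = 2 * exp ((m + 4 + 2)^2)"
  have A: "A1 \<ge> 0" "A2 \<ge> 1" "B \<ge> 0"
    by (auto simp: A1_def A2_def B_def mult_ge1_I)
  show ?thesis
  proof (intro exI[of _ "A1 + A2 + B * 2 powr m"] conjI allI impI weighted_kernel_majorant m)
    show "1 \<le> A1 + A2 + B * 2 powr m" using A by (simp add: add_increasing add_increasing2)
    show "0 \<le> A1 + A2" "0 \<le> B" using A by auto
    fix \<epsilon> :: real and u x y :: "real^3"
    assume e: "0 < \<epsilon>" "\<epsilon>^2 \<le> 1 / 2" and u: "norm u \<le> 1"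
    define a where "a = 1 - \<epsilon>^2"
    define z where "z = \<epsilon> *\<^sub>R y"
    have a: "1 / 2 \<le> a" "a \<le> 1" using e by (auto simp: a_def)
    define t where "t = \<epsilon> * rho y"
    have t: "norm z \<le> t" "t > 0"
      using e by (simp_all add: z_def t_def) (simp add: rho_def)
    define P where "P = t powr p * rho x powr (-M)"
    have P: "P \<ge> 0" by (simp add: P_def)
    have "\<bar>heat_grad a u (x - z) - heat_grad a u x\<bar>
      \<le> (A1 + A2) * P + (if norm z \<le> 1 then 0 else B * rho (x - z) powr (- (m + 4)))"
    proof (cases "norm z \<le> 1")
      case True
      have "norm z = norm z powr 1" by simp
      also have "\<dots> \<le> norm z powr p" using True p by (intro powr_mono') auto
      also have "\<dots> \<le> t powr p" using t p by (intro powr_mono2) auto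
      finally have zp: "norm z \<le> t powr p" .
      have "\<bar>heat_grad a u (x - z) - heat_grad a u x\<bar> \<le> A1 * norm z * rho x powr (-M)"
        unfolding A1_def by (rule heat_grad_lipschitz_near[OF a M True u])
      also have "\<dots> \<le> A1 * t powr p * rho x powr (-M)"
        using A zp by (intro mult_right_mono mult_left_mono) auto
      also have "\<dots> = A1 * P" by (simp only: P_def mult.assoc)
      also have "\<dots> \<le> (A1 + A2) * P" using A P by (intro mult_right_mono) auto
      finally show ?thesis using True by simp
    next
      case False
      have "1 \<le> t powr p"
        using t False p by (intro ge_one_powr_ge_zero) auto
      then have "1 * (A2 * rho x powr (-M)) \<le> t powr p * (A2 * rho x powr (-M))"
        using A by (intro mult_right_mono) auto
      also have "\<dots> = A2 * P" by (simp only: P_def mult_ac)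
      also have "\<dots> \<le> (A1 + A2) * P" using A P by (intro mult_right_mono) auto
      finally have "\<bar>heat_grad a u x\<bar> \<le> (A1 + A2) * P"
        using abs_heat_grad_le[OF a M u, of x] by (simp add: A2_def)
      moreover have "\<bar>heat_grad a u (x - z)\<bar> \<le> B * rho (x - z) powr (- (m + 4))"
        unfolding B_def using a m u by (intro abs_heat_grad_le) auto
      ultimately show ?thesis using False by simp
    qed
    then show "\<bar>heat_grad (1 - \<epsilon>^2) u (x - \<epsilon> *\<^sub>R y) - heat_grad (1 - \<epsilon>^2) u x\<bar>
        \<le> (A1 + A2) * ((\<epsilon> * rho y) powr p * rho x powr (- (m + 2)))
        + (if norm (\<epsilon> *\<^sub>R y) \<le> 1 then 0 else B * rho (x - \<epsilon> *\<^sub>R y) powr (- (m + 4)))"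
      unfolding a_def P_def t_def M_def z_def .
  qed
qed

text \<open>
  For small \<open>a\<close> half of the exponent of the Gaussian is spent: one quarter absorbs the factor \<open>x\<close>
  at the price of \<open>sqrt a\<close>, another one the weight.
\<close>

lemma heat_grad_short_time:
  assumes a: "0 < a" "a \<le> 1" and m: "m \<ge> 0" and u: "norm u \<le> 1"
  shows "rho x powr m * \<bar>heat_grad a u x\<bar> \<le> 2 * exp (4 * m^2) * (1 / a^2) * exp (- ((norm x)^2 / (8 * a)))"
proof -
  define r where "r = norm x"
  define s where "s = sqrt a"
  have s: "s > 0" "s^2 = a" using a by (auto simp: s_def)
  have r0: "r \<ge> 0" by (simp add: r_def)
  \<comment> \<open>The inequality \<open>m r \<le> r^2 / (16 a) + 4 m^2 a\<close> says that the square of \<open>r / (4s) - 2 m s\<close> is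
    nonnegative, where \<open>s = sqrt a\<close>.\<close>
  have e1: "rho x powr m \<le> exp (r^2 / (16 * a)) * exp (4 * m^2)"
  proof -
    have "rho x powr m = exp (m * ln (rho x))"
      by (simp add: powr_def)
    also have "\<dots> \<le> exp (m * r)"
      using m ln_add_one_self_le_self[of "norm x"] by (simp add: rho_def r_def mult_left_mono)
    also have "m * r \<le> r^2 / (16 * a) + 4 * m^2"
    proof -
      have "0 \<le> (r / (4 * s) - 2 * m * s)^2" by simp
      also have "\<dots> = r^2 / (16 * a) + 4 * m^2 * a - m * r"
        using s(1) by (simp add: s(2)[symmetric] power2_eq_square field_simps)
      finally have "m * r \<le> r^2 / (16 * a) + 4 * m^2 * a" by simp
      moreover have "4 * m^2 * a \<le> 4 * m^2 * 1" using a by (intro mult_left_mono) auto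
      ultimately show ?thesis by linarith
    qed
    finally show ?thesis by (simp add: exp_add)
  qed
  have e2: "r \<le> 4 * s * exp (r^2 / (16 * a))"
  proof -
    define v where "v = r / (4 * s)"
    have "v \<le> 1 + v^2"
      using zero_le_power2[of "v - 1/2"] by (simp add: power2_eq_square algebra_simps)
    also have "\<dots> \<le> exp (v^2)" by (rule exp_ge_add_one_self)
    also have "v^2 = r^2 / (16 * a)"
      by (simp add: v_def power_divide power_mult_distrib s)
    finally show ?thesis using s by (simp add: v_def field_simps)
  qed
  have e3: "(4 * pi * a) powr (- 3 / 2) \<le> 1 / (s * a)"
  proof -
    have "1 * a \<le> 4 * pi * a" using a pi_gt3 by (intro mult_right_mono) auto
    then have "(4 * pi * a) powr (- 3 / 2) \<le> a powr (- 3 / 2)"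
      using a by (intro powr_mono2') auto
    also have "\<dots> = 1 / (s * a)"
    proof -
      have "a powr (1/2 + 1) = s * a" unfolding powr_add using a by (simp add: s_def powr_half_sqrt)
      moreover have "1/2 + 1 = (3/2::real)" by simp
      ultimately have "a powr (3 / 2) = s * a" by (simp only:)
      moreover have "a powr (- 3 / 2) = inverse (a powr (3 / 2))"
        using powr_minus[of a "3/2"] by simp
      ultimately show ?thesis by (simp only: divide_inverse mult_1_left)
    qed
    finally show ?thesis .
  qed
  have "\<bar>u \<bullet> x\<bar> \<le> r"
    using Cauchy_Schwarz_ineq2[of u x] mult_right_mono[OF u, of "norm x"] by (simp add: r_def)
  then have "\<bar>heat_grad a u x\<bar> \<le> r / (2 * a) * heat a x"
    unfolding heat_grad_def abs_mult abs_of_nonneg[OF heat_nonneg] using a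
    by (intro mult_right_mono heat_nonneg) (simp add: divide_right_mono)
  also have "\<dots> \<le> (4 * s * exp (r^2 / (16 * a))) / (2 * a) * (1 / (s * a) * exp (- (r^2 / (4 * a))))"
    unfolding heat_def r_def[symmetric] using a s r0 e2
    by (intro mult_mono divide_right_mono e3) auto
  also have "\<dots> = (4 * s / (2 * a) * (1 / (s * a))) * (exp (r^2 / (16 * a)) * exp (- (r^2 / (4 * a))))"
    by (simp only: times_divide_eq_right times_divide_eq_left mult_ac)
  also have "4 * s / (2 * a) * (1 / (s * a)) = 2 * (1 / a^2)"
    using a s(1) by (simp add: power2_eq_square divide_simps)
  finally have g: "\<bar>heat_grad a u x\<bar> \<le> 2 * (1 / a^2) * (exp (r^2 / (16 * a)) * exp (- (r^2 / (4 * a))))" .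
  have "rho x powr m * \<bar>heat_grad a u x\<bar>
      \<le> (exp (r^2 / (16 * a)) * exp (4 * m^2)) * (2 * (1 / a^2) * (exp (r^2 / (16 * a)) * exp (- (r^2 / (4 * a)))))"
    by (intro mult_mono e1 g) auto
  also have "\<dots> = 2 * exp (4 * m^2) * (1 / a^2) * (exp (r^2 / (16 * a)) * exp (r^2 / (16 * a)) * exp (- (r^2 / (4 * a))))"
    by (simp only: mult_ac)
  also have "exp (r^2 / (16 * a)) * exp (r^2 / (16 * a)) * exp (- (r^2 / (4 * a))) = exp (- (r^2 / (8 * a)))"
  proof -
    have "r^2 / (16 * a) + r^2 / (16 * a) + (- (r^2 / (4 * a))) = - (r^2 / (8 * a))"
      using a by (simp add: divide_simps)
    then show ?thesis by (simp only: exp_add[symmetric])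
  qed
  finally show ?thesis by (simp add: r_def)
qed

section \<open>Smooth functions and the divergence-free condition\<close>

text \<open>
  The usual function \<open>exp (- 1/t)\<close> times powers of \<open>1/t\<close>. The whole family is introduced because
  its linear span is closed under differentiation.
\<close>

definition bump :: "nat \<Rightarrow> real \<Rightarrow> real"
  where "bump n t = (if t > 0 then exp (- inverse t) * inverse t ^ n else 0)"

lemma bump_tendsto_0: "(bump n \<longlongrightarrow> 0) (at 0)"
proof -
  have "((\<lambda>t. inverse t ^ n / exp (inverse t)) \<longlongrightarrow> 0) (at_right (0::real))"
    by (rule filterlim_compose[OF tendsto_power_div_exp_0 filterlim_inverse_at_top_right])
  then have "(bump n \<longlongrightarrow> 0) (at_right 0)"
    by (rule Lim_transform_eventually)
       (auto simp: bump_def exp_minus field_simps eventually_at_right_less intro: eventually_mono[OF eventually_at_right_less])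
  moreover have "(bump n \<longlongrightarrow> 0) (at_left 0)"
    by (rule Lim_transform_eventually[OF tendsto_const])
       (auto simp: bump_def eventually_at_filter)
  ultimately show ?thesis
    by (simp add: filterlim_at_split)
qed

lemma bump_deriv: "(bump n has_real_derivative (bump (n + 2) t - real n * bump (n + 1) t)) (at t)"
proof -
  consider "t > 0" | "t < 0" | "t = 0" by linarith
  then show ?thesis
  proof cases
    case 1
    have i: "(inverse has_real_derivative - (inverse t * inverse t)) (at t)"
      using DERIV_inverse[of t UNIV] 1 by (simp add: numeral_2_eq_2)
    have "((\<lambda>t. exp (- inverse t) * inverse t ^ n) has_real_derivative
        exp (- inverse t) * (real n * (inverse t ^ (n - 1) * - (inverse t * inverse t)))
        + exp (- inverse t) * - (- (inverse t * inverse t)) * inverse t ^ n) (at t)"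
      by (rule derivative_eq_intros i refl | simp)+
    also have "exp (- inverse t) * (real n * (inverse t ^ (n - 1) * - (inverse t * inverse t)))
        + exp (- inverse t) * - (- (inverse t * inverse t)) * inverse t ^ n
        = bump (n + 2) t - real n * bump (n + 1) t"
      using 1 by (cases n) (simp_all add: bump_def algebra_simps)
    finally show ?thesis
      by (rule has_field_derivative_transform_within_open[of _ _ _ "{0<..}"])
         (use 1 in \<open>auto simp: bump_def\<close>)
  next
    case 2
    have "((\<lambda>t. 0) has_real_derivative 0) (at t)" by simp
    then have "(bump n has_real_derivative 0) (at t)"
      by (rule has_field_derivative_transform_within_open[of _ _ _ "{..<0}"])
         (use 2 in \<open>auto simp: bump_def\<close>)
    then show ?thesis using 2 by (simp add: bump_def)
  next
    case 3
    have "((\<lambda>h. bump n h / h) \<longlongrightarrow> 0) (at 0)"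
      by (rule Lim_transform_eventually[OF bump_tendsto_0[of "n + 1"]])
         (auto simp: bump_def eventually_at_filter field_simps)
    then have "(bump n has_real_derivative 0) (at 0)"
      unfolding DERIV_def by (simp add: bump_def[of n 0])
    then show ?thesis using 3 by (simp add: bump_def)
  qed
qed

lemma bump_0_le: "bump 0 t \<ge> 0" "bump 0 t \<le> 1"
  by (auto simp: bump_def)

lemma bump_2_le: "bump 2 t \<ge> 0" "bump 2 t \<le> 2"
proof -
  show "bump 2 t \<ge> 0" by (auto simp: bump_def)
  show "bump 2 t \<le> 2"
  proof (cases "t > 0")
    case True
    have "1 + inverse t + (inverse t)^2 / 2 \<le> exp (inverse t)"
      using True by (intro exp_lower_Taylor_quadratic) simp
    moreover have "inverse t \<ge> 0" using True by simp
    ultimately have "(inverse t)^2 \<le> 2 * exp (inverse t)" by linarith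
    then show ?thesis using True by (simp add: bump_def exp_minus field_simps)
  qed (simp add: bump_def)
qed

text \<open>
  A class of expressions that is closed under partial derivatives, so that membership implies
  \<open>C_k k\<close> for all \<open>k\<close> by induction on \<open>k\<close>. It contains what is paired with divergence-free fields
  below: polynomials, a cutoff function, and \<open>1 / sqrt (\<delta> + norm (x - y)^2)\<close>.
\<close>

inductive smooth :: "(real^3 \<Rightarrow> real) \<Rightarrow> bool" where
  smooth_const: "smooth (\<lambda>x. c)"
| smooth_coord: "smooth (\<lambda>x. x $ i)"
| smooth_add: "smooth f \<Longrightarrow> smooth g \<Longrightarrow> smooth (\<lambda>x. f x + g x)"
| smooth_mult: "smooth f \<Longrightarrow> smooth g \<Longrightarrow> smooth (\<lambda>x. f x * g x)"
| smooth_inverse: "smooth f \<Longrightarrow> (\<And>x. f x \<noteq> 0) \<Longrightarrow> smooth (\<lambda>x. inverse (f x))"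
| smooth_sqrt: "smooth f \<Longrightarrow> (\<And>x. f x > 0) \<Longrightarrow> smooth (\<lambda>x. sqrt (f x))"
| smooth_bump: "smooth f \<Longrightarrow> smooth (\<lambda>x. bump n (f x))"

lemma partialI: "(f has_derivative D) (at x) \<Longrightarrow> partial j f x = D (axis j 1)"
  unfolding partial_def using frechet_derivative_at by metis

lemma sum_mult_axis: "(\<Sum>i\<in>UNIV. c i * axis (j::3) (1::real) $ i) = c j"
proof -
  have "(\<Sum>i\<in>UNIV. c i * axis j 1 $ i) = (\<Sum>i\<in>UNIV. if i = j then c i else 0)"
    by (intro sum.cong) (auto simp: axis_def)
  then show ?thesis by simp
qed

lemma smooth_chain_aux:
  assumes "smooth f" "\<And>j. smooth (g j)" "smooth q'"
    and "\<And>x. (f has_derivative (\<lambda>h. \<Sum>j\<in>UNIV. g j x * h $ j)) (at x)"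
    and "\<And>x. (q has_real_derivative q' x) (at (f x))"
  shows "\<exists>g. (\<forall>j. smooth (g j)) \<and>
    (\<forall>x. ((\<lambda>x. q (f x)) has_derivative (\<lambda>h. \<Sum>j\<in>UNIV. g j x * h $ j)) (at x))"
proof (intro exI conjI allI)
  show "smooth (\<lambda>x. q' x * g j x)" for j
    by (intro smooth_mult assms)
  show "((\<lambda>x. q (f x)) has_derivative (\<lambda>h. \<Sum>j\<in>UNIV. (q' x * g j x) * h $ j)) (at x)" for x
    using DERIV_compose_FDERIV[OF assms(5) assms(4)]
    by (simp add: sum_distrib_left mult_ac)
qed

text \<open>
  Closure of the class under differentiation, with the gradient as a witness; \<open>bump n\<close> is
  differentiated by \<open>bump_deriv\<close>.
\<close>

lemma smooth_has_derivative:
  assumes "smooth f"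
  shows "\<exists>g. (\<forall>j. smooth (g j)) \<and> (\<forall>x. (f has_derivative (\<lambda>h. \<Sum>j\<in>UNIV. g j x * h $ j)) (at x))"
  using assms
proof induction
  case (smooth_const c)
  show ?case
    by (intro exI[of _ "\<lambda>j x. 0"]) (auto intro!: smooth.smooth_const)
next
  case (smooth_coord i)
  have "((\<lambda>x::real^3. x $ i) has_derivative (\<lambda>h. \<Sum>j\<in>UNIV. (if j = i then 1 else 0) * h $ j)) (at x)" for x
  proof -
    have "(\<lambda>h::real^3. \<Sum>j\<in>UNIV. (if j = i then 1 else 0) * h $ j) = (\<lambda>h. h $ i)"
      by (auto simp: if_distrib[where f="\<lambda>c. c * _"] cong: if_cong)
    then show ?thesis
      by (simp add: bounded_linear_imp_has_derivative bounded_linear_vec_nth)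
  qed
  then show ?case
    by (intro exI[of _ "\<lambda>j x. if j = i then 1 else 0"]) (auto intro!: smooth.smooth_const)
next
  case (smooth_add f1 f2)
  then obtain g1 g2 where g: "\<And>j. smooth (g1 j)" "\<And>j. smooth (g2 j)"
    "\<And>x. (f1 has_derivative (\<lambda>h. \<Sum>j\<in>UNIV. g1 j x * h $ j)) (at x)"
    "\<And>x. (f2 has_derivative (\<lambda>h. \<Sum>j\<in>UNIV. g2 j x * h $ j)) (at x)" by blast
  show ?case
  proof (intro exI conjI allI)
    show "smooth (\<lambda>x. g1 j x + g2 j x)" for j
      by (intro smooth.smooth_add g)
    show "((\<lambda>x. f1 x + f2 x) has_derivative (\<lambda>h. \<Sum>j\<in>UNIV. (g1 j x + g2 j x) * h $ j)) (at x)" for x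
      using has_derivative_add[OF g(3) g(4)] by (simp add: sum.distrib distrib_right)
  qed
next
  case (smooth_mult f1 f2)
  then obtain g1 g2 where g: "\<And>j. smooth (g1 j)" "\<And>j. smooth (g2 j)"
    "\<And>x. (f1 has_derivative (\<lambda>h. \<Sum>j\<in>UNIV. g1 j x * h $ j)) (at x)"
    "\<And>x. (f2 has_derivative (\<lambda>h. \<Sum>j\<in>UNIV. g2 j x * h $ j)) (at x)" by blast
  show ?case
  proof (intro exI conjI allI)
    show "smooth (\<lambda>x. f1 x * g2 j x + g1 j x * f2 x)" for j
      by (intro smooth.smooth_add smooth.smooth_mult g smooth_mult)
    show "((\<lambda>x. f1 x * f2 x) has_derivative (\<lambda>h. \<Sum>j\<in>UNIV. (f1 x * g2 j x + g1 j x * f2 x) * h $ j)) (at x)" for x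
    proof -
      have "(\<lambda>h. f1 x * (\<Sum>j\<in>UNIV. g2 j x * h $ j) + (\<Sum>j\<in>UNIV. g1 j x * h $ j) * f2 x)
          = (\<lambda>h. \<Sum>j\<in>UNIV. (f1 x * g2 j x + g1 j x * f2 x) * h $ j)"
        by (simp add: fun_eq_iff sum.distrib distrib_right sum_distrib_left sum_distrib_right mult_ac(1,2))
          (simp add: sum.distrib[symmetric] algebra_simps)
      then show ?thesis using has_derivative_mult[OF g(3) g(4), of x] by simp
    qed
  qed
next
  case (smooth_inverse f)
  then obtain g where g: "\<And>j. smooth (g j)"
    "\<And>x. (f has_derivative (\<lambda>h. \<Sum>j\<in>UNIV. g j x * h $ j)) (at x)" by blast
  have i: "smooth (\<lambda>x. inverse (f x))"
    by (intro smooth.smooth_inverse smooth_inverse)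
  show ?case
  proof (rule smooth_chain_aux[OF _ g(1) _ g(2)])
    show "smooth (\<lambda>x. (-1) * (inverse (f x) * inverse (f x)))"
      by (intro smooth.smooth_mult smooth.smooth_const i)
    show "(inverse has_real_derivative (-1) * (inverse (f x) * inverse (f x))) (at (f x))" for x
      using DERIV_inverse[of "f x" UNIV] smooth_inverse by (simp add: power2_eq_square numeral_2_eq_2)
  qed (use smooth_inverse in simp)
next
  case (smooth_sqrt f)
  then obtain g where g: "\<And>j. smooth (g j)"
    "\<And>x. (f has_derivative (\<lambda>h. \<Sum>j\<in>UNIV. g j x * h $ j)) (at x)" by blast
  have s: "smooth (\<lambda>x. sqrt (f x))"
    by (intro smooth.smooth_sqrt smooth_sqrt)
  show ?case
  proof (rule smooth_chain_aux[OF _ g(1) _ g(2)])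
    have "sqrt (f x) \<noteq> 0" for x using smooth_sqrt(2)[of x] by simp
    then show "smooth (\<lambda>x. inverse (sqrt (f x)) * (1 / 2))"
      by (intro smooth.smooth_mult smooth.smooth_inverse smooth.smooth_const s)
    show "(sqrt has_real_derivative inverse (sqrt (f x)) * (1 / 2)) (at (f x))" for x
      using DERIV_real_sqrt[OF smooth_sqrt(2)[of x]] by simp
  qed (use smooth_sqrt in simp)
next
  case (smooth_bump f n)
  then obtain g where g: "\<And>j. smooth (g j)"
    "\<And>x. (f has_derivative (\<lambda>h. \<Sum>j\<in>UNIV. g j x * h $ j)) (at x)" by blast
  show ?case
  proof (rule smooth_chain_aux[OF _ g(1) _ g(2)])
    show "smooth (\<lambda>x. bump (n + 2) (f x) + (- real n) * bump (n + 1) (f x))"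
      by (intro smooth.intros smooth_bump)
    show "(bump n has_real_derivative (bump (n + 2) (f x) + (- real n) * bump (n + 1) (f x))) (at (f x))" for x
      using bump_deriv[of n "f x"] by simp
  qed (use smooth_bump in simp)
qed

lemma smooth_partial:
  assumes "smooth f"
  shows "smooth (partial j f)"
    and "(f has_derivative (\<lambda>h. \<Sum>j\<in>UNIV. partial j f x * h $ j)) (at x)"
proof -
  obtain g where g: "\<And>j. smooth (g j)"
    "\<And>x. (f has_derivative (\<lambda>h. \<Sum>j\<in>UNIV. g j x * h $ j)) (at x)"
    using smooth_has_derivative[OF assms] by blast
  have eq: "partial j f = g j" for j
  proof
    fix x
    show "partial j f x = g j x"
      using partialI[OF g(2)[of x], of j] by (simp add: sum_mult_axis)
  qed
  show "smooth (partial j f)" using g eq by simp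
  show "(f has_derivative (\<lambda>h. \<Sum>j\<in>UNIV. partial j f x * h $ j)) (at x)" using g eq by simp
qed

lemma smooth_C_k: "smooth f \<Longrightarrow> C_k k f"
proof (induction k arbitrary: f)
  case 0
  have "f differentiable (at x)" for x
    using smooth_partial(2)[OF 0] by (auto simp: differentiable_def)
  then show ?case
    by (auto simp: continuous_at_imp_continuous_on differentiable_imp_continuous_within)
next
  case (Suc k)
  have "f differentiable (at x)" for x
    using smooth_partial(2)[OF Suc.prems] by (auto simp: differentiable_def)
  then show ?case
    using Suc.IH smooth_partial(1)[OF Suc.prems] by simp
qed

lemma smooth_measurable: "smooth f \<Longrightarrow> f \<in> borel_measurable borel"
  using smooth_C_k[of f 0] by (simp add: borel_measurable_continuous_onI)

lemma smooth_partial_mult: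
  assumes "smooth f" "smooth g"
  shows "partial j (\<lambda>x. f x * g x) x = f x * partial j g x + partial j f x * g x"
  using partialI[OF has_derivative_mult[OF smooth_partial(2)[OF assms(1)] smooth_partial(2)[OF assms(2)], of x], of j]
  by (simp add: sum_mult_axis)

lemma smooth_diff_inner: "smooth (\<lambda>x. (x - y) \<bullet> (x - y))"
proof -
  have eq: "(\<lambda>x::real^3. (x - y) \<bullet> (x - y)) =
    (\<lambda>x. (x $ 1 + (- y $ 1)) * (x $ 1 + (- y $ 1)) + (x $ 2 + (- y $ 2)) * (x $ 2 + (- y $ 2))
      + (x $ 3 + (- y $ 3)) * (x $ 3 + (- y $ 3)))"
    by (auto simp: inner_vec_def sum_3)
  show ?thesis unfolding eq by (intro smooth.intros)
qed

text \<open>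
  Supported in the ball of radius \<open>R\<close>. As \<open>R\<close> grows it tends to \<open>bump 0 1 = exp (- 1)\<close>; the value
  at the centre is not normalized. The difference \<open>x - 0\<close> makes it an instance of
  \<open>smooth_diff_inner\<close>.
\<close>

definition cutoff :: "real \<Rightarrow> real^3 \<Rightarrow> real"
  where "cutoff R x = bump 0 (1 + (- 1 / R^2) * ((x - 0) \<bullet> (x - 0)))"

lemma smooth_cutoff: "smooth (cutoff R)"
  unfolding cutoff_def by (intro smooth_bump smooth_add smooth_mult smooth_const smooth_diff_inner)

lemma partial_cutoff:
  "partial j (cutoff R) x = bump 2 (1 + (- 1 / R^2) * (x \<bullet> x)) * (- 2 * x $ j / R^2)"
proof -
  have d: "((\<lambda>x. 1 + c * (x \<bullet> x)) has_derivative (\<lambda>h. c * (2 * (x \<bullet> h)))) (at x)" for c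
    by (auto intro!: derivative_eq_intros simp: inner_commute algebra_simps)
  have "(bump 0 has_real_derivative bump 2 (1 + (- 1 / R^2) * (x \<bullet> x))) (at (1 + (- 1 / R^2) * (x \<bullet> x)))"
    using bump_deriv[of 0 "1 + (- 1 / R^2) * (x \<bullet> x)"] by (simp add: numeral_2_eq_2)
  from DERIV_compose_FDERIV[OF this d] have
    "(cutoff R has_derivative (\<lambda>h. (- 1 / R^2) * (2 * (x \<bullet> h)) * bump 2 (1 + (- 1 / R^2) * (x \<bullet> x)))) (at x)"
    by (simp add: cutoff_def[abs_def])
  from partialI[OF this, of j] show ?thesis
    by (simp add: inner_axis)
qed

lemma cutoff_support:
  assumes "R > 0" "norm x \<ge> R"
  shows "bump n (1 + (- 1 / R^2) * (x \<bullet> x)) = 0"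
proof -
  have "R^2 \<le> x \<bullet> x"
    using assms power_mono[of R "norm x" 2] by (simp add: power2_norm_eq_inner)
  then have "1 + (- 1 / R^2) * (x \<bullet> x) \<le> 0"
    using assms by (simp add: field_simps)
  then show ?thesis by (simp add: bump_def)
qed

lemma test_function_cutoff_mult:
  assumes "smooth \<phi>" "R > 0"
  shows "test_function (\<lambda>x. \<phi> x * cutoff R x)"
  unfolding test_function_def
proof (intro conjI allI)
  show "C_k k (\<lambda>x. \<phi> x * cutoff R x)" for k
    by (intro smooth_C_k smooth_mult assms smooth_cutoff)
  have "{x. \<phi> x * cutoff R x \<noteq> 0} \<subseteq> cball 0 R"
  proof
    fix x assume "x \<in> {x. \<phi> x * cutoff R x \<noteq> 0}"
    then have "\<not> norm x \<ge> R"
      using cutoff_support[OF assms(2), of x 0] by (auto simp: cutoff_def)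
    then show "x \<in> cball 0 R" by simp
  qed
  then have "bounded {x. \<phi> x * cutoff R x \<noteq> 0}"
    using bounded_cball bounded_subset by blast
  then show "compact (closure {x. \<phi> x * cutoff R x \<noteq> 0})"
    by (simp add: compact_closure)
qed

lemma measurable_component [measurable (raw)]:
  fixes f :: "'a \<Rightarrow> real^3"
  assumes "f \<in> borel_measurable M"
  shows "(\<lambda>x. f x $ j) \<in> borel_measurable M"
proof -
  have "(\<lambda>x. f x \<bullet> axis j 1) \<in> borel_measurable M"
    using assms by measurable
  then show ?thesis by (simp add: inner_axis)
qed

text \<open>
  The divergence condition, stated for compactly supported test functions, extends to functions of
  quadratic growth if the first moment of \<open>w\<close> is finite: the gradient of the cutoff is at most of
  order \<open>norm x / R^2\<close> and is supported in \<open>norm x \<le> R\<close>, hence its product with \<open>\<phi>\<close> is dominated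
  by \<open>rho\<close> uniformly in \<open>R\<close>.
\<close>

lemma div_free_pairing:
  assumes w: "distr_div_free w" and [measurable]: "w \<in> borel_measurable borel"
    and int: "integrable lborel (\<lambda>x. rho x * norm (w x))"
    and s: "smooth \<phi>" and C: "\<And>x. \<bar>\<phi> x\<bar> \<le> C * (rho x)^2" "\<And>j x. \<bar>partial j \<phi> x\<bar> \<le> C * rho x"
  shows "(LINT x|lborel. (\<Sum>j\<in>UNIV. w x $ j * partial j \<phi> x)) = 0"
proof -
  have C0: "C \<ge> 0"
    using C(1)[of 0] by (simp add: rho_def)
  have [measurable]: "\<phi> \<in> borel_measurable borel" "cutoff R \<in> borel_measurable borel"
    "partial j \<phi> \<in> borel_measurable borel" "partial j (cutoff R) \<in> borel_measurable borel" for j R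
    by (intro smooth_measurable smooth_partial s smooth_cutoff)+
  define R where "R n = real n + 1" for n :: nat
  have R: "R n \<ge> 1" for n by (simp add: R_def)
  define f where "f n x = (\<Sum>j\<in>UNIV. w x $ j * (\<phi> x * partial j (cutoff (R n)) x + partial j \<phi> x * cutoff (R n) x))" for n x
  have f0: "(LINT x|lborel. f n x) = 0" for n
  proof -
    have "test_function (\<lambda>x. \<phi> x * cutoff (R n) x)"
      using R[of n] by (intro test_function_cutoff_mult s) simp
    then have "(LINT x|lborel. (\<Sum>j\<in>UNIV. w x $ j * partial j (\<lambda>x. \<phi> x * cutoff (R n) x) x)) = 0"
      using w by (auto simp: distr_div_free_def)
    then show ?thesis
      unfolding f_def by (simp add: smooth_partial_mult[OF s smooth_cutoff])
  qed
  have Rlim: "filterlim R at_top sequentially"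
    by (rule filterlim_at_top_mono[OF filterlim_real_sequentially]) (simp add: R_def)
  have inv: "(\<lambda>n. 1 / (R n)^2) \<longlonglongrightarrow> 0"
    by (rule real_tendsto_divide_at_top[OF tendsto_const])
       (intro filterlim_pow_at_top Rlim, simp)
  have "(\<lambda>n. LINT x|lborel. f n x) \<longlonglongrightarrow> (LINT x|lborel. (\<Sum>j\<in>UNIV. w x $ j * (partial j \<phi> x * bump 0 1)))"
  proof (rule integral_dominated_convergence)
    show "(\<lambda>x. \<Sum>j\<in>UNIV. w x $ j * (partial j \<phi> x * bump 0 1)) \<in> borel_measurable lborel"
      by measurable
    show "f n \<in> borel_measurable lborel" for n
      unfolding f_def by measurable
    \<comment> \<open>Each of the three components contributes at most \<open>9 C rho x\<close>: 8 from the derivative of the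
      cutoff, 1 from the derivative of \<open>\<phi>\<close>.\<close>
    show "integrable lborel (\<lambda>x. 27 * C * (rho x * norm (w x)))"
      by (intro integrable_mult_right int)
    show "AE x in lborel. (\<lambda>n. f n x) \<longlonglongrightarrow> (\<Sum>j\<in>UNIV. w x $ j * (partial j \<phi> x * bump 0 1))"
    proof (intro always_eventually allI)
      fix x :: "real^3"
      have lim1: "(\<lambda>n. 1 + (- 1 / (R n)^2) * (x \<bullet> x)) \<longlonglongrightarrow> 1"
      proof -
        have "(\<lambda>n. 1 - (1 / (R n)^2) * (x \<bullet> x)) \<longlonglongrightarrow> 1 - 0 * (x \<bullet> x)"
          by (intro tendsto_intros inv)
        then show ?thesis by simp
      qed
      have lim2: "(\<lambda>n. cutoff (R n) x) \<longlonglongrightarrow> bump 0 1"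
        using isCont_tendsto_compose[OF DERIV_isCont[OF bump_deriv[of 0 1]] lim1]
        by (simp add: cutoff_def)
      have lim3: "(\<lambda>n. partial j (cutoff (R n)) x) \<longlonglongrightarrow> 0" for j
      proof -
        have "(\<lambda>n. bump 2 (1 + (- 1 / (R n)^2) * (x \<bullet> x)) * (- 2 * x $ j * (1 / (R n)^2))) \<longlonglongrightarrow> bump 2 1 * (- 2 * x $ j * 0)"
          by (intro tendsto_mult tendsto_const inv isCont_tendsto_compose[OF DERIV_isCont[OF bump_deriv[of 2 1]] lim1])
        then show ?thesis by (simp add: partial_cutoff)
      qed
      have "(\<lambda>n. f n x) \<longlonglongrightarrow> (\<Sum>j\<in>UNIV. w x $ j * (\<phi> x * 0 + partial j \<phi> x * bump 0 1))"
        unfolding f_def by (intro tendsto_sum tendsto_mult tendsto_add tendsto_const lim2 lim3)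
      then show "(\<lambda>n. f n x) \<longlonglongrightarrow> (\<Sum>j\<in>UNIV. w x $ j * (partial j \<phi> x * bump 0 1))" by simp
    qed
    show "AE x in lborel. norm (f n x) \<le> 27 * C * (rho x * norm (w x))" for n
    proof (intro always_eventually allI)
      fix x :: "real^3"
      have pc: "\<bar>\<phi> x * partial j (cutoff (R n)) x\<bar> \<le> 8 * C * rho x" for j
      proof (cases "norm x \<ge> R n")
        case True
        then have "partial j (cutoff (R n)) x = 0"
          using R[of n] cutoff_support[of "R n" x 2] by (simp add: partial_cutoff)
        then show ?thesis using C0 by simp
      next
        case False
        have "\<bar>partial j (cutoff (R n)) x\<bar> \<le> 2 * (2 * norm x / (R n)^2)"
          unfolding partial_cutoff abs_mult
          using bump_2_le component_le_norm_cart[of x j]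
          by (intro mult_mono) (auto simp: abs_mult intro!: divide_right_mono)
        then have "\<bar>\<phi> x * partial j (cutoff (R n)) x\<bar> \<le> C * (rho x)^2 * (2 * (2 * norm x / (R n)^2))"
          unfolding abs_mult by (intro mult_mono C) (use C0 in auto)
        also have "\<dots> = 4 * C * rho x * (rho x / R n * (norm x / R n))"
          by (simp add: power2_eq_square)
        also have "\<dots> \<le> 4 * C * rho x * (2 * 1)"
        proof (intro mult_left_mono mult_mono)
          show "rho x / R n \<le> 2" "norm x / R n \<le> 1"
            using False R[of n] by (auto simp: rho_def divide_simps)
        qed (use C0 R[of n] in auto)
        finally show ?thesis by simp
      qed
      have "\<bar>\<phi> x * partial j (cutoff (R n)) x + partial j \<phi> x * cutoff (R n) x\<bar> \<le> 9 * C * rho x" for j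
      proof -
        have "\<bar>partial j \<phi> x * cutoff (R n) x\<bar> \<le> C * rho x * 1"
          unfolding abs_mult using bump_0_le by (intro mult_mono C) (use C0 in \<open>auto simp: cutoff_def\<close>)
        then show ?thesis using pc[of j] by linarith
      qed
      then have "\<bar>w x $ j * (\<phi> x * partial j (cutoff (R n)) x + partial j \<phi> x * cutoff (R n) x)\<bar> \<le> norm (w x) * (9 * C * rho x)" for j
        unfolding abs_mult by (intro mult_mono component_le_norm_cart) auto
      then have "norm (f n x) \<le> (\<Sum>j\<in>(UNIV::3 set). norm (w x) * (9 * C * rho x))"
        unfolding f_def real_norm_def by (intro order_trans[OF sum_abs] sum_mono)
      then show "norm (f n x) \<le> 27 * C * (rho x * norm (w x))" by (simp add: mult_ac)
    qed
  qed
  then have "(LINT x|lborel. (\<Sum>j\<in>UNIV. w x $ j * (partial j \<phi> x * bump 0 1))) = 0"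
    unfolding f0 using LIMSEQ_unique tendsto_const by blast
  moreover have "(\<Sum>j\<in>UNIV. w x $ j * (partial j \<phi> x * bump 0 1)) = bump 0 1 * (\<Sum>j\<in>UNIV. w x $ j * partial j \<phi> x)" for x
    by (simp add: sum_distrib_left mult_ac)
  ultimately have "bump 0 1 * (LINT x|lborel. (\<Sum>j\<in>UNIV. w x $ j * partial j \<phi> x)) = 0"
    by simp
  then show ?thesis by (simp add: bump_def)
qed

section \<open>Moments of solenoidal fields\<close>

lemma measurable_of_components:
  fixes w :: "'a \<Rightarrow> real^3"
  assumes "\<And>i. (\<lambda>x. w x $ i) \<in> borel_measurable M"
  shows "w \<in> borel_measurable M"
  unfolding borel_measurable_euclidean_space[of w] using assms
  by (auto simp: Basis_vec_def inner_axis)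

lemma weighted_bound_of_components:
  assumes "\<And>i. (\<lambda>x. w x $ i) \<in> weighted_L2 m"
  shows "weighted_bound m w (weighted_norm m w)"
    and "(NN x. ennreal ((rho x powr m * norm (w x))^2)) = ennreal ((weighted_norm m w)^2)"
proof -
  have meas[measurable]: "w \<in> borel_measurable borel"
    using assms by (intro measurable_of_components) (auto simp: weighted_L2_def)
  have "integrable lborel (\<lambda>x. \<Sum>i\<in>UNIV. (rho x powr m * w x $ i)^2)"
    using assms by (intro Bochner_Integration.integrable_sum) (auto simp: weighted_L2_def)
  also have "(\<lambda>x. \<Sum>i\<in>UNIV. (rho x powr m * w x $ i)^2) = (\<lambda>x. (rho x powr m * norm (w x))^2)"
    by (simp add: power_mult_distrib norm_vec_def L2_set_def sum_distrib_left sum_nonneg)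
  finally have int: "integrable lborel (\<lambda>x. (rho x powr m * norm (w x))^2)" .
  show eq: "(NN x. ennreal ((rho x powr m * norm (w x))^2)) = ennreal ((weighted_norm m w)^2)"
    by (subst nn_integral_eq_integral[OF int]) (simp_all add: weighted_norm_def L2_norm_def)
  show "weighted_bound m w (weighted_norm m w)"
    unfolding weighted_bound_def using eq by (simp add: weighted_norm_def L2_norm_def)
qed

lemma weighted_L2_diff:
  assumes "f \<in> weighted_L2 m" "g \<in> weighted_L2 m"
  shows "(\<lambda>x. f x - g x) \<in> weighted_L2 m"
proof -
  have [measurable]: "f \<in> borel_measurable borel" "g \<in> borel_measurable borel"
    using assms by (auto simp: weighted_L2_def)
  have "integrable lborel (\<lambda>x. (rho x powr m * (f x - g x))^2)"
  proof (rule Bochner_Integration.integrable_bound)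
    show "integrable lborel (\<lambda>x. 2 * (rho x powr m * f x)^2 + 2 * (rho x powr m * g x)^2)"
      using assms by (auto simp: weighted_L2_def)
    have "(a - b)^2 \<le> 2 * a^2 + 2 * b^2" for a b :: real
      using zero_le_power2[of "a + b"] by (simp add: power2_eq_square algebra_simps)
    then show "AE x in lborel. norm ((rho x powr m * (f x - g x))^2)
        \<le> norm (2 * (rho x powr m * f x)^2 + 2 * (rho x powr m * g x)^2)"
      by (simp add: right_diff_distrib)
  qed measurable
  then show ?thesis by (simp add: weighted_L2_def)
qed

lemma integrable_of_nn_bound:
  fixes f :: "'a \<Rightarrow> 'b::{banach, second_countable_topology}"
  assumes "f \<in> borel_measurable M" "(\<integral>\<^sup>+x. ennreal (norm (f x)) \<partial>M) \<le> ennreal c"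
  shows "integrable M f"
  using assms by (intro integrableI_bounded) (auto intro: le_less_trans)

lemma weighted_moment_integrable:
  assumes "weighted_bound m w N" "2 * (m - q) > 3"
  shows "integrable lborel (\<lambda>x. rho x powr q * norm (w x))"
proof -
  obtain C where "(NN x. ennreal (rho x powr q * norm (w x))) \<le> ennreal (C * N)"
    using weighted_moment_bound[OF assms(2)] assms(1) by blast
  moreover note weighted_boundD(1)[OF assms(1), measurable]
  ultimately show ?thesis
    by (intro integrable_of_nn_bound[where c="C * N"]) auto
qed

lemma solenoidal_weighted_bound:
  assumes "w \<in> solenoidal_L2 m"
  shows "weighted_bound m w (weighted_norm m w)"
  using assms by (intro weighted_bound_of_components) (simp add: solenoidal_L2_def)

lemma solenoidal_pairing:
  assumes w: "w \<in> solenoidal_L2 m" and m: "m > 5 / 2"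
    and "smooth \<phi>" "\<And>x. \<bar>\<phi> x\<bar> \<le> C * (rho x)^2" "\<And>j x. \<bar>partial j \<phi> x\<bar> \<le> C * rho x"
  shows "(LINT x|lborel. (\<Sum>j\<in>UNIV. w x $ j * partial j \<phi> x)) = 0"
proof (rule div_free_pairing)
  note b = solenoidal_weighted_bound[OF w]
  show "distr_div_free w" using w by (simp add: solenoidal_L2_def)
  show "w \<in> borel_measurable borel" by (rule weighted_boundD[OF b])
  show "integrable lborel (\<lambda>x. rho x * norm (w x))"
    using weighted_moment_integrable[OF b, of 1] m by simp
qed (use assms in auto)

lemma component_le_rho: "\<bar>x $ i\<bar> \<le> rho x"
  using component_le_norm_cart[of x i] by (simp add: rho_def)

lemma partial_coord: "partial j (\<lambda>x. x $ i) x = (if j = i then 1 else 0)"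
  by (subst partialI[OF bounded_linear_imp_has_derivative[OF bounded_linear_vec_nth]]) (simp add: axis_def eq_commute)

text \<open>
  Pairing with the gradient of a coordinate function.
\<close>

lemma solenoidal_mean_zero:
  assumes "w \<in> solenoidal_L2 m" "m > 5 / 2"
  shows "(LINT x|lborel. w x $ i) = 0"
proof -
  have "(LINT x|lborel. (\<Sum>j\<in>UNIV. w x $ j * partial j (\<lambda>x. x $ i) x)) = 0"
  proof (rule solenoidal_pairing[OF assms smooth_coord, of _ 1])
    fix x :: "real^3"
    have "\<bar>x $ i\<bar> \<le> rho x" by (rule component_le_rho)
    also have "\<dots> \<le> (rho x)^2" using rho_ge_1[of x] by (simp add: self_le_power)
    finally show "\<bar>x $ i\<bar> \<le> 1 * (rho x)^2" by simp
    show "\<bar>partial j (\<lambda>x. x $ i) x\<bar> \<le> 1 * rho x" for j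
      using rho_ge_1[of x] by (simp add: partial_coord)
  qed
  moreover have "(\<Sum>j\<in>UNIV. w x $ j * partial j (\<lambda>x. x $ i) x) = w x $ i" for x
    by (simp add: partial_coord if_distrib cong: if_cong)
  ultimately show ?thesis by simp
qed

text \<open>
  Pairing with the gradient of \<open>x $ i * x $ k\<close>.
\<close>

lemma solenoidal_first_moments_antisym:
  assumes "w \<in> solenoidal_L2 m" "m > 5 / 2"
  shows "(LINT x|lborel. x $ i * w x $ k) = - (LINT x|lborel. x $ k * w x $ i)"
proof -
  note b = solenoidal_weighted_bound[OF assms(1)]
  note [measurable] = weighted_boundD(1)[OF b]
  have part: "partial j (\<lambda>x. x $ i * x $ k) x = x $ i * (if j = k then 1 else 0) + (if j = i then 1 else 0) * x $ k" for j x
    using smooth_partial_mult[OF smooth_coord smooth_coord, of j i k x] by (simp add: partial_coord)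
  have "(LINT x|lborel. (\<Sum>j\<in>UNIV. w x $ j * partial j (\<lambda>x. x $ i * x $ k) x)) = 0"
  proof (rule solenoidal_pairing[OF assms smooth_mult[OF smooth_coord smooth_coord], of _ _ 2])
    fix x :: "real^3"
    have "\<bar>x $ i\<bar> * \<bar>x $ k\<bar> \<le> rho x * rho x"
      by (intro mult_mono component_le_rho) auto
    then show "\<bar>x $ i * x $ k\<bar> \<le> 2 * (rho x)^2"
      using zero_le_power2[of "rho x"] unfolding abs_mult power2_eq_square by linarith
    show "\<bar>partial j (\<lambda>x. x $ i * x $ k) x\<bar> \<le> 2 * rho x" for j
      unfolding part using component_le_rho[of x i] component_le_rho[of x k] rho_nonneg[of x]
      by auto
  qed
  moreover have "(\<Sum>j\<in>UNIV. w x $ j * partial j (\<lambda>x. x $ i * x $ k) x) = x $ i * w x $ k + x $ k * w x $ i" for x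
    unfolding part using exhaust_3[of i] exhaust_3[of k] by (auto simp: sum_3)
  moreover have int: "integrable lborel (\<lambda>x. x $ i * w x $ k)" for i k
  proof (rule Bochner_Integration.integrable_bound)
    show "integrable lborel (\<lambda>x. rho x powr 1 * norm (w x))"
      using assms by (intro weighted_moment_integrable[OF b]) auto
    have "\<bar>x $ i\<bar> * \<bar>w x $ k\<bar> \<le> rho x * norm (w x)" for x
      by (intro mult_mono component_le_rho component_le_norm_cart) auto
    then show "AE x in lborel. norm (x $ i * w x $ k) \<le> norm (rho x powr 1 * norm (w x))"
      by (simp add: abs_mult)
    have [measurable]: "(\<lambda>x::real^3. x $ i) \<in> borel_measurable borel"
      by (rule measurable_component) simp
    show "(\<lambda>x. x $ i * w x $ k) \<in> borel_measurable lborel" by measurable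
  qed
  ultimately show ?thesis
    by (simp add: Bochner_Integration.integral_add[OF int int])
qed

section \<open>The velocity field\<close>

lemma norm_cross3_le: "norm (cross3 x y) \<le> norm x * norm y"
proof (rule power2_le_imp_le)
  show "(norm (cross3 x y))^2 \<le> (norm x * norm y)^2"
    using norm_cross_dot[of x y] zero_le_power2[of "x \<bullet> y"] by linarith
qed simp

lemma bounded_linear_cross3: "bounded_linear (cross3 x)"
  by (rule bounded_linear_intro[of _ "norm x"])
     (auto simp: cross_add_right cross_mult_right norm_cross3_le mult.commute[of "norm _" "norm x"])

lemma cross3_measurable [measurable (raw)]:
  assumes [measurable]: "f \<in> borel_measurable M" "g \<in> borel_measurable M"
  shows "(\<lambda>x. cross3 (f x) (g x)) \<in> borel_measurable M"
proof (rule measurable_of_components)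
  fix i :: 3
  show "(\<lambda>x. cross3 (f x) (g x) $ i) \<in> borel_measurable M"
    using exhaust_3[of i] by (auto simp: cross_components)
qed

definition bs_kernel :: "real^3 \<Rightarrow> real^3 \<Rightarrow> real^3"
  where "bs_kernel d c = (1 / norm d ^ 3) *\<^sub>R cross3 d c"

lemma norm_bs_kernel_le: "norm (bs_kernel d c) \<le> norm c / (norm d)^2"
proof -
  have "norm (bs_kernel d c) \<le> (1 / norm d ^ 3) * (norm d * norm c)"
    unfolding bs_kernel_def norm_scaleR by (simp add: norm_cross3_le divide_right_mono)
  also have "\<dots> = norm c / (norm d)^2"
    by (cases "d = 0") (simp_all add: power2_eq_square power3_eq_cube)
  finally show ?thesis .
qed

lemma bs_kernel_measurable [measurable (raw)]:
  assumes [measurable]: "f \<in> borel_measurable M" "g \<in> borel_measurable M"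
  shows "(\<lambda>x. bs_kernel (f x) (g x)) \<in> borel_measurable M"
  unfolding bs_kernel_def by measurable

lemma biot_savart_eq: "biot_savart w x = - (1 / (4 * pi)) *\<^sub>R (LINT y|lborel. bs_kernel (x - y) (w y))"
  by (simp add: biot_savart_def bs_kernel_def)

lemma biot_savart_measurable [measurable]:
  assumes [measurable]: "w \<in> borel_measurable borel"
  shows "biot_savart w \<in> borel_measurable borel"
  unfolding biot_savart_eq[abs_def] by measurable

lemma nn_integral_bs_kernel_le:
  "(NN y. ennreal (norm (bs_kernel (x - y) (w y)))) \<le> riesz w x"
  unfolding riesz_def by (intro nn_integral_mono ennreal_leI norm_bs_kernel_le)

lemma bs_kernel_integrable:
  assumes [measurable]: "w \<in> borel_measurable borel" and "riesz w x < \<infinity>"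
  shows "integrable lborel (\<lambda>y. bs_kernel (x - y) (w y))"
proof (rule integrableI_bounded)
  show "(NN y. ennreal (norm (bs_kernel (x - y) (w y)))) < \<infinity>"
    using nn_integral_bs_kernel_le assms(2) by (rule le_less_trans)
qed measurable

lemma norm_biot_savart_le: "ennreal (norm (biot_savart w x)) \<le> riesz w x"
proof -
  have "ennreal (norm (LINT y|lborel. bs_kernel (x - y) (w y))) \<le> riesz w x"
  proof (cases "integrable lborel (\<lambda>y. bs_kernel (x - y) (w y))")
    case True
    show ?thesis
      by (rule order_trans[OF integral_norm_bound_ennreal[OF True] nn_integral_bs_kernel_le])
  qed (simp add: not_integrable_integral_eq)
  moreover have "norm (biot_savart w x) \<le> norm (LINT y|lborel. bs_kernel (x - y) (w y))"
    unfolding biot_savart_eq norm_scaleR using pi_gt3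
    by (intro mult_left_le_one_le) (auto simp: divide_simps)
  ultimately show ?thesis
    using ennreal_leI order_trans by blast
qed

text \<open>
  The potential is square integrable.
\<close>

lemma riesz_finite_AE:
  assumes "weighted_bound m w N" "m > 3 / 2"
  shows "AE x in lborel. riesz w x < \<infinity>"
proof -
  note [measurable] = weighted_boundD(1)[OF assms(1)]
  obtain C where "(NN x. (riesz w x)^2) \<le> ennreal ((C * N)^2)"
    using riesz_L2_bound[OF assms(2)] assms(1) by blast
  then have "(NN x. (riesz w x)^2) \<noteq> \<infinity>"
    by (auto simp: top_unique)
  then have "AE x in lborel. (riesz w x)^2 \<noteq> \<infinity>"
    by (intro nn_integral_PInf_AE) auto
  then show ?thesis
    by eventually_elim (auto simp: less_top power2_eq_square ennreal_mult_eq_top_iff)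
qed

lemma biot_savart_diff_AE:
  assumes w: "weighted_bound m w N" "weighted_bound m w' N'" "m > 3 / 2"
  shows "AE x in lborel. biot_savart (\<lambda>y. w y - w' y) x = biot_savart w x - biot_savart w' x"
  using riesz_finite_AE[OF w(1,3)] riesz_finite_AE[OF w(2,3)]
proof eventually_elim
  case (elim x)
  have "bs_kernel d (a - b) = bs_kernel d a - bs_kernel d b" for d a b
    by (simp add: bs_kernel_def Cross3.right_diff_distrib scaleR_diff_right)
  moreover note bs_kernel_integrable[OF weighted_boundD(1)[OF w(1)] elim(1)]
    bs_kernel_integrable[OF weighted_boundD(1)[OF w(2)] elim(2)]
  ultimately show ?case
    by (simp add: biot_savart_eq scaleR_diff_right)
qed

lemma riesz_minus: "(NN x. ennreal (norm (w x) / (norm (x - y))^2)) = riesz w y"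
  by (simp add: riesz_def norm_minus_commute)

text \<open>
  The integrand is \<open>w\<close> paired with minus the gradient of \<open>1 / norm (x - y)\<close>. The singularity is
  removed by replacing \<open>norm (x - y)\<close> with \<open>sqrt (\<delta> + norm (x - y)^2)\<close>; in the limit \<open>\<delta> \<rightarrow> 0\<close> the
  integrands are dominated by \<open>norm (w x) / norm (x - y)^2\<close>.
\<close>

lemma solenoidal_riesz_orthogonal:
  assumes w: "w \<in> solenoidal_L2 m" "m > 5 / 2" and fin: "riesz w y < \<infinity>"
  shows "(LINT x|lborel. (1 / norm (x - y) ^ 3) * (w x \<bullet> (x - y))) = 0"
proof -
  note b = solenoidal_weighted_bound[OF w(1)]
  note [measurable] = weighted_boundD(1)[OF b]
  define \<delta> where "\<delta> n = 1 / (real n + 1)" for n :: nat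
  have d: "\<delta> n > 0" for n by (simp add: \<delta>_def)
  define s where "s n x = sqrt (\<delta> n + (x - y) \<bullet> (x - y))" for n x
  have s_pos: "s n x > 0" for n x
    unfolding s_def real_sqrt_gt_0_iff by (intro add_pos_nonneg d) simp
  have s2: "(s n x)^2 = \<delta> n + (norm (x - y))^2" for n x
    using d[of n] by (simp add: s_def power2_norm_eq_inner)
  have s_ge: "norm (x - y) \<le> s n x" for n x
  proof (rule power2_le_imp_le)
    show "(norm (x - y))^2 \<le> (s n x)^2" using d[of n] by (simp only: s2)
    show "0 \<le> s n x" using s_pos[of n x] by linarith
  qed
  have sm: "smooth (\<lambda>x. inverse (s n x))" for n
    unfolding s_def using d[of n] s_pos[of n]
    by (intro smooth_inverse smooth_sqrt smooth_add smooth_const smooth_diff_inner)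
       (auto simp: add_pos_nonneg s_def less_imp_neq[symmetric])
  have part: "partial j (\<lambda>x. inverse (s n x)) x = - ((x - y) $ j) * inverse (s n x) ^ 3" for j n x
  proof -
    have q: "((\<lambda>x. \<delta> n + (x - y) \<bullet> (x - y)) has_derivative (\<lambda>h. 2 * ((x - y) \<bullet> h))) (at x)"
      by (auto intro!: derivative_eq_intros simp: inner_commute)
    have pos: "\<delta> n + (x - y) \<bullet> (x - y) > 0" using d[of n] by (simp add: add_pos_nonneg)
    have "((\<lambda>t. inverse (sqrt t)) has_real_derivative
        - (inverse (sqrt t) * (inverse (sqrt t) / 2) * inverse (sqrt t))) (at t)" if "t > 0" for t
      using that by (auto intro!: derivative_eq_intros)
    from DERIV_compose_FDERIV[OF this[OF pos] q]
    have "((\<lambda>x. inverse (s n x)) has_derivative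
       (\<lambda>h. 2 * ((x - y) \<bullet> h) * - (inverse (s n x) * (inverse (s n x) / 2) * inverse (s n x)))) (at x)"
      by (simp add: s_def)
    from partialI[OF this, of j] show ?thesis
      by (simp add: inner_axis power3_eq_cube left_diff_distrib diff_divide_distrib)
  qed
  have zero: "(LINT x|lborel. inverse (s n x) ^ 3 * (w x \<bullet> (x - y))) = 0" for n
  proof -
    have "inverse (s n x) ^ 2 \<le> 1 / \<delta> n" for x
    proof -
      have "inverse (s n x) ^ 2 = inverse (\<delta> n + (norm (x - y))^2)"
        by (simp only: power_inverse s2)
      also have "\<dots> \<le> inverse (\<delta> n)" using d[of n] by (intro le_imp_inverse_le) auto
      finally show ?thesis by (simp add: inverse_eq_divide)
    qed
    note is2 = this
    define C where "C = 1 + 1 / \<delta> n"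
    have C: "C \<ge> 1" "1 / \<delta> n \<le> C" using d[of n] by (auto simp: C_def)
    have "(LINT x|lborel. (\<Sum>j\<in>UNIV. w x $ j * partial j (\<lambda>x. inverse (s n x)) x)) = 0"
    proof (rule solenoidal_pairing[OF w sm, of _ C])
      fix x
      have "inverse (s n x) \<le> 1 + inverse (s n x) ^ 2"
        using zero_le_power2[of "inverse (s n x) - 1/2"] by (simp add: power2_eq_square algebra_simps)
      also have "\<dots> \<le> C" using is2[of x] by (simp add: C_def)
      finally have "inverse (s n x) \<le> C" .
      also have "C = C * 1 ^ 2" by simp
      also have "\<dots> \<le> C * (rho x)^2"
        using C rho_ge_1[of x] by (intro mult_left_mono power_mono) auto
      finally show "\<bar>inverse (s n x)\<bar> \<le> C * (rho x)^2" using s_pos[of n x] by simp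
      fix j :: 3
      have "\<bar>(x - y) $ j\<bar> * inverse (s n x) \<le> 1"
        using component_le_norm_cart[of "x - y" j] s_ge[of x n] s_pos[of n x] by (simp add: field_simps)
      then have "\<bar>(x - y) $ j\<bar> * inverse (s n x) * inverse (s n x) ^ 2 \<le> 1 * (1 / \<delta> n)"
        using is2[of x] s_pos[of n x] by (intro mult_mono) auto
      also have "\<dots> \<le> C * 1" using C by simp
      also have "\<dots> \<le> C * rho x" using C rho_ge_1[of x] by (intro mult_left_mono) auto
      finally show "\<bar>partial j (\<lambda>x. inverse (s n x)) x\<bar> \<le> C * rho x"
        unfolding part abs_mult abs_minus_cancel using s_pos[of n x] by (simp add: abs_mult power3_eq_cube power2_eq_square mult_ac)
    qed
    moreover have "(\<Sum>j\<in>UNIV. w x $ j * partial j (\<lambda>x. inverse (s n x)) x)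
        = - (inverse (s n x) ^ 3 * (w x \<bullet> (x - y)))" for x
      unfolding part inner_vec_def by (simp add: sum_distrib_left sum_negf[symmetric] algebra_simps)
    ultimately show ?thesis by simp
  qed
  have [measurable]: "(\<lambda>x. s n x) \<in> borel_measurable borel" for n
    unfolding s_def by measurable
  have "(\<lambda>n. LINT x|lborel. inverse (s n x) ^ 3 * (w x \<bullet> (x - y)))
     \<longlonglongrightarrow> (LINT x|lborel. (1 / norm (x - y) ^ 3) * (w x \<bullet> (x - y)))"
  proof (rule integral_dominated_convergence)
    show "integrable lborel (\<lambda>x. norm (w x) / (norm (x - y))^2)"
      by (rule integrableI_bounded) (use fin in \<open>auto simp: riesz_minus\<close>)
    show "AE x in lborel. (\<lambda>n. inverse (s n x) ^ 3 * (w x \<bullet> (x - y)))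
        \<longlonglongrightarrow> (1 / norm (x - y) ^ 3) * (w x \<bullet> (x - y))"
    proof (intro always_eventually allI)
      fix x
      show "(\<lambda>n. inverse (s n x) ^ 3 * (w x \<bullet> (x - y))) \<longlonglongrightarrow> (1 / norm (x - y) ^ 3) * (w x \<bullet> (x - y))"
      proof (cases "x = y")
        case False
        have "\<delta> \<longlonglongrightarrow> 0"
          unfolding \<delta>_def using LIMSEQ_inverse_real_of_nat by (simp add: inverse_eq_divide add.commute)
        then have "(\<lambda>n. s n x) \<longlonglongrightarrow> sqrt (0 + (x - y) \<bullet> (x - y))"
          unfolding s_def by (intro tendsto_intros)
        then have "(\<lambda>n. s n x) \<longlonglongrightarrow> norm (x - y)" by (simp add: norm_eq_sqrt_inner)
        then have "(\<lambda>n. inverse (s n x) ^ 3 * (w x \<bullet> (x - y))) \<longlonglongrightarrow> inverse (norm (x - y)) ^ 3 * (w x \<bullet> (x - y))"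
          using False by (intro tendsto_intros) auto
        also have "inverse (norm (x - y)) ^ 3 = 1 / norm (x - y) ^ 3"
          by (simp add: inverse_eq_divide power_divide)
        finally show ?thesis .
      qed simp
    qed
    show "AE x in lborel. norm (inverse (s n x) ^ 3 * (w x \<bullet> (x - y))) \<le> norm (w x) / (norm (x - y))^2" for n
    proof (intro always_eventually allI)
      fix x
      show "norm (inverse (s n x) ^ 3 * (w x \<bullet> (x - y))) \<le> norm (w x) / (norm (x - y))^2"
      proof (cases "x = y")
        case False
        have "inverse (s n x) \<le> inverse (norm (x - y))"
          using False s_ge[of x n] by (intro le_imp_inverse_le) auto
        then have "inverse (s n x) ^ 3 \<le> inverse (norm (x - y)) ^ 3"
          using s_pos[of n x] by (intro power_mono) auto
        then have "norm (inverse (s n x) ^ 3 * (w x \<bullet> (x - y))) \<le> inverse (norm (x - y)) ^ 3 * (norm (w x) * norm (x - y))"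
          unfolding norm_mult using s_pos[of n x] by (intro mult_mono) (auto simp: Cauchy_Schwarz_ineq2)
        also have "\<dots> = norm (w x) / (norm (x - y))^2"
          using False by (simp add: power2_eq_square power3_eq_cube field_simps)
        finally show ?thesis .
      qed simp
    qed
  qed measurable
  then show ?thesis
    unfolding zero using LIMSEQ_unique tendsto_const by blast
qed

lemma integrable_pair_of_nn_bound:
  fixes f :: "real^3 \<Rightarrow> real^3 \<Rightarrow> real^3"
  assumes [measurable]: "case_prod f \<in> borel_measurable (lborel \<Otimes>\<^sub>M lborel)"
    and "(NN x. NN y. ennreal (norm (f x y))) \<le> ennreal c"
  shows "integrable (lborel \<Otimes>\<^sub>M lborel) (case_prod f)"
proof (rule integrable_of_nn_bound)
  have "(\<integral>\<^sup>+z. ennreal (norm (case_prod f z)) \<partial>(lborel \<Otimes>\<^sub>M lborel))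
      = (NN x. NN y. ennreal (norm (f x y)))"
    by (subst lborel.nn_integral_fst[symmetric]) (simp_all, measurable)
  then show "(\<integral>\<^sup>+z. ennreal (norm (case_prod f z)) \<partial>(lborel \<Otimes>\<^sub>M lborel)) \<le> ennreal c"
    using assms(2) by simp
qed measurable

lemma field_times_riesz_bound:
  assumes m: "m > 3 / 2"
  shows "\<exists>C\<ge>1. \<forall>w N w' N'. weighted_bound m w N \<longrightarrow> weighted_bound m w' N' \<longrightarrow>
    (NN x. ennreal (norm (w x)) * riesz w' x) \<le> ennreal (C * N * N')"
proof -
  obtain C where C: "C \<ge> 1" "\<And>w N. weighted_bound m w N \<Longrightarrow> (NN x. (riesz w x)^2) \<le> ennreal ((C * N)^2)"
    using riesz_L2_bound[OF m] by blast
  show ?thesis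
  proof (intro exI[of _ C] conjI allI impI C(1))
    fix w N w' N' assume w: "weighted_bound m w N" "weighted_bound m w' N'"
    note [measurable] = weighted_boundD(1)[OF w(1)] weighted_boundD(1)[OF w(2)]
    have "(NN x. ennreal (norm (w x)) * riesz w' x) \<le> ennreal (N * (C * N'))"
      using weighted_bound_L2[OF w(1)] C(2)[OF w(2)] m C(1) weighted_boundD(2)[OF w(1)] weighted_boundD(2)[OF w(2)]
      by (intro Cauchy_Schwarz_bound) auto
    then show "(NN x. ennreal (norm (w x)) * riesz w' x) \<le> ennreal (C * N * N')"
      by (simp add: mult_ac)
  qed
qed

text \<open>
  Formally \<open>w \<times> v\<close> is a divergence, since \<open>w\<close> is the curl of the divergence-free field \<open>v\<close>.
  Working with the kernel avoids derivatives of \<open>v\<close>: by the Lagrange identity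
  \<open>w(x) \<times> ((x - y) \<times> w(y))\<close> is the difference of \<open>(w(x) \<bullet> w(y)) (x - y)\<close>, which is antisymmetric
  in \<open>x\<close> and \<open>y\<close>, and \<open>(w(x) \<bullet> (x - y)) w(y)\<close>, whose integral over \<open>x\<close> against
  \<open>1 / norm (x - y)^3\<close> vanishes by the divergence condition.
\<close>

lemma integral_cross_velocity_zero:
  assumes w: "w \<in> solenoidal_L2 m" "m > 5 / 2"
  shows "(LINT x|lborel. cross3 (w x) (biot_savart w x)) = 0"
proof -
  note b = solenoidal_weighted_bound[OF w(1)]
  note [measurable] = weighted_boundD(1)[OF b]
  have m: "m > 3 / 2" using w by simp
  define k where "k x y = 1 / norm (x - y) ^ 3" for x y :: "real^3"
  \<comment> \<open>The two terms of the Lagrange identity.\<close>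
  define T1 where "T1 x y = (k x y * (w x \<bullet> w y)) *\<^sub>R (x - y)" for x y
  define T2 where "T2 x y = (k x y * (w x \<bullet> (x - y))) *\<^sub>R w y" for x y
  have [measurable]: "case_prod k \<in> borel_measurable (lborel \<Otimes>\<^sub>M lborel)"
    unfolding k_def by measurable
  have m1[measurable]: "case_prod T1 \<in> borel_measurable (lborel \<Otimes>\<^sub>M lborel)"
    unfolding T1_def by measurable
  have m2[measurable]: "case_prod T2 \<in> borel_measurable (lborel \<Otimes>\<^sub>M lborel)"
    unfolding T2_def by measurable
  have k_eq: "k x y * (norm (x - y) * c) = c / (norm (x - y))^2" for x y c
    by (cases "x = y") (simp_all add: k_def power2_eq_square power3_eq_cube)
  have k0: "k x y \<ge> 0" for x y by (simp add: k_def)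
  have n1: "norm (T1 x y) \<le> norm (w x) * (norm (w y) / (norm (x - y))^2)" for x y
  proof -
    have "norm (T1 x y) = k x y * (norm (x - y) * \<bar>w x \<bullet> w y\<bar>)"
      by (simp add: T1_def abs_mult k0)
    also have "\<dots> \<le> k x y * (norm (x - y) * (norm (w x) * norm (w y)))"
      by (intro mult_left_mono Cauchy_Schwarz_ineq2 k0) simp
    finally show ?thesis by (simp add: k_eq)
  qed
  have n2: "norm (T2 x y) \<le> norm (w x) * (norm (w y) / (norm (x - y))^2)" for x y
  proof -
    have "norm (T2 x y) = k x y * (\<bar>w x \<bullet> (x - y)\<bar> * norm (w y))"
      by (simp add: T2_def abs_mult k0)
    also have "\<dots> \<le> k x y * ((norm (w x) * norm (x - y)) * norm (w y))"
      by (intro mult_left_mono mult_right_mono Cauchy_Schwarz_ineq2 k0) simp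
    also have "\<dots> = k x y * (norm (x - y) * (norm (w x) * norm (w y)))" by (simp only: mult_ac)
    finally show ?thesis by (simp add: k_eq)
  qed
  obtain C where C: "(NN x. ennreal (norm (w x)) * riesz w x) \<le> ennreal C"
    using field_times_riesz_bound[OF m] b by blast
  have prod: "(NN x. NN y. ennreal (norm (w x) * (norm (w y) / (norm (x - y))^2))) \<le> ennreal C"
  proof -
    have "(NN y. ennreal (norm (w x) * (norm (w y) / (norm (x - y))^2))) = ennreal (norm (w x)) * riesz w x" for x
    proof -
      have "ennreal (norm (w x) * (norm (w y) / (norm (x - y))^2)) = ennreal (norm (w x)) * ennreal (norm (w y) / (norm (x - y))^2)" for y
        by (rule ennreal_mult) simp_all
      then show ?thesis
        unfolding riesz_def by (simp only:) (rule nn_integral_cmult, measurable)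
    qed
    then show ?thesis using C by simp
  qed
  have i1: "integrable (lborel \<Otimes>\<^sub>M lborel) (case_prod T1)"
  proof (rule integrable_pair_of_nn_bound[OF m1])
    have "(NN x. NN y. ennreal (norm (T1 x y)))
       \<le> (NN x. NN y. ennreal (norm (w x) * (norm (w y) / (norm (x - y))^2)))"
      by (intro nn_integral_mono ennreal_leI n1)
    then show "(NN x. NN y. ennreal (norm (T1 x y))) \<le> ennreal C"
      using prod by (rule order_trans)
  qed
  have i2: "integrable (lborel \<Otimes>\<^sub>M lborel) (case_prod T2)"
  proof (rule integrable_pair_of_nn_bound[OF m2])
    have "(NN x. NN y. ennreal (norm (T2 x y)))
       \<le> (NN x. NN y. ennreal (norm (w x) * (norm (w y) / (norm (x - y))^2)))"
      by (intro nn_integral_mono ennreal_leI n2)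
    then show "(NN x. NN y. ennreal (norm (T2 x y))) \<le> ennreal C"
      using prod by (rule order_trans)
  qed
  have z1: "(LINT x|lborel. LINT y|lborel. T1 x y) = 0"
  proof -
    have swap: "T1 x y = - T1 y x" for x y
      by (simp add: T1_def k_def norm_minus_commute inner_commute scaleR_right_diff_distrib)
    have "(LINT x|lborel. LINT y|lborel. T1 x y) = (LINT y|lborel. LINT x|lborel. T1 x y)"
      by (rule lborel_pair.Fubini_integral[OF i1, symmetric])
    also have "\<dots> = (LINT y|lborel. LINT x|lborel. - T1 y x)"
      by (subst swap) simp
    also have "\<dots> = - (LINT y|lborel. LINT x|lborel. T1 y x)" by simp
    finally have "2 *\<^sub>R (LINT x|lborel. LINT y|lborel. T1 x y) = 0"
      by (simp add: scaleR_2 eq_neg_iff_add_eq_0)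
    then show ?thesis by simp
  qed
  have z2: "(LINT x|lborel. LINT y|lborel. T2 x y) = 0"
  proof -
    have "(LINT x|lborel. LINT y|lborel. T2 x y) = (LINT y|lborel. LINT x|lborel. T2 x y)"
      by (rule lborel_pair.Fubini_integral[OF i2, symmetric])
    also have "\<dots> = (LINT y|(lborel :: (real^3) measure). 0)"
    proof (rule integral_cong_AE)
      show "AE y in lborel. (LINT x|lborel. T2 x y) = 0"
        using riesz_finite_AE[OF b m]
      proof eventually_elim
        case (elim y)
        have "integrable lborel (\<lambda>x. k x y * (w x \<bullet> (x - y)))"
        proof (rule integrableI_bounded)
          have "norm (k x y * (w x \<bullet> (x - y))) \<le> norm (w x) / (norm (x - y))^2" for x
          proof -
            have "norm (k x y * (w x \<bullet> (x - y))) \<le> k x y * (norm (w x) * norm (x - y))"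
              using k0[of x y] Cauchy_Schwarz_ineq2[of "w x" "x - y"] by (simp add: abs_mult mult_left_mono)
            then show ?thesis using k_eq[of x y "norm (w x)"] by (simp add: mult.commute)
          qed
          then have "(NN x. ennreal (norm (k x y * (w x \<bullet> (x - y))))) \<le> riesz w y"
            unfolding riesz_minus[symmetric] by (intro nn_integral_mono ennreal_leI)
          then show "(NN x. ennreal (norm (k x y * (w x \<bullet> (x - y))))) < \<infinity>"
            using elim by (rule le_less_trans)
        qed (simp add: k_def)
        then have "(LINT x|lborel. T2 x y) = (LINT x|lborel. k x y * (w x \<bullet> (x - y))) *\<^sub>R w y"
          unfolding T2_def by (rule integral_scaleR_left)
        also have "(LINT x|lborel. k x y * (w x \<bullet> (x - y))) = 0"
          unfolding k_def by (rule solenoidal_riesz_orthogonal[OF w elim])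
        finally show ?case by simp
      qed
    qed measurable
    finally show ?thesis by simp
  qed
  have ae1: "AE x in lborel. integrable lborel (T1 x)"
    using lborel_pair.AE_integrable_fst'[OF i1] by simp
  have ae2: "AE x in lborel. integrable lborel (T2 x)"
    using lborel_pair.AE_integrable_fst'[OF i2] by simp
  have o1: "integrable lborel (\<lambda>x. LINT y|lborel. T1 x y)"
    using lborel_pair.integrable_fst'[OF i1] by simp
  have o2: "integrable lborel (\<lambda>x. LINT y|lborel. T2 x y)"
    using lborel_pair.integrable_fst'[OF i2] by simp
  have "(LINT x|lborel. cross3 (w x) (biot_savart w x))
      = (LINT x|lborel. - (1 / (4 * pi)) *\<^sub>R ((LINT y|lborel. T1 x y) - (LINT y|lborel. T2 x y)))"
  proof (rule integral_cong_AE)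
    show "AE x in lborel. cross3 (w x) (biot_savart w x)
        = - (1 / (4 * pi)) *\<^sub>R ((LINT y|lborel. T1 x y) - (LINT y|lborel. T2 x y))"
      using riesz_finite_AE[OF b m] ae1 ae2
    proof eventually_elim
      case (elim x)
      have "cross3 (w x) (LINT y|lborel. bs_kernel (x - y) (w y))
          = (LINT y|lborel. cross3 (w x) (bs_kernel (x - y) (w y)))"
        by (rule integral_bounded_linear[OF bounded_linear_cross3, symmetric])
           (rule bs_kernel_integrable[OF weighted_boundD(1)[OF b] elim(1)])
      also have "\<dots> = (LINT y|lborel. T1 x y - T2 x y)"
        by (simp add: bs_kernel_def cross_mult_right Lagrange T1_def T2_def k_def scaleR_right_diff_distrib)
      also have "\<dots> = (LINT y|lborel. T1 x y) - (LINT y|lborel. T2 x y)"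
        using elim by simp
      finally show ?case
        by (simp add: biot_savart_eq cross_mult_right)
    qed
  qed measurable
  also have "\<dots> = - (1 / (4 * pi)) *\<^sub>R ((LINT x|lborel. LINT y|lborel. T1 x y) - (LINT x|lborel. LINT y|lborel. T2 x y))"
    by (subst integral_scaleR_right) (simp add: o1 o2)
  finally show ?thesis by (simp add: z1 z2)
qed

definition vort_flux :: "3 \<Rightarrow> 3 \<Rightarrow> (real^3 \<Rightarrow> real^3) \<Rightarrow> real^3 \<Rightarrow> real"
  where "vort_flux i j w x = w x $ j * biot_savart w x $ i - biot_savart w x $ j * w x $ i"

text \<open>
  The \<open>j\<close>-th derivative of \<open>exp_Lambda_half\<close> applied to the flux, without its factor \<open>\<epsilon>^2\<close>.
\<close>

abbreviation flux_conv :: "real \<Rightarrow> 3 \<Rightarrow> 3 \<Rightarrow> (real^3 \<Rightarrow> real^3) \<Rightarrow> real^3 \<Rightarrow> real"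
  where "flux_conv \<epsilon> i j w x \<equiv>
    (LINT y|lborel. heat_grad (1 - \<epsilon>^2) (axis j 1) (x - \<epsilon> *\<^sub>R y) * vort_flux i j w y)"

lemma vort_flux_measurable [measurable]:
  assumes [measurable]: "w \<in> borel_measurable borel"
  shows "vort_flux i j w \<in> borel_measurable borel"
  unfolding vort_flux_def by measurable

lemma vort_flux_le: "ennreal \<bar>vort_flux i j w x\<bar> \<le> 2 * (ennreal (norm (w x)) * riesz w x)"
proof -
  have "\<bar>w x $ j * biot_savart w x $ i\<bar> \<le> norm (w x) * norm (biot_savart w x)"
       "\<bar>biot_savart w x $ j * w x $ i\<bar> \<le> norm (w x) * norm (biot_savart w x)"
    unfolding abs_mult mult.commute[of "\<bar>biot_savart w x $ j\<bar>"]
    by (intro mult_mono component_le_norm_cart; simp)+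
  then have "\<bar>vort_flux i j w x\<bar> \<le> 2 * (norm (w x) * norm (biot_savart w x))"
    unfolding vort_flux_def by linarith
  then have "ennreal \<bar>vort_flux i j w x\<bar> \<le> ennreal (2 * (norm (w x) * norm (biot_savart w x)))"
    by (rule ennreal_leI)
  also have "\<dots> = 2 * (ennreal (norm (w x)) * ennreal (norm (biot_savart w x)))"
    by (simp add: ennreal_mult)
  also have "\<dots> \<le> 2 * (ennreal (norm (w x)) * riesz w x)"
    by (intro mult_left_mono norm_biot_savart_le) simp_all
  finally show ?thesis .
qed

lemma vort_flux_integrable:
  assumes "weighted_bound m w N" "m > 3 / 2"
  shows "integrable lborel (vort_flux i j w)"
proof -
  note [measurable] = weighted_boundD(1)[OF assms(1)]
  obtain C where C: "(NN x. ennreal (norm (w x)) * riesz w x) \<le> ennreal C"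
    using field_times_riesz_bound[OF assms(2)] assms(1) by blast
  have "(NN x. ennreal (norm (vort_flux i j w x))) \<le> (NN x. 2 * (ennreal (norm (w x)) * riesz w x))"
    unfolding real_norm_def by (intro nn_integral_mono vort_flux_le)
  also have "\<dots> = 2 * (NN x. ennreal (norm (w x)) * riesz w x)"
    by (rule nn_integral_cmult) measurable
  also have "\<dots> \<le> ennreal 2 * ennreal C"
    using C by (intro mult_mono) auto
  also have "\<dots> = ennreal (2 * C)" by (simp add: ennreal_mult')
  finally have "(NN x. ennreal (norm (vort_flux i j w x))) \<le> ennreal (2 * C)" .
  then show ?thesis
    by (rule integrable_of_nn_bound[rotated]) measurable
qed

text \<open>
  Up to sign the nonzero fluxes are the components of \<open>w \<times> v\<close>.
\<close>

lemma integral_vort_flux_zero: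
  assumes w: "w \<in> solenoidal_L2 m" "m > 5 / 2"
  shows "(LINT x|lborel. vort_flux i j w x) = 0"
proof -
  note b = solenoidal_weighted_bound[OF w(1)]
  note [measurable] = weighted_boundD(1)[OF b]
  have m: "m > 3 / 2" using w by simp
  have int: "integrable lborel (\<lambda>x. cross3 (w x) (biot_savart w x))"
  proof -
    obtain C where C: "(NN x. ennreal (norm (w x)) * riesz w x) \<le> ennreal C"
      using field_times_riesz_bound[OF m] b by blast
    have "ennreal (norm (cross3 (w x) (biot_savart w x))) \<le> ennreal (norm (w x)) * riesz w x" for x
    proof -
      have "ennreal (norm (cross3 (w x) (biot_savart w x))) \<le> ennreal (norm (w x)) * ennreal (norm (biot_savart w x))"
        by (subst ennreal_mult[symmetric]) (simp_all add: ennreal_leI norm_cross3_le)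
      also have "\<dots> \<le> ennreal (norm (w x)) * riesz w x"
        by (intro mult_left_mono norm_biot_savart_le) simp
      finally show ?thesis .
    qed
    then have "(NN x. ennreal (norm (cross3 (w x) (biot_savart w x)))) \<le> ennreal C"
      by (intro order_trans[OF nn_integral_mono C])
    then show ?thesis
      by (rule integrable_of_nn_bound[rotated]) measurable
  qed
  have comp: "(LINT x|lborel. cross3 (w x) (biot_savart w x) $ k) = 0" for k
    using integral_bounded_linear[OF bounded_linear_vec_nth[of k] int] integral_cross_velocity_zero[OF w]
    by simp
  have neg: "(LINT x|lborel. - f x) = 0" if "(LINT x|lborel. f x) = 0" for f :: "real^3 \<Rightarrow> real"
    using that by simp
  note c = comp[of 1] comp[of 2] comp[of 3]
  note n = neg[OF comp[of 1]] neg[OF comp[of 2]] neg[OF comp[of 3]]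
  have F: "vort_flux 2 1 w x = cross3 (w x) (biot_savart w x) $ 3" "vort_flux 1 2 w x = - cross3 (w x) (biot_savart w x) $ 3"
    "vort_flux 1 3 w x = cross3 (w x) (biot_savart w x) $ 2" "vort_flux 3 1 w x = - cross3 (w x) (biot_savart w x) $ 2"
    "vort_flux 3 2 w x = cross3 (w x) (biot_savart w x) $ 1" "vort_flux 2 3 w x = - cross3 (w x) (biot_savart w x) $ 1"
    "vort_flux k k w x = 0" for x k
    by (simp_all add: vort_flux_def cross_components mult.commute)
  consider "i = 2" "j = 1" | "i = 1" "j = 2" | "i = 1" "j = 3" | "i = 3" "j = 1" | "i = 3" "j = 2" | "i = 2" "j = 3" | "i = j"
    using exhaust_3[of i] exhaust_3[of j] by blast
  then show ?thesis
    by cases (simp_all only: F c n, simp)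
qed

section \<open>The semigroup as a convolution\<close>

text \<open>
  Substitute \<open>y = exp (t / 2) \<eta>\<close>: with \<open>\<epsilon> = exp (- t / 2)\<close> the Jacobian \<open>\<epsilon>^3\<close> turns the prefactor
  \<open>exp t\<close> into \<open>\<epsilon>\<close>.
\<close>

lemma exp_Lambda_eq:
  assumes [measurable]: "f \<in> borel_measurable borel" and t: "t > 0"
  shows "exp_Lambda t f x = exp (- t / 2) * (LINT y|lborel. heat (1 - (exp (- t / 2))^2) (x - exp (- t / 2) *\<^sub>R y) * f y)"
proof -
  define \<epsilon> where "\<epsilon> = exp (- t / 2)"
  have e2: "\<epsilon>^2 = exp (- t)"
    by (simp add: \<epsilon>_def power2_eq_square exp_add[symmetric])
  have e0: "\<epsilon> > 0" by (simp add: \<epsilon>_def)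
  have ee: "exp (t / 2) * \<epsilon> = 1"
    by (simp add: \<epsilon>_def exp_add[symmetric])
  have et: "exp t * \<epsilon> ^ 3 = \<epsilon>"
  proof -
    have "exp t * \<epsilon>^2 = 1" unfolding e2 by (simp add: exp_add[symmetric])
    then show ?thesis by (simp add: power3_eq_cube power2_eq_square mult.assoc[symmetric])
  qed
  have a: "1 - exp (- t) > 0" using t by simp
  have "(LINT \<eta>|lborel. exp (- (norm (x - \<eta>))\<^sup>2 / (4 * (1 - exp (- t)))) * f (exp (t / 2) *\<^sub>R \<eta>))
      = \<epsilon> ^ 3 * (LINT y|lborel. exp (- (norm (x - \<epsilon> *\<^sub>R y))\<^sup>2 / (4 * (1 - exp (- t)))) * f y)"
    by (subst integral_affine[of _ \<epsilon> 0]) (use e0 in \<open>simp_all add: ee\<close>)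
  moreover have "heat (1 - exp (- t)) z = exp (- (norm z)\<^sup>2 / (4 * (1 - exp (- t)))) / (4 * pi * (1 - exp (- t))) powr (3 / 2)" for z
  proof -
    have "X powr (- 3 / 2) = inverse (X powr (3 / 2))" for X :: real
      using powr_minus[of X "3/2"] by simp
    then have "heat (1 - exp (- t)) z = inverse ((4 * pi * (1 - exp (- t))) powr (3 / 2)) * exp (- ((norm z)^2 / (4 * (1 - exp (- t)))))"
      unfolding heat_def by (simp only:)
    then show ?thesis by (simp only: divide_inverse mult.commute minus_mult_left)
  qed
  ultimately have "exp_Lambda t f x = exp t * \<epsilon> ^ 3 * (LINT y|lborel. heat (1 - exp (- t)) (x - \<epsilon> *\<^sub>R y) * f y)"
    using t by (simp add: exp_Lambda_def)
  then show ?thesis unfolding \<epsilon>_def[symmetric] e2 by (simp only: et)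
qed

lemma mult_exp_neg_le_1:
  fixes s :: real
  assumes "s \<ge> 0"
  shows "s * exp (- s) \<le> 1"
proof -
  have "s \<le> exp s" using exp_ge_add_one_self[of s] by linarith
  then have "s * exp (- s) \<le> exp s * exp (- s)" by (intro mult_right_mono) auto
  then show ?thesis by (simp add: exp_minus)
qed

text \<open>
  A second order bound without decay in \<open>x\<close>, but uniform in \<open>x\<close> and \<open>h\<close>, for every width.
\<close>

lemma heat_taylor_global:
  assumes a: "a > 0"
  shows "\<bar>heat a (x + h) - heat a x - heat_grad a h x\<bar> \<le> (4 * pi * a) powr (- 3 / 2) / a * (norm h)^2"
proof -
  define b where "b = 1 / (4 * a)"
  have b: "b > 0" using a by (simp add: b_def)
  obtain \<theta> where \<theta>: "0 < \<theta>" "\<theta> < 1"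
    "exp (- (b * (norm (x - (-h)))^2)) - exp (- (b * (norm x)^2)) - 2 * b * ((-h) \<bullet> x) * exp (- (b * (norm x)^2))
    = (1/2) * (4 * b^2 * ((-h) \<bullet> (x - \<theta> *\<^sub>R (-h)))^2 - 2 * b * (norm (-h))^2) * exp (- (b * (norm (x - \<theta> *\<^sub>R (-h)))^2))"
    using exp_segment_taylor[of b x "-h"] by blast
  define X where "X = x - \<theta> *\<^sub>R (-h)"
  let ?k = "(4 * pi * a) powr (- 3 / 2)"
  have b1: "(norm x)^2 / (4 * a) = b * (norm x)^2" for x :: "real^3" by (simp add: b_def)
  have b2: "t / (2 * a) = 2 * b * t" for t by (simp add: b_def)
  have "heat a (x + h) - heat a x - heat_grad a h x
     = ?k * (exp (- (b * (norm (x - (-h)))^2)) - exp (- (b * (norm x)^2)) - 2 * b * ((-h) \<bullet> x) * exp (- (b * (norm x)^2)))"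
    unfolding heat_grad_def heat_def b1 b2 by (simp add: algebra_simps)
  also have "\<dots> = ?k * ((1/2) * (4 * b^2 * (h \<bullet> X)^2 - 2 * b * (norm h)^2) * exp (- (b * (norm X)^2)))"
    unfolding \<theta>(3) X_def by simp
  finally have "\<bar>heat a (x + h) - heat a x - heat_grad a h x\<bar>
      = \<bar>?k * ((1/2) * (4 * b^2 * (h \<bullet> X)^2 - 2 * b * (norm h)^2) * exp (- (b * (norm X)^2)))\<bar>"
    by (rule arg_cong)
  also have "\<dots> = ?k * ((1/2) * (\<bar>4 * b^2 * (h \<bullet> X)^2 - 2 * b * (norm h)^2\<bar> * exp (- (b * (norm X)^2))))"
    by (simp add: abs_mult)
  also have "\<dots> \<le> ?k * ((1/2) * (8 * b * (norm h)^2))"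
  proof (intro mult_left_mono)
    let ?e = "exp (- (b * (norm X)^2))"
    have "(h \<bullet> X)^2 \<le> (norm h)^2 * (norm X)^2"
      using Cauchy_Schwarz_ineq[of h X] by (simp add: power2_norm_eq_inner)
    then have "4 * b^2 * (h \<bullet> X)^2 \<le> 4 * b^2 * ((norm h)^2 * (norm X)^2)"
      by (intro mult_left_mono) auto
    moreover have "0 \<le> 4 * b^2 * (h \<bullet> X)^2" "0 \<le> 2 * b * (norm h)^2" using b by auto
    ultimately have "\<bar>4 * b^2 * (h \<bullet> X)^2 - 2 * b * (norm h)^2\<bar> \<le> 4 * b^2 * ((norm h)^2 * (norm X)^2) + 2 * b * (norm h)^2"
      by linarith
    then have "\<bar>4 * b^2 * (h \<bullet> X)^2 - 2 * b * (norm h)^2\<bar> * ?e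
        \<le> (4 * b^2 * ((norm h)^2 * (norm X)^2) + 2 * b * (norm h)^2) * ?e"
      by (rule mult_right_mono) simp
    also have "\<dots> = 4 * b * (norm h)^2 * ((b * (norm X)^2) * ?e) + 2 * b * (norm h)^2 * ?e"
      by (simp add: power2_eq_square algebra_simps)
    also have "\<dots> \<le> 4 * b * (norm h)^2 * 1 + 2 * b * (norm h)^2 * 1"
      using b by (intro add_mono mult_left_mono mult_exp_neg_le_1) auto
    also have "\<dots> \<le> 8 * b * (norm h)^2" using b by simp
    finally show "\<bar>4 * b^2 * (h \<bullet> X)^2 - 2 * b * (norm h)^2\<bar> * ?e \<le> 8 * b * (norm h)^2" .
  qed auto
  also have "\<dots> = ?k / a * (norm h)^2" using a by (simp add: b_def)
  finally show ?thesis .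
qed

lemma heat_bounded:
  assumes "a > 0"
  shows "\<bar>heat a x\<bar> \<le> (4 * pi * a) powr (- 3 / 2)"
proof -
  have "heat a x \<le> (4 * pi * a) powr (- 3 / 2) * 1"
    unfolding heat_def using assms by (intro mult_left_mono) auto
  then show ?thesis using heat_nonneg[of a x] by simp
qed

lemma norm_heat_bounded:
  assumes a: "a > 0"
  shows "norm x * heat a x \<le> (4 * pi * a) powr (- 3 / 2) * (1 + 4 * a)"
proof -
  have "norm x * exp (- ((norm x)^2 / (4 * a))) \<le> 1 + 4 * a"
  proof -
    have "norm x \<le> 1 + (norm x)^2"
      using zero_le_power2[of "norm x - 1/2"] by (simp add: power2_eq_square algebra_simps)
    then have "norm x * exp (- ((norm x)^2 / (4 * a))) \<le> (1 + (norm x)^2) * exp (- ((norm x)^2 / (4 * a)))"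
      by (rule mult_right_mono) simp
    also have "\<dots> = exp (- ((norm x)^2 / (4 * a))) + 4 * a * ((norm x)^2 / (4 * a) * exp (- ((norm x)^2 / (4 * a))))"
      using a by (simp add: distrib_right)
    also have "\<dots> \<le> 1 + 4 * a * 1"
      using a by (intro add_mono mult_left_mono mult_exp_neg_le_1) auto
    finally show ?thesis by simp
  qed
  then have "(4 * pi * a) powr (- 3 / 2) * (norm x * exp (- ((norm x)^2 / (4 * a)))) \<le> (4 * pi * a) powr (- 3 / 2) * (1 + 4 * a)"
    by (rule mult_left_mono) simp
  then show ?thesis by (simp add: heat_def mult_ac)
qed

lemma heat_grad_bounded:
  assumes a: "a > 0"
  shows "\<bar>heat_grad a u x\<bar> \<le> norm u * ((4 * pi * a) powr (- 3 / 2) * (1 + 4 * a) / (2 * a))"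
proof -
  have "\<bar>heat_grad a u x\<bar> \<le> (norm u * norm x) / (2 * a) * heat a x"
    unfolding heat_grad_def abs_mult abs_of_nonneg[OF heat_nonneg] using a Cauchy_Schwarz_ineq2[of u x]
    by (intro mult_right_mono heat_nonneg) (simp add: divide_right_mono)
  also have "\<dots> = norm u * ((norm x * heat a x) / (2 * a))" by simp
  also have "\<dots> \<le> norm u * (((4 * pi * a) powr (- 3 / 2) * (1 + 4 * a)) / (2 * a))"
    using a by (intro mult_left_mono divide_right_mono norm_heat_bounded) auto
  finally show ?thesis by simp
qed

lemma integrable_bounded_mult:
  fixes f g :: "'a \<Rightarrow> real"
  assumes "integrable M f" "g \<in> borel_measurable M" "\<And>x. \<bar>g x\<bar> \<le> B"
  shows "integrable M (\<lambda>x. g x * f x)"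
proof (rule Bochner_Integration.integrable_bound)
  show "integrable M (\<lambda>x. B * \<bar>f x\<bar>)" using assms by simp
  have "\<bar>g x * f x\<bar> \<le> \<bar>B * \<bar>f x\<bar>\<bar>" for x
    using assms(3)[of x] by (simp add: abs_mult mult_right_mono)
  then show "AE x in M. norm (g x * f x) \<le> norm (B * \<bar>f x\<bar>)" by simp
  show "(\<lambda>x. g x * f x) \<in> borel_measurable M"
    using assms(1,2) by measurable
qed

text \<open>
  The Taylor remainder of the kernel is uniform in its argument, so integrability of \<open>f\<close> is enough
  to differentiate under the integral.
\<close>

lemma heat_convolution_has_derivative:
  assumes f: "integrable lborel f" and a: "a > 0"
  shows "((\<lambda>x. LINT y|lborel. heat a (x - c *\<^sub>R y) * f y) has_derivative
    (\<lambda>h. LINT y|lborel. heat_grad a h (x - c *\<^sub>R y) * f y)) (at x)"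
proof -
  have [measurable]: "f \<in> borel_measurable borel" using f by auto
  define H where "H x = (LINT y|lborel. heat a (x - c *\<^sub>R y) * f y)" for x
  define D where "D h = (LINT y|lborel. heat_grad a h (x - c *\<^sub>R y) * f y)" for h
  let ?k = "(4 * pi * a) powr (- 3 / 2)"
  have iH: "integrable lborel (\<lambda>y. heat a (x - c *\<^sub>R y) * f y)" for x
    by (rule integrable_bounded_mult[OF f _ heat_bounded[OF a]]) measurable
  have iD: "integrable lborel (\<lambda>y. heat_grad a h (x - c *\<^sub>R y) * f y)" for h
    by (rule integrable_bounded_mult[OF f _ heat_grad_bounded[OF a]]) measurable
  define L where "L = (LINT y|lborel. \<bar>f y\<bar>)"
  have L: "L \<ge> 0" by (simp add: L_def)
  have grad_add: "heat_grad a (h + h') z = heat_grad a h z + heat_grad a h' z" for h h' z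
    by (simp add: heat_grad_def inner_add_left add_divide_distrib algebra_simps)
  have grad_scale: "heat_grad a (r *\<^sub>R h) z = r * heat_grad a h z" for r h z
    by (simp add: heat_grad_def)
  have bl: "bounded_linear D"
  proof (rule bounded_linear_intro)
    show "D (h + h') = D h + D h'" for h h'
      unfolding D_def by (subst Bochner_Integration.integral_add[OF iD iD, symmetric])
        (simp add: grad_add distrib_right)
    show "D (r *\<^sub>R h) = r *\<^sub>R D h" for r h
      unfolding D_def by (simp add: grad_scale mult.assoc)
    show "norm (D h) \<le> norm h * (?k * (1 + 4 * a) / (2 * a) * L)" for h
    proof -
      have "norm (D h) \<le> (LINT y|lborel. norm (heat_grad a h (x - c *\<^sub>R y) * f y))"
        unfolding D_def by (rule integral_norm_bound)
      also have "\<dots> \<le> (LINT y|lborel. (norm h * (?k * (1 + 4 * a) / (2 * a))) * \<bar>f y\<bar>)"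
      proof (rule integral_mono)
        show "integrable lborel (\<lambda>y. norm (heat_grad a h (x - c *\<^sub>R y) * f y))" using iD by simp
        show "integrable lborel (\<lambda>y. (norm h * (?k * (1 + 4 * a) / (2 * a))) * \<bar>f y\<bar>)" using f by simp
        show "norm (heat_grad a h (x - c *\<^sub>R y) * f y) \<le> (norm h * (?k * (1 + 4 * a) / (2 * a))) * \<bar>f y\<bar>" for y
          unfolding real_norm_def abs_mult by (intro mult_right_mono heat_grad_bounded a) simp
      qed
      finally show ?thesis by (simp add: L_def mult_ac)
    qed
  qed
  have rem: "norm (H (x + h) - H x - D h) \<le> ?k / a * L * (norm h)^2" for h
  proof -
    have shift: "x + h - c *\<^sub>R y = (x - c *\<^sub>R y) + h" for y by simp
    have eq: "H (x + h) - H x - D h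
        = (LINT y|lborel. heat a (x + h - c *\<^sub>R y) * f y - heat a (x - c *\<^sub>R y) * f y - heat_grad a h (x - c *\<^sub>R y) * f y)"
      unfolding H_def D_def using iH[of "x + h"] iH[of x] iD[of h] by simp
    have "norm (H (x + h) - H x - D h) \<le> (LINT y|lborel. norm (heat a (x + h - c *\<^sub>R y) * f y - heat a (x - c *\<^sub>R y) * f y - heat_grad a h (x - c *\<^sub>R y) * f y))"
      unfolding eq by (rule integral_norm_bound)
    also have "\<dots> \<le> (LINT y|lborel. (?k / a * (norm h)^2) * \<bar>f y\<bar>)"
    proof (rule integral_mono)
      show "integrable lborel (\<lambda>y. norm (heat a (x + h - c *\<^sub>R y) * f y - heat a (x - c *\<^sub>R y) * f y - heat_grad a h (x - c *\<^sub>R y) * f y))"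
        using iH[of "x + h"] iH[of x] iD[of h] by (intro integrable_norm Bochner_Integration.integrable_diff)
      show "integrable lborel (\<lambda>y. (?k / a * (norm h)^2) * \<bar>f y\<bar>)" using f by simp
      show "norm (heat a (x + h - c *\<^sub>R y) * f y - heat a (x - c *\<^sub>R y) * f y - heat_grad a h (x - c *\<^sub>R y) * f y)
          \<le> (?k / a * (norm h)^2) * \<bar>f y\<bar>" for y
        unfolding left_diff_distrib[symmetric] real_norm_def abs_mult shift
        by (intro mult_right_mono heat_taylor_global a) simp
    qed
    finally show ?thesis by (simp add: L_def mult_ac)
  qed
  have "((\<lambda>h. norm (H (x + h) - H x - D h) / norm h) \<longlongrightarrow> 0) (at 0)"
  proof (rule Lim_null_comparison)
    show "\<forall>\<^sub>F h in at 0. norm (norm (H (x + h) - H x - D h) / norm h) \<le> ?k / a * L * norm h"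
      unfolding eventually_at_filter
    proof (intro always_eventually allI impI)
      fix h :: "real^3" assume "h \<noteq> 0"
      then show "norm (norm (H (x + h) - H x - D h) / norm h) \<le> ?k / a * L * norm h"
        using rem[of h] by (simp add: power2_eq_square pos_divide_le_eq mult.assoc)
    qed
    have "((\<lambda>h::real^3. ?k / a * L * norm h) \<longlongrightarrow> ?k / a * L * norm (0::real^3)) (at 0)"
      by (intro tendsto_intros)
    then show "((\<lambda>h::real^3. ?k / a * L * norm h) \<longlongrightarrow> 0) (at 0)" by simp
  qed
  then have "(H has_derivative D) (at x)"
    using bl by (simp add: has_derivative_at)
  then show ?thesis by (simp add: H_def[abs_def] D_def[abs_def])
qed

lemma partial_exp_Lambda_half:
  assumes f: "integrable lborel f" and t: "t > 0"
  shows "partial j (exp_Lambda_half t f) x = (exp (- t / 2))^2 *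
    (LINT y|lborel. heat_grad (1 - (exp (- t / 2))^2) (axis j 1) (x - exp (- t / 2) *\<^sub>R y) * f y)"
proof -
  have [measurable]: "f \<in> borel_measurable borel" using f by auto
  define \<epsilon> where "\<epsilon> = exp (- t / 2)"
  have "\<epsilon>^2 = exp (- t)"
    by (simp add: \<epsilon>_def power2_eq_square exp_add[symmetric])
  then have a: "1 - \<epsilon>^2 > 0" using t by simp
  have eq: "exp_Lambda_half t f = (\<lambda>x. \<epsilon>^2 * (LINT y|lborel. heat (1 - \<epsilon>^2) (x - \<epsilon> *\<^sub>R y) * f y))"
    using exp_Lambda_eq[of f t] t by (auto simp: exp_Lambda_half_def fun_eq_iff power2_eq_square \<epsilon>_def)
  have "((\<lambda>x. \<epsilon>^2 * (LINT y|lborel. heat (1 - \<epsilon>^2) (x - \<epsilon> *\<^sub>R y) * f y)) has_derivative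
    (\<lambda>h. \<epsilon>^2 * (LINT y|lborel. heat_grad (1 - \<epsilon>^2) h (x - \<epsilon> *\<^sub>R y) * f y))) (at x)"
    by (intro has_derivative_mult_right heat_convolution_has_derivative f a)
  from partialI[OF this, of j] show ?thesis
    unfolding eq by (simp add: \<epsilon>_def)
qed

section \<open>Weighted kernel estimates\<close>

lemma ennreal_abs_integral_le:
  fixes f :: "'a \<Rightarrow> real"
  shows "ennreal \<bar>LINT x|M. f x\<bar> \<le> (\<integral>\<^sup>+x. ennreal \<bar>f x\<bar> \<partial>M)"
proof (cases "integrable M f")
  case True
  then show ?thesis using integral_norm_bound_ennreal[of M f] by simp
qed (simp add: not_integrable_integral_eq)

lemma ennreal_weighted_abs_integral_le:
  fixes k f :: "'a::euclidean_space \<Rightarrow> real"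
  assumes [measurable]: "k \<in> borel_measurable borel" "f \<in> borel_measurable borel" and c: "c \<ge> 0"
  shows "ennreal (c * \<bar>LINT y|lborel. k y * f y\<bar>) \<le> (NN y. ennreal ((c * \<bar>k y\<bar>) * \<bar>f y\<bar>))"
proof -
  have "ennreal (c * \<bar>LINT y|lborel. k y * f y\<bar>) \<le> ennreal c * (NN y. ennreal \<bar>k y * f y\<bar>)"
    using c by (simp add: ennreal_mult mult_left_mono ennreal_abs_integral_le)
  also have "\<dots> = (NN y. ennreal c * ennreal \<bar>k y * f y\<bar>)"
    by (rule nn_integral_cmult[symmetric]) measurable
  also have "\<dots> = (NN y. ennreal ((c * \<bar>k y\<bar>) * \<bar>f y\<bar>))"
    using c by (simp add: ennreal_mult[symmetric] abs_mult mult.assoc)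
  finally show ?thesis .
qed

lemma ennreal_weighted_square: "ennreal ((rho x powr m * t)^2) = (ennreal (rho x powr m * \<bar>t\<bar>))^2"
  by (subst ennreal_power) (simp_all add: power_mult_distrib)

lemma one_over_square_powr: "(a::real) > 0 \<Longrightarrow> 1 / a^2 = a powr (- 2)"
  using powr_minus[of a 2] by (simp add: inverse_eq_divide)

lemma sqrt_one_over_cube_powr: "(a::real) > 0 \<Longrightarrow> sqrt (1 / a ^ 3) = a powr (- 3 / 2)"
proof -
  assume a: "a > 0"
  have "(a powr (- 3 / 2))^2 = a powr (- 3)"
    unfolding power2_eq_square powr_add[symmetric] by simp
  also have "\<dots> = 1 / a ^ 3" using powr_minus[of a 3] a by (simp add: inverse_eq_divide)
  finally show ?thesis by (intro real_sqrt_unique) simp_all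
qed

lemma two_ennreal_square: "r \<ge> 0 \<Longrightarrow> 2 * (ennreal r)^2 = ennreal (2 * r^2)"
  by (simp add: ennreal_power ennreal_mult)

text \<open>
  The first summand of the majorant factorizes and contributes the moment of order \<open>p\<close> of \<open>f\<close>
  times the \<open>L\<^sup>2\<close> norm of \<open>rho powr (-2)\<close>; the second one is an integral operator applied to the
  weighted function, and its bound \<open>B\<close> comes from Schur's test.
\<close>

lemma kernel_weighted_estimate:
  fixes k :: "real^3 \<Rightarrow> real^3 \<Rightarrow> real" and f :: "real^3 \<Rightarrow> real"
  assumes [measurable]: "f \<in> borel_measurable borel" "case_prod k \<in> borel_measurable (lborel \<Otimes>\<^sub>M lborel)"
    and nn: "C \<ge> 0" "\<epsilon> > 0" "A \<ge> 0" "B \<ge> 0" "c \<ge> 0"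
    and k: "\<And>x y. rho x powr m * \<bar>k x y\<bar>
      \<le> C * kernel_majorant m p \<epsilon> x y"
    and A: "(NN y. ennreal (rho y powr p * \<bar>f y\<bar>)) \<le> ennreal A"
    and B: "(NN x. (NN y. ennreal (rho (x - \<epsilon> *\<^sub>R y) powr (-4)) * ennreal (rho y powr m * \<bar>f y\<bar>))^2) \<le> ennreal (B^2)"
    and c: "(NN x. ennreal (rho x powr (-4))) \<le> ennreal (c^2)"
  shows "(NN x. ennreal ((rho x powr m * (LINT y|lborel. k x y * f y))^2))
    \<le> ennreal (2 * (C * \<epsilon> powr p * A * c)^2 + 2 * (C * \<epsilon> powr m * B)^2)"
proof -
  define J where "J x = (NN y. ennreal (rho (x - \<epsilon> *\<^sub>R y) powr (-4)) * ennreal (rho y powr m * \<bar>f y\<bar>))" for x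
  have [measurable]: "J \<in> borel_measurable borel" unfolding J_def by measurable
  have ptw: "ennreal (rho x powr m * \<bar>LINT y|lborel. k x y * f y\<bar>)
     \<le> ennreal (C * \<epsilon> powr p * A * rho x powr (-2)) + ennreal (C * \<epsilon> powr m) * J x" for x
  proof -
    have "ennreal (rho x powr m * \<bar>LINT y|lborel. k x y * f y\<bar>) \<le> (NN y. ennreal ((rho x powr m * \<bar>k x y\<bar>) * \<bar>f y\<bar>))"
      by (intro ennreal_weighted_abs_integral_le; (measurable | simp))
    also have "\<dots> \<le> (NN y. ennreal (C * \<epsilon> powr p * rho x powr (-2)) * ennreal (rho y powr p * \<bar>f y\<bar>)
         + ennreal (C * \<epsilon> powr m) * (ennreal (rho (x - \<epsilon> *\<^sub>R y) powr (-4)) * ennreal (rho y powr m * \<bar>f y\<bar>)))"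
    proof (rule nn_integral_mono)
      fix y
      have "(rho x powr m * \<bar>k x y\<bar>) * \<bar>f y\<bar> \<le> (C * kernel_majorant m p \<epsilon> x y) * \<bar>f y\<bar>"
        by (intro mult_right_mono k) simp
      also have "\<dots> = (C * \<epsilon> powr p * rho x powr (-2)) * (rho y powr p * \<bar>f y\<bar>)
         + (C * \<epsilon> powr m) * (rho (x - \<epsilon> *\<^sub>R y) powr (-4) * (rho y powr m * \<bar>f y\<bar>))"
        using nn by (simp add: powr_mult algebra_simps)
      finally have "ennreal ((rho x powr m * \<bar>k x y\<bar>) * \<bar>f y\<bar>) \<le> ennreal \<dots>" by (rule ennreal_leI)
      then show "ennreal ((rho x powr m * \<bar>k x y\<bar>) * \<bar>f y\<bar>)
          \<le> ennreal (C * \<epsilon> powr p * rho x powr (-2)) * ennreal (rho y powr p * \<bar>f y\<bar>)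
         + ennreal (C * \<epsilon> powr m) * (ennreal (rho (x - \<epsilon> *\<^sub>R y) powr (-4)) * ennreal (rho y powr m * \<bar>f y\<bar>))"
        using nn by (simp add: ennreal_mult ennreal_plus)
    qed
    also have "\<dots> = ennreal (C * \<epsilon> powr p * rho x powr (-2)) * (NN y. ennreal (rho y powr p * \<bar>f y\<bar>))
        + ennreal (C * \<epsilon> powr m) * J x"
      unfolding J_def by (subst nn_integral_add, measurable) (simp add: nn_integral_cmult)
    also have "\<dots> \<le> ennreal (C * \<epsilon> powr p * rho x powr (-2)) * ennreal A + ennreal (C * \<epsilon> powr m) * J x"
      by (intro add_mono mult_left_mono A) auto
    also have "ennreal (C * \<epsilon> powr p * rho x powr (-2)) * ennreal A = ennreal (C * \<epsilon> powr p * A * rho x powr (-2))"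
      using nn by (simp add: ennreal_mult[symmetric] mult_ac)
    finally show ?thesis .
  qed
  have "(NN x. ennreal ((rho x powr m * (LINT y|lborel. k x y * f y))^2))
    \<le> (NN x. ennreal (2 * (C * \<epsilon> powr p * A)^2) * ennreal (rho x powr (-4)) + ennreal (2 * (C * \<epsilon> powr m)^2) * (J x)^2)"
  proof (rule nn_integral_mono)
    fix x
    have "ennreal ((rho x powr m * (LINT y|lborel. k x y * f y))^2)
        = (ennreal (rho x powr m * \<bar>LINT y|lborel. k x y * f y\<bar>))^2"
      by (rule ennreal_weighted_square)
    also have "\<dots> \<le> (ennreal (C * \<epsilon> powr p * A * rho x powr (-2)) + ennreal (C * \<epsilon> powr m) * J x)^2"
      by (intro power_mono ptw) simp
    also have "\<dots> \<le> 2 * (ennreal (C * \<epsilon> powr p * A * rho x powr (-2)))^2 + 2 * (ennreal (C * \<epsilon> powr m) * J x)^2"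
      by (rule ennreal_square_add_le)
    also have "2 * (ennreal (C * \<epsilon> powr p * A * rho x powr (-2)))^2 = ennreal (2 * (C * \<epsilon> powr p * A)^2) * ennreal (rho x powr (-4))"
    proof -
      have "rho x powr (-4) = (rho x powr (-2))^2"
        by (simp add: power2_eq_square powr_add[symmetric])
      then have "2 * (C * \<epsilon> powr p * A * rho x powr (-2))^2 = 2 * (C * \<epsilon> powr p * A)^2 * rho x powr (-4)"
        by (simp only: power_mult_distrib mult.assoc)
      moreover have "2 * (ennreal (C * \<epsilon> powr p * A * rho x powr (-2)))^2 = ennreal (2 * (C * \<epsilon> powr p * A * rho x powr (-2))^2)"
        using nn by (intro two_ennreal_square) simp
      moreover have "ennreal (2 * (C * \<epsilon> powr p * A)^2 * rho x powr (-4)) = ennreal (2 * (C * \<epsilon> powr p * A)^2) * ennreal (rho x powr (-4))"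
        by (rule ennreal_mult) simp_all
      ultimately show ?thesis by (simp only:)
    qed
    also have "2 * (ennreal (C * \<epsilon> powr m) * J x)^2 = ennreal (2 * (C * \<epsilon> powr m)^2) * (J x)^2"
    proof -
      have "2 * (ennreal (C * \<epsilon> powr m))^2 = ennreal (2 * (C * \<epsilon> powr m)^2)"
        using nn by (intro two_ennreal_square) simp
      then show ?thesis by (simp only: power_mult_distrib mult.assoc[symmetric])
    qed
    finally show "ennreal ((rho x powr m * (LINT y|lborel. k x y * f y))^2)
       \<le> ennreal (2 * (C * \<epsilon> powr p * A)^2) * ennreal (rho x powr (-4)) + ennreal (2 * (C * \<epsilon> powr m)^2) * (J x)^2" .
  qed
  also have "\<dots> = ennreal (2 * (C * \<epsilon> powr p * A)^2) * (NN x. ennreal (rho x powr (-4)))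
      + ennreal (2 * (C * \<epsilon> powr m)^2) * (NN x. (J x)^2)"
    by (subst nn_integral_add, measurable) (simp add: nn_integral_cmult)
  also have "\<dots> \<le> ennreal (2 * (C * \<epsilon> powr p * A)^2) * ennreal (c^2) + ennreal (2 * (C * \<epsilon> powr m)^2) * ennreal (B^2)"
    using B by (intro add_mono mult_left_mono c) (simp_all add: J_def)
  also have "\<dots> = ennreal (2 * (C * \<epsilon> powr p * A * c)^2 + 2 * (C * \<epsilon> powr m * B)^2)"
  proof -
    have "ennreal (2 * (C * \<epsilon> powr p * A)^2) * ennreal (c^2) = ennreal (2 * (C * \<epsilon> powr p * A * c)^2)"
      by (subst ennreal_mult[symmetric]) (simp_all add: power_mult_distrib)
    moreover have "ennreal (2 * (C * \<epsilon> powr m)^2) * ennreal (B^2) = ennreal (2 * (C * \<epsilon> powr m * B)^2)"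
      by (subst ennreal_mult[symmetric]) (simp_all add: power_mult_distrib)
    ultimately show ?thesis by (simp add: ennreal_plus)
  qed
  finally show ?thesis .
qed

lemma heat_kernel_pair_measurable [measurable]:
  "(\<lambda>(x, y). heat a (x - c *\<^sub>R y)) \<in> borel_measurable (lborel \<Otimes>\<^sub>M lborel)"
  "(\<lambda>(x, y). heat_grad a u (x - c *\<^sub>R y)) \<in> borel_measurable (lborel \<Otimes>\<^sub>M lborel)"
  by measurable

text \<open>
  In Schur's test for the second part of the majorant, integration in \<open>y\<close> costs a factor
  \<open>1 / \<epsilon>^3\<close>, so this part is of order \<open>\<epsilon> powr (m - 3/2)\<close>. It is dominated by \<open>\<epsilon> powr p\<close> under the
  same condition \<open>2 (m - p) > 3\<close> that makes the moment of order \<open>p\<close> finite.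
\<close>

lemma linear_remainder_estimate:
  assumes m: "m \<ge> 0" and p: "1 \<le> p" "p \<le> 2" "2 * (m - p) > 3"
  shows "\<exists>C\<ge>1. \<forall>w N \<epsilon> i. weighted_bound m w N \<longrightarrow> 0 < \<epsilon> \<longrightarrow> \<epsilon>^2 \<le> 1 / 2 \<longrightarrow>
    (NN x. ennreal ((rho x powr m * (LINT y|lborel. heat_remainder \<epsilon> x y * w y $ i))^2)) \<le> ennreal ((C * \<epsilon> powr p * N)^2)"
proof -
  obtain C1 where C1: "C1 \<ge> 1" "\<And>\<epsilon> x y. 0 < \<epsilon> \<Longrightarrow> \<epsilon>^2 \<le> 1 / 2 \<Longrightarrow>
    rho x powr m * \<bar>heat_remainder \<epsilon> x y\<bar>
    \<le> C1 * kernel_majorant m p \<epsilon> x y"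
    using heat_remainder_kernel[OF m p(1,2)] by blast
  obtain C2 where C2: "C2 \<ge> 1" "\<And>w N. weighted_bound m w N \<Longrightarrow>
    (NN x. ennreal (rho x powr p * norm (w x))) \<le> ennreal (C2 * N)"
    using weighted_moment_bound[OF p(3)] by blast
  obtain c where c: "c \<ge> 1" "(NN x. ennreal (rho x powr (-4))) \<le> ennreal (c^2)"
    "(NN x. ennreal (rho x powr (-4))) \<le> ennreal c"
    using finite_ennreal_bound[OF nn_integral_rho_powr_finite[of 4]] by force
  define C where "C = 2 * C1 * C2 * c"
  have C_ge: "C \<ge> 1" unfolding C_def using C1(1) C2(1) c(1) by (simp add: mult_ge1_I)
  show ?thesis
  proof (intro exI[of _ C] conjI allI impI C_ge)
    fix w N and \<epsilon> :: real and i
    assume w: "weighted_bound m w N" and e: "0 < \<epsilon>" "\<epsilon>^2 \<le> 1 / 2"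
    note [measurable] = weighted_boundD(1)[OF w]
    have N: "N \<ge> 0" by (rule weighted_boundD[OF w])
    have e1: "\<epsilon> \<le> 1" using e by (intro power2_le_imp_le[of \<epsilon> 1]) auto
    define B where "B = sqrt (1 / \<epsilon> ^ 3) * c * N"
    have B: "B^2 = 1 / \<epsilon> ^ 3 * c^2 * N^2" "B \<ge> 0"
      using e c N by (simp_all add: B_def power_mult_distrib)
    have "(NN x. ennreal ((rho x powr m * (LINT y|lborel. heat_remainder \<epsilon> x y * w y $ i))^2))
      \<le> ennreal (2 * (C1 * \<epsilon> powr p * (C2 * N) * c)^2 + 2 * (C1 * \<epsilon> powr m * B)^2)"
    proof (rule kernel_weighted_estimate)
      show "(NN y. ennreal (rho y powr p * \<bar>w y $ i\<bar>)) \<le> ennreal (C2 * N)"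
        by (rule order_trans[OF nn_integral_mono C2(2)[OF w]])
           (intro ennreal_leI mult_left_mono component_le_norm_cart, simp)
      have "(NN x. (NN y. ennreal (rho (x - \<epsilon> *\<^sub>R y) powr (-4)) * ennreal (rho y powr m * \<bar>w y $ i\<bar>) * 1)^2)
         \<le> ennreal (1 / \<epsilon> ^ 3 * c) * ennreal c * (NN y. (ennreal (rho y powr m * \<bar>w y $ i\<bar>))^2)"
      proof (rule schur_test)
        show "(NN y. ennreal (rho (x - \<epsilon> *\<^sub>R y) powr (-4)) * 1^2) \<le> ennreal (1 / \<epsilon> ^ 3 * c)" for x
        proof -
          have "(NN y. ennreal (rho (x - \<epsilon> *\<^sub>R y) powr (-4))) = ennreal (1 / \<epsilon> ^ 3) * (NN y. ennreal (rho y powr (-4)))"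
            using e by (intro nn_integral_reflect_scale) auto
          also have "\<dots> \<le> ennreal (1 / \<epsilon> ^ 3) * ennreal c" by (intro mult_left_mono c) simp
          also have "\<dots> = ennreal (1 / \<epsilon> ^ 3 * c)" using e c by (simp add: ennreal_mult[symmetric])
          finally show ?thesis by simp
        qed
        show "(NN x. ennreal (rho (x - \<epsilon> *\<^sub>R y) powr (-4))) \<le> ennreal c" for y
          using nn_integral_shift[of "\<lambda>x. ennreal (rho x powr (-4))" "\<epsilon> *\<^sub>R y"] c(3) by simp
      qed measurable
      also have "\<dots> \<le> ennreal (1 / \<epsilon> ^ 3 * c) * ennreal c * ennreal (N^2)"
      proof (intro mult_left_mono)
        have "(NN y. (ennreal (rho y powr m * \<bar>w y $ i\<bar>))^2) \<le> (NN y. (ennreal (rho y powr m * norm (w y)))^2)"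
          by (intro nn_integral_mono power_mono ennreal_leI mult_left_mono component_le_norm_cart) auto
        then show "(NN y. (ennreal (rho y powr m * \<bar>w y $ i\<bar>))^2) \<le> ennreal (N^2)"
          using weighted_boundD(3)[OF w] by (rule order_trans)
      qed simp
      also have "\<dots> = ennreal (B^2)"
        unfolding B(1) using e c N by (simp add: ennreal_mult[symmetric] power2_eq_square)
      finally show "(NN x. (NN y. ennreal (rho (x - \<epsilon> *\<^sub>R y) powr (-4)) * ennreal (rho y powr m * \<bar>w y $ i\<bar>))^2) \<le> ennreal (B^2)"
        by simp
    qed (use C1 C2 c e N B in auto)
    also have "\<dots> \<le> ennreal ((C * \<epsilon> powr p * N)^2)"
    proof (rule ennreal_leI)
      have "(\<epsilon> powr m * sqrt (1 / \<epsilon> ^ 3)) = \<epsilon> powr (m - 3 / 2)"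
      proof -
        have "\<epsilon> powr m * sqrt (1 / \<epsilon> ^ 3) = \<epsilon> powr (m + (- 3 / 2))"
          by (simp only: sqrt_one_over_cube_powr[OF e(1)] powr_add)
        also have "m + (- 3 / 2) = m - 3 / 2" by simp
        finally show ?thesis .
      qed
      moreover have "\<epsilon> powr (m - 3 / 2) \<le> \<epsilon> powr p"
        using p e e1 by (intro powr_mono') auto
      ultimately have "\<epsilon> powr m * B \<le> \<epsilon> powr p * (c * N)"
        unfolding B_def using c N by (simp add: mult.assoc[symmetric] mult_right_mono)
      then have "C1 * \<epsilon> powr m * B \<le> C1 * \<epsilon> powr p * (c * N)"
        using C1 by (simp add: mult.assoc mult_left_mono)
      also have "\<dots> \<le> C1 * \<epsilon> powr p * (C2 * N) * c"
      proof -
        have "c * N * 1 \<le> c * N * C2" using c N C2 by (intro mult_left_mono) auto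
        then have "C1 * \<epsilon> powr p * (c * N * 1) \<le> C1 * \<epsilon> powr p * (c * N * C2)"
          by (rule mult_left_mono) (use C1 in simp)
        then show ?thesis by (simp add: mult_ac)
      qed
      finally have "(C1 * \<epsilon> powr m * B)^2 \<le> (C1 * \<epsilon> powr p * (C2 * N) * c)^2"
        using C1 B e by (intro power_mono) auto
      then have "2 * (C1 * \<epsilon> powr p * (C2 * N) * c)^2 + 2 * (C1 * \<epsilon> powr m * B)^2 \<le> 4 * (C1 * \<epsilon> powr p * (C2 * N) * c)^2"
        by linarith
      also have "\<dots> = (C * \<epsilon> powr p * N)^2"
        by (simp add: C_def power2_eq_square mult_ac)
      finally show "2 * (C1 * \<epsilon> powr p * (C2 * N) * c)^2 + 2 * (C1 * \<epsilon> powr m * B)^2 \<le> (C * \<epsilon> powr p * N)^2" .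
    qed
    finally show "(NN x. ennreal ((rho x powr m * (LINT y|lborel. heat_remainder \<epsilon> x y * w y $ i))^2)) \<le> ennreal ((C * \<epsilon> powr p * N)^2)" .
  qed
qed

lemma weighted_flux_le:
  assumes "q \<le> m"
  shows "ennreal (rho y powr q * \<bar>vort_flux i j w y\<bar>) \<le> 2 * (ennreal (rho y powr m * norm (w y)) * riesz w y)"
proof -
  have "ennreal (rho y powr q * \<bar>vort_flux i j w y\<bar>) \<le> ennreal (rho y powr m) * ennreal \<bar>vort_flux i j w y\<bar>"
    using assms rho_ge_1[of y]
    by (subst ennreal_mult[symmetric]) (auto intro!: ennreal_leI mult_right_mono powr_mono)
  also have "\<dots> \<le> ennreal (rho y powr m) * (2 * (ennreal (norm (w y)) * riesz w y))"
    by (intro mult_left_mono vort_flux_le) simp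
  also have "\<dots> = 2 * (ennreal (rho y powr m) * ennreal (norm (w y)) * riesz w y)"
    by (simp only: mult_ac)
  also have "ennreal (rho y powr m) * ennreal (norm (w y)) = ennreal (rho y powr m * norm (w y))"
    by (rule ennreal_mult[symmetric]) simp_all
  finally show ?thesis .
qed

text \<open>
  The flux is at most twice the product of \<open>norm \<circ> w\<close>, which is measured in the weighted norm, and
  the velocity, which is the additional factor in Schur's test.
\<close>

lemma flux_schur_estimate:
  fixes H :: "real^3 \<Rightarrow> real^3 \<Rightarrow> ennreal"
  assumes w: "weighted_bound m w N" and [measurable]: "case_prod H \<in> borel_measurable (lborel \<Otimes>\<^sub>M lborel)"
    and S: "\<And>x. (NN y. H x y * (riesz w y)^2) \<le> ennreal S" and B: "\<And>y. (NN x. H x y) \<le> ennreal B"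
    and nn: "S \<ge> 0" "B \<ge> 0"
  shows "(NN x. (NN y. H x y * ennreal (rho y powr m * \<bar>vort_flux i j w y\<bar>))^2) \<le> ennreal (4 * S * B * N^2)"
proof -
  note [measurable] = weighted_boundD(1)[OF w]
  let ?J = "\<lambda>x. NN y. H x y * ennreal (rho y powr m * norm (w y)) * riesz w y"
  have "(NN x. (NN y. H x y * ennreal (rho y powr m * \<bar>vort_flux i j w y\<bar>))^2) \<le> (NN x. 4 * (?J x)^2)"
  proof (rule nn_integral_mono)
    fix x
    have "(NN y. H x y * ennreal (rho y powr m * \<bar>vort_flux i j w y\<bar>))
      \<le> (NN y. H x y * (2 * (ennreal (rho y powr m * norm (w y)) * riesz w y)))"
      by (intro nn_integral_mono mult_left_mono weighted_flux_le) auto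
    also have "\<dots> = (NN y. 2 * (H x y * ennreal (rho y powr m * norm (w y)) * riesz w y))"
      by (intro nn_integral_cong) (simp only: mult_ac)
    also have "\<dots> = 2 * ?J x" by (rule nn_integral_cmult) measurable
    finally have "(NN y. H x y * ennreal (rho y powr m * \<bar>vort_flux i j w y\<bar>))^2 \<le> (2 * ?J x)^2"
      by (intro power_mono) auto
    then show "(NN y. H x y * ennreal (rho y powr m * \<bar>vort_flux i j w y\<bar>))^2 \<le> 4 * (?J x)^2"
      by (simp add: power_mult_distrib)
  qed
  also have "\<dots> = 4 * (NN x. (?J x)^2)" by (rule nn_integral_cmult) measurable
  also have "\<dots> \<le> 4 * (ennreal S * ennreal B * (NN y. (ennreal (rho y powr m * norm (w y)))^2))"
    by (intro mult_left_mono schur_test S B) (simp_all, measurable)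
  also have "\<dots> \<le> 4 * (ennreal S * ennreal B * ennreal (N^2))"
    by (intro mult_left_mono weighted_boundD(3)[OF w]) auto
  also have "\<dots> = ennreal (4 * S * B * N^2)"
    using nn by (simp add: ennreal_mult mult.assoc)
  finally show ?thesis .
qed

text \<open>
  Since the flux has mean zero, the value of the kernel at \<open>y = 0\<close> may be subtracted; this gains
  the factor \<open>\<epsilon> powr p\<close>. As the velocity is square integrable, no negative power of \<open>\<epsilon>\<close> arises in
  Schur's test.
\<close>

lemma flux_long_time_estimate:
  assumes m: "m > 5 / 2" and p: "0 \<le> p" "p \<le> 1"
  shows "\<exists>C\<ge>1. \<forall>w \<epsilon> i j. w \<in> solenoidal_L2 m \<longrightarrow> 0 < \<epsilon> \<longrightarrow> \<epsilon>^2 \<le> 1 / 2 \<longrightarrow>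
    (NN x. ennreal ((rho x powr m * flux_conv \<epsilon> i j w x)^2))
    \<le> ennreal ((C * \<epsilon> powr p * (weighted_norm m w)^2)^2)"
proof -
  have m0: "m \<ge> 0" "m > 3 / 2" "p \<le> m" using m p by auto
  obtain C1 where C1: "C1 \<ge> 1" "\<And>\<epsilon> u x y. 0 < \<epsilon> \<Longrightarrow> \<epsilon>^2 \<le> 1 / 2 \<Longrightarrow> norm u \<le> 1 \<Longrightarrow>
    rho x powr m * \<bar>heat_grad (1 - \<epsilon>^2) u (x - \<epsilon> *\<^sub>R y) - heat_grad (1 - \<epsilon>^2) u x\<bar>
    \<le> C1 * kernel_majorant m p \<epsilon> x y"
    using heat_grad_difference_kernel[OF m0(1) p] by blast
  obtain C3 where C3: "C3 \<ge> 1" "\<And>w N. weighted_bound m w N \<Longrightarrow> (NN x. (riesz w x)^2) \<le> ennreal ((C3 * N)^2)"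
    using riesz_L2_bound[OF m0(2)] by blast
  obtain c where c: "c \<ge> 1" "(NN x. ennreal (rho x powr (-4))) \<le> ennreal (c^2)"
    using finite_ennreal_bound[OF nn_integral_rho_powr_finite[of 4]] by force
  define C where "C = 4 * C1 * C3 * c"
  have C_ge: "C \<ge> 1" unfolding C_def using C1(1) C3(1) c(1) by (simp add: mult_ge1_I)
  show ?thesis
  proof (intro exI[of _ C] conjI allI impI C_ge)
    fix w and \<epsilon> :: real and i j :: 3
    assume sol: "w \<in> solenoidal_L2 m" and e: "0 < \<epsilon>" "\<epsilon>^2 \<le> 1 / 2"
    define N where "N = weighted_norm m w"
    have w: "weighted_bound m w N" unfolding N_def by (rule solenoidal_weighted_bound[OF sol])
    note [measurable] = weighted_boundD(1)[OF w]
    have N: "N \<ge> 0" by (rule weighted_boundD[OF w])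
    have e1: "\<epsilon> \<le> 1" using e by (intro power2_le_imp_le[of \<epsilon> 1]) auto
    have a: "1 - \<epsilon>^2 > 0" using e by simp
    have fi: "integrable lborel (vort_flux i j w)" by (rule vort_flux_integrable[OF w m0(2)])
    have sub: "flux_conv \<epsilon> i j w x
      = (LINT y|lborel. (heat_grad (1 - \<epsilon>^2) (axis j 1) (x - \<epsilon> *\<^sub>R y) - heat_grad (1 - \<epsilon>^2) (axis j 1) x) * vort_flux i j w y)" for x
    proof -
      have "integrable lborel (\<lambda>y. heat_grad (1 - \<epsilon>^2) (axis j 1) (x - \<epsilon> *\<^sub>R y) * vort_flux i j w y)"
        by (rule integrable_bounded_mult[OF fi _ heat_grad_bounded[OF a]]) measurable
      then show ?thesis
        unfolding left_diff_distrib using fi by (simp add: integral_vort_flux_zero[OF sol m])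
    qed
    have meas: "(\<lambda>(x, y). heat_grad (1 - \<epsilon>^2) (axis j 1) (x - \<epsilon> *\<^sub>R y) - heat_grad (1 - \<epsilon>^2) (axis j 1) x)
        \<in> borel_measurable (lborel \<Otimes>\<^sub>M lborel)" by measurable
    have "(NN x. ennreal ((rho x powr m * (LINT y|lborel. (heat_grad (1 - \<epsilon>^2) (axis j 1) (x - \<epsilon> *\<^sub>R y)
          - heat_grad (1 - \<epsilon>^2) (axis j 1) x) * vort_flux i j w y))^2))
      \<le> ennreal (2 * (C1 * \<epsilon> powr p * (2 * C3 * N^2) * c)^2 + 2 * (C1 * \<epsilon> powr m * (2 * C3 * c * N^2))^2)"
    proof (rule kernel_weighted_estimate[OF _ meas])
      show "(NN y. ennreal (rho y powr p * \<bar>vort_flux i j w y\<bar>)) \<le> ennreal (2 * C3 * N^2)"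
      proof -
        have "(NN y. ennreal (rho y powr p * \<bar>vort_flux i j w y\<bar>))
          \<le> (NN y. 2 * (ennreal (rho y powr m * norm (w y)) * riesz w y))"
          by (intro nn_integral_mono weighted_flux_le m0)
        also have "\<dots> = 2 * (NN y. ennreal (rho y powr m * norm (w y)) * riesz w y)"
          by (rule nn_integral_cmult) measurable
        also have "\<dots> \<le> ennreal 2 * ennreal (N * (C3 * N))"
          using weighted_boundD(3)[OF w] C3(2)[OF w] N C3(1)
          by (intro mult_mono Cauchy_Schwarz_bound) auto
        also have "\<dots> = ennreal (2 * C3 * N^2)"
          using N C3(1) by (subst ennreal_mult[symmetric]) (auto simp: power2_eq_square mult_ac)
        finally show ?thesis .
      qed
      have "(NN x. (NN y. ennreal (rho (x - \<epsilon> *\<^sub>R y) powr (-4)) * ennreal (rho y powr m * \<bar>vort_flux i j w y\<bar>))^2)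
        \<le> ennreal (4 * (C3 * N)^2 * c^2 * N^2)"
      proof (rule flux_schur_estimate[OF w])
        show "(NN y. ennreal (rho (x - \<epsilon> *\<^sub>R y) powr (-4)) * (riesz w y)^2) \<le> ennreal ((C3 * N)^2)" for x
        proof -
          have "ennreal (rho (x - \<epsilon> *\<^sub>R y) powr (-4)) \<le> 1" for y
            using ennreal_leI[OF rho_powr_neg4_le_1] by simp
          then have "(NN y. ennreal (rho (x - \<epsilon> *\<^sub>R y) powr (-4)) * (riesz w y)^2) \<le> (NN y. 1 * (riesz w y)^2)"
            by (intro nn_integral_mono mult_right_mono) auto
          then show ?thesis using C3(2)[OF w] by simp
        qed
        show "(NN x. ennreal (rho (x - \<epsilon> *\<^sub>R y) powr (-4))) \<le> ennreal (c^2)" for y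
          using nn_integral_shift[of "\<lambda>x. ennreal (rho x powr (-4))" "\<epsilon> *\<^sub>R y"] c(2) by simp
      qed simp_all
      also have "4 * (C3 * N)^2 * c^2 * N^2 = (2 * C3 * c * N^2)^2"
        by (simp add: power2_eq_square mult_ac)
      finally show "(NN x. (NN y. ennreal (rho (x - \<epsilon> *\<^sub>R y) powr (-4)) * ennreal (rho y powr m * \<bar>vort_flux i j w y\<bar>))^2)
        \<le> ennreal ((2 * C3 * c * N^2)^2)" .
    qed (use C1 C3 c e N in auto)
    also have "\<dots> \<le> ennreal ((C * \<epsilon> powr p * N^2)^2)"
    proof (rule ennreal_leI)
      have "\<epsilon> powr m \<le> \<epsilon> powr p"
        using m0 e e1 by (intro powr_mono') auto
      then have "C1 * \<epsilon> powr m * (2 * C3 * c * N^2) \<le> C1 * \<epsilon> powr p * (2 * C3 * c * N^2)"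
        using C1 C3 c by (intro mult_right_mono mult_left_mono) auto
      also have "\<dots> = C1 * \<epsilon> powr p * (2 * C3 * N^2) * c" by (simp only: mult_ac)
      finally have "(C1 * \<epsilon> powr m * (2 * C3 * c * N^2))^2 \<le> (C1 * \<epsilon> powr p * (2 * C3 * N^2) * c)^2"
        using C1 C3 c by (intro power_mono) auto
      then have "2 * (C1 * \<epsilon> powr p * (2 * C3 * N^2) * c)^2 + 2 * (C1 * \<epsilon> powr m * (2 * C3 * c * N^2))^2
          \<le> 4 * (C1 * \<epsilon> powr p * (2 * C3 * N^2) * c)^2"
        by linarith
      also have "\<dots> = (C * \<epsilon> powr p * N^2)^2"
        by (simp add: C_def power2_eq_square mult_ac)
      finally show "2 * (C1 * \<epsilon> powr p * (2 * C3 * N^2) * c)^2 + 2 * (C1 * \<epsilon> powr m * (2 * C3 * c * N^2))^2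
          \<le> (C * \<epsilon> powr p * N^2)^2" .
    qed
    finally show "(NN x. ennreal ((rho x powr m * flux_conv \<epsilon> i j w x)^2))
      \<le> ennreal ((C * \<epsilon> powr p * (weighted_norm m w)^2)^2)"
      unfolding sub N_def .
  qed
qed

lemma nn_integral_gauss_scale:
  "\<exists>c\<ge>1. \<forall>a>0. (NN x. ennreal (exp (- ((norm (x::real^3))^2 / (8 * a))))) \<le> ennreal (c * a powr (3 / 2))"
proof -
  have fin: "(NN x. ennreal (exp (- ((norm (x::real^3))^2 / 4)))) < \<infinity>"
  proof -
    have "(NN x. ennreal (exp (- ((norm (x::real^3))^2 / 4))))
        \<le> (NN x. ennreal (exp (4^2)) * ennreal (rho x powr (-4)))"
    proof (rule nn_integral_mono)
      fix x :: "real^3"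
      have "ennreal (exp (- ((norm x)^2 / 4))) \<le> ennreal (exp (4^2) * rho x powr (-4))"
        by (rule ennreal_leI, rule exp_neg_square_le_rho_powr) simp
      then show "ennreal (exp (- ((norm x)^2 / 4))) \<le> ennreal (exp (4^2)) * ennreal (rho x powr (-4))"
        by (simp only: ennreal_mult[OF exp_ge_zero powr_ge_zero])
    qed
    also have "\<dots> = ennreal (exp (4^2)) * (NN x. ennreal (rho x powr (-4)))"
      by (rule nn_integral_cmult) measurable
    also have "\<dots> < \<infinity>"
      using nn_integral_rho_powr_finite[of 4] by (simp add: ennreal_mult_less_top)
    finally show ?thesis .
  qed
  from finite_ennreal_bound[OF fin] obtain K where
    K: "K \<ge> 1" "(NN x. ennreal (exp (- ((norm (x::real^3))^2 / 4)))) \<le> ennreal K" by metis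
  define c where "c = 2 powr (3 / 2) * K"
  have c1: "c \<ge> 1" unfolding c_def using K(1) by (intro mult_ge1_I ge_one_powr_ge_zero) auto
  show ?thesis
  proof (intro exI[of _ c] conjI allI impI c1)
    fix a :: real assume a: "a > 0"
    define s where "s = sqrt (2 * a)"
    have s: "s > 0" "s^2 = 2 * a" using a by (auto simp: s_def)
    have s3: "s ^ 3 = 2 powr (3 / 2) * a powr (3 / 2)"
    proof -
      have "s = (2 * a) powr (1 / 2)" using a by (simp add: s_def powr_half_sqrt)
      then have "s ^ 3 = (2 * a) powr (3 / 2)"
        using a by (simp add: powr_powr flip: powr_numeral)
      then show ?thesis by (simp add: powr_mult)
    qed
    have "(NN x. ennreal (exp (- ((norm (x::real^3))^2 / (8 * a)))))
       = ennreal (\<bar>s\<bar> ^ DIM(real^3)) * (NN x. ennreal (exp (- ((norm (0 + s *\<^sub>R (x::real^3)))^2 / (8 * a)))))"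
      by (rule nn_integral_affine) (use s in auto)
    also have "\<dots> = ennreal (\<bar>s\<bar> ^ DIM(real^3)) * (NN x. ennreal (exp (- ((norm (x::real^3))^2 / 4))))"
      using s a by (simp add: power_mult_distrib)
    also have "\<dots> \<le> ennreal (s ^ 3) * ennreal K"
      using s K(2) by (intro mult_mono) auto
    also have "\<dots> = ennreal (c * a powr (3 / 2))"
      using K(1) s by (subst ennreal_mult[symmetric]) (auto simp: s3 c_def mult_ac)
    finally show "(NN x. ennreal (exp (- ((norm (x::real^3))^2 / (8 * a))))) \<le> ennreal (c * a powr (3 / 2))" .
  qed
qed

text \<open>
  With \<open>a = 1 - exp (- t)\<close>, the weighted kernel is at most a multiple of
  \<open>a powr (-2) exp (- norm x^2 / (8a))\<close>, whose \<open>L\<^sup>1\<close> norm is of order \<open>a powr (-1/2)\<close> and whose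
  \<open>L\<^sup>2\<close> norm is of order \<open>a powr (-5/4)\<close>. Schur's test, with the \<open>L\<^sup>2\<close> norm controlling the
  integral against the square of the velocity, gives the geometric mean \<open>a powr (-7/8)\<close>; moreover
  \<open>a \<ge> t / 2\<close>.
\<close>

lemma flux_short_time_estimate:
  assumes m: "m > 5 / 2"
  shows "\<exists>C\<ge>1. \<forall>w N t i j. weighted_bound m w N \<longrightarrow> 0 < t \<longrightarrow> t \<le> 1 \<longrightarrow>
    (NN x. ennreal ((rho x powr m * flux_conv (exp (- t / 2)) i j w x)^2))
    \<le> ennreal ((C * t powr (- 7 / 8) * N^2)^2)"
proof -
  have m0: "m \<ge> 0" "m > 3 / 2" using m by auto
  obtain C3 where C3: "C3 \<ge> 1" "\<And>w N h A B. weighted_bound m w N \<Longrightarrow> h \<in> borel_measurable borel \<Longrightarrow> A \<ge> 0 \<Longrightarrow> B \<ge> 0 \<Longrightarrow>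
    (NN x. h x) \<le> ennreal A \<Longrightarrow> (NN x. (h x)^2) \<le> ennreal (B^2) \<Longrightarrow>
    (NN x. h x * (riesz w x)^2) \<le> ennreal (C3 * (A + B) * N^2)"
    using riesz_weighted_bound[OF m0(2)] by blast
  obtain c where c: "c \<ge> 1" "\<And>a. a > 0 \<Longrightarrow> (NN x. ennreal (exp (- ((norm (x::real^3))^2 / (8 * a))))) \<le> ennreal (c * a powr (3 / 2))"
    using nn_integral_gauss_scale by blast
  define G where "G = 2 * exp (4 * m^2)"
  have G: "G \<ge> 1" unfolding G_def by (intro mult_ge1_I) auto
  define Q where "Q = 4 * C3 * (16 * G * c) * (G * c)"
  have Q: "Q \<ge> 1" unfolding Q_def using C3(1) G c(1) by (intro mult_ge1_I) auto
  define C where "C = 3 * sqrt Q"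
  have C_ge: "C \<ge> 1" unfolding C_def using Q by (intro mult_ge1_I) auto
  show ?thesis
  proof (intro exI[of _ C] conjI allI impI C_ge)
    fix w and N t :: real and i j :: 3
    assume w: "weighted_bound m w N" and t: "0 < t" "t \<le> 1"
    note [measurable] = weighted_boundD(1)[OF w]
    have N: "N \<ge> 0" by (rule weighted_boundD[OF w])
    define \<epsilon> where "\<epsilon> = exp (- t / 2)"
    define a where "a = 1 - \<epsilon>^2"
    have e2: "\<epsilon>^2 = exp (- t)" by (simp add: \<epsilon>_def power2_eq_square exp_add[symmetric])
    have e: "\<epsilon> > 0" "\<epsilon> \<le> 1" using t by (auto simp: \<epsilon>_def)
    have a: "a > 0" "a \<le> 1" "t / 2 \<le> a"
    proof -
      show "a > 0" "a \<le> 1" using t by (auto simp: a_def e2)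
      have "1 + t \<le> exp t" by (rule exp_ge_add_one_self)
      then have "exp (- t) \<le> 1 / (1 + t)" using t by (simp add: exp_minus field_simps)
      moreover have "1 / (1 + t) \<le> 1 - t / 2" using t mult_left_mono[of t 1 t] by (simp add: field_simps)
      ultimately show "t / 2 \<le> a" by (simp add: a_def e2)
    qed
    \<comment> \<open>The constant is a square, because it will also appear as the square of an \<open>L\<^sup>2\<close> norm.\<close>
    have e3: "1 / \<epsilon> ^ 3 \<le> 16"
    proof -
      have "1 / 2 \<le> \<epsilon>"
      proof -
        have "1 - t / 2 \<le> exp (- t / 2)" using exp_ge_add_one_self[of "- t / 2"] by simp
        then show ?thesis using t by (simp add: \<epsilon>_def)
      qed
      then have "(1 / 2) ^ 3 \<le> \<epsilon> ^ 3" by (intro power_mono) auto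
      then have "1 / \<epsilon> ^ 3 \<le> 1 / (1 / 2) ^ 3" using e by (intro divide_left_mono) auto
      then show ?thesis by (simp add: power3_eq_cube)
    qed
    define h where "h x = G * (1 / a^2) * exp (- ((norm (x::real^3))^2 / (8 * a)))" for x
    have [measurable]: "h \<in> borel_measurable borel" unfolding h_def by measurable
    have h0: "h x \<ge> 0" for x using G by (simp add: h_def)
    have a12: "1 / a^2 * a powr (3 / 2) = a powr (- 1 / 2)"
    proof -
      have "1 / a^2 = a powr (-2)" by (rule one_over_square_powr[OF a(1)])
      then have "1 / a^2 * a powr (3 / 2) = a powr (- 2 + 3 / 2)" by (simp only: powr_add)
      also have "- 2 + 3 / 2 = (- 1 / 2 :: real)" by simp
      finally show ?thesis .
    qed
    have h1: "(NN x. ennreal (h x)) \<le> ennreal (G * c * a powr (- 1 / 2))"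
    proof -
      have "(NN x. ennreal (h x))
          = (NN x. ennreal (G * (1 / a^2)) * ennreal (exp (- ((norm (x::real^3))^2 / (8 * a)))))"
        using G by (intro nn_integral_cong) (simp add: h_def ennreal_mult[symmetric])
      also have "\<dots> = ennreal (G * (1 / a^2)) * (NN x. ennreal (exp (- ((norm (x::real^3))^2 / (8 * a)))))"
        by (rule nn_integral_cmult) measurable
      also have "\<dots> \<le> ennreal (G * (1 / a^2)) * ennreal (c * a powr (3 / 2))"
        by (intro mult_left_mono c a) simp
      also have "\<dots> = ennreal (G * c * (1 / a^2 * a powr (3 / 2)))"
        using G c by (subst ennreal_mult[symmetric]) (auto simp: mult_ac)
      finally show ?thesis unfolding a12 .
    qed
    have h2: "(NN x. (ennreal (h x))^2) \<le> ennreal ((G * c * a powr (- 5 / 4))^2)"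
    proof -
      have "(NN x. (ennreal (h x))^2) \<le> (NN x. ennreal (G * (1 / a^2)) * ennreal (h x))"
      proof (rule nn_integral_mono)
        fix x
        have "h x \<le> G * (1 / a^2) * 1"
          unfolding h_def using G a by (intro mult_left_mono) auto
        then have "h x * h x \<le> G * (1 / a^2) * 1 * h x"
          by (rule mult_right_mono) (rule h0)
        then have "(h x)^2 \<le> G * (1 / a^2) * h x"
          by (simp only: power2_eq_square[of "h x"] mult_1_right)
        then show "(ennreal (h x))^2 \<le> ennreal (G * (1 / a^2)) * ennreal (h x)"
          using h0[of x] G by (simp add: ennreal_power ennreal_mult[symmetric] ennreal_leI)
      qed
      also have "\<dots> = ennreal (G * (1 / a^2)) * (NN x. ennreal (h x))"
        by (rule nn_integral_cmult) measurable
      also have "\<dots> \<le> ennreal (G * (1 / a^2)) * ennreal (G * c * a powr (- 1 / 2))"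
        by (intro mult_left_mono h1) simp
      also have "\<dots> = ennreal (G * (1 / a^2) * (G * c * a powr (- 1 / 2)))"
        using G c by (subst ennreal_mult[symmetric]) auto
      also have "\<dots> \<le> ennreal ((G * c * a powr (- 5 / 4))^2)"
      proof (rule ennreal_leI)
        have "1 / a^2 = a powr (-2)" by (rule one_over_square_powr[OF a(1)])
        then have "1 / a^2 * a powr (- 1 / 2) = (a powr (- 5 / 4))^2"
          unfolding power2_eq_square by (simp only: powr_add[symmetric]) simp
        then have "G * (1 / a^2) * (G * c * a powr (- 1 / 2)) = G * G * c * (a powr (- 5 / 4))^2"
          by (metis (no_types, opaque_lifting) mult.assoc mult.left_commute)
        also have "\<dots> \<le> G * G * (c * c) * (a powr (- 5 / 4))^2"
          using c(1) G by (intro mult_right_mono mult_left_mono) auto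
        also have "\<dots> = (G * c * a powr (- 5 / 4))^2" by (simp add: power2_eq_square mult_ac)
        finally show "G * (1 / a^2) * (G * c * a powr (- 1 / 2)) \<le> (G * c * a powr (- 5 / 4))^2" .
      qed
      finally show ?thesis .
    qed
    have scale: "(NN y. f (x - \<epsilon> *\<^sub>R y)) \<le> ennreal (16 * A)"
      if "f \<in> borel_measurable borel" "(NN y. f y) \<le> ennreal A" "A \<ge> 0" for f A and x :: "real^3"
    proof -
      have "(NN y. f (x - \<epsilon> *\<^sub>R y)) = ennreal (1 / \<epsilon> ^ 3) * (NN y. f y)"
        by (rule nn_integral_reflect_scale[OF that(1) e(1)])
      also have "\<dots> \<le> ennreal 16 * ennreal A"
        using e3 that by (intro mult_mono ennreal_leI) auto
      also have "\<dots> = ennreal (16 * A)" using that by (subst ennreal_mult[symmetric]) auto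
      finally show ?thesis .
    qed
    \<comment> \<open>The supremum over \<open>x\<close> in Schur's test.\<close>
    have S: "(NN y. ennreal (h (x - \<epsilon> *\<^sub>R y)) * (riesz w y)^2)
        \<le> ennreal (C3 * (16 * (G * c * a powr (- 1 / 2)) + 4 * (G * c * a powr (- 5 / 4))) * N^2)" for x
    proof (rule C3(2)[OF w])
      show "(NN y. ennreal (h (x - \<epsilon> *\<^sub>R y))) \<le> ennreal (16 * (G * c * a powr (- 1 / 2)))"
        using h1 G c(1) by (intro scale[where f="\<lambda>x. ennreal (h x)"]) auto
      have "(NN y. (ennreal (h (x - \<epsilon> *\<^sub>R y)))^2) \<le> ennreal (16 * (G * c * a powr (- 5 / 4))^2)"
        using h2 G c(1) by (intro scale[where f="\<lambda>x. (ennreal (h x))^2"]) auto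
      then show "(NN y. (ennreal (h (x - \<epsilon> *\<^sub>R y)))^2) \<le> ennreal ((4 * (G * c * a powr (- 5 / 4)))^2)"
        by (simp add: power_mult_distrib)
    qed (use G c(1) in auto)
    let ?S = "C3 * (16 * (G * c * a powr (- 1 / 2)) + 4 * (G * c * a powr (- 5 / 4))) * N^2"
    let ?B = "G * c * a powr (- 1 / 2)"
    have pt: "ennreal (rho x powr m * \<bar>flux_conv \<epsilon> i j w x\<bar>)
       \<le> (NN y. ennreal (h (x - \<epsilon> *\<^sub>R y)) * ennreal (rho y powr m * \<bar>vort_flux i j w y\<bar>))" for x
    proof -
      have "ennreal (rho x powr m * \<bar>flux_conv \<epsilon> i j w x\<bar>)
        \<le> (NN y. ennreal ((rho x powr m * \<bar>heat_grad a (axis j 1) (x - \<epsilon> *\<^sub>R y)\<bar>) * \<bar>vort_flux i j w y\<bar>))"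
        unfolding a_def by (intro ennreal_weighted_abs_integral_le; (measurable | simp))
      also have "\<dots> \<le> (NN y. ennreal (h (x - \<epsilon> *\<^sub>R y)) * ennreal (rho y powr m * \<bar>vort_flux i j w y\<bar>))"
      proof (rule nn_integral_mono)
        fix y
        define z where "z = x - \<epsilon> *\<^sub>R y"
        have "rho (\<epsilon> *\<^sub>R y) \<le> rho y"
          using e by (simp add: rho_def mult_left_le_one_le)
        then have "rho (\<epsilon> *\<^sub>R y) powr m \<le> rho y powr m" using m0 by (intro powr_mono2) auto
        then have "rho z powr m * rho (\<epsilon> *\<^sub>R y) powr m \<le> rho z powr m * rho y powr m" by (intro mult_left_mono) auto
        then have "rho x powr m \<le> rho z powr m * rho y powr m"
          using rho_powr_add_le[OF m0(1), of x "\<epsilon> *\<^sub>R y"] unfolding z_def by linarith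
        then have "rho x powr m * \<bar>heat_grad a (axis j 1) z\<bar> \<le> (rho z powr m * rho y powr m) * \<bar>heat_grad a (axis j 1) z\<bar>"
          by (rule mult_right_mono) simp
        also have "\<dots> = rho y powr m * (rho z powr m * \<bar>heat_grad a (axis j 1) z\<bar>)" by (simp only: mult_ac)
        also have "\<dots> \<le> rho y powr m * h z"
          unfolding h_def G_def by (intro mult_left_mono heat_grad_short_time) (use a m0 in auto)
        finally have "(rho x powr m * \<bar>heat_grad a (axis j 1) z\<bar>) * \<bar>vort_flux i j w y\<bar> \<le> (rho y powr m * h z) * \<bar>vort_flux i j w y\<bar>"
          by (rule mult_right_mono) simp
        also have "\<dots> = h z * (rho y powr m * \<bar>vort_flux i j w y\<bar>)" by (simp only: mult_ac)
        finally show "ennreal ((rho x powr m * \<bar>heat_grad a (axis j 1) (x - \<epsilon> *\<^sub>R y)\<bar>) * \<bar>vort_flux i j w y\<bar>)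
            \<le> ennreal (h (x - \<epsilon> *\<^sub>R y)) * ennreal (rho y powr m * \<bar>vort_flux i j w y\<bar>)"
          using h0[of z] unfolding z_def by (simp add: ennreal_mult[symmetric] ennreal_leI)
      qed
      finally show ?thesis .
    qed
    have "(NN x. ennreal ((rho x powr m * flux_conv \<epsilon> i j w x)^2))
       \<le> (NN x. (NN y. ennreal (h (x - \<epsilon> *\<^sub>R y)) * ennreal (rho y powr m * \<bar>vort_flux i j w y\<bar>))^2)"
      unfolding ennreal_weighted_square by (intro nn_integral_mono power_mono pt) simp
    also have "\<dots> \<le> ennreal (4 * ?S * ?B * N^2)"
    proof (rule flux_schur_estimate[OF w _ S])
      show "(NN x. ennreal (h (x - \<epsilon> *\<^sub>R y))) \<le> ennreal ?B" for y
        using nn_integral_shift[of "\<lambda>x. ennreal (h x)" "\<epsilon> *\<^sub>R y"] h1 by simp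
    qed (use C3(1) G c(1) in auto)
    also have "\<dots> \<le> ennreal ((C * t powr (- 7 / 8) * N^2)^2)"
    proof (rule ennreal_leI)
      have a1: "a powr (- 1 / 2) \<le> a powr (- 5 / 4)"
        using a by (intro powr_mono') auto
      have "16 * (G * c * a powr (- 1 / 2)) + 4 * (G * c * a powr (- 5 / 4)) \<le> 2 * (16 * G * c) * a powr (- 5 / 4)"
      proof -
        have "G * c * a powr (- 1 / 2) \<le> G * c * a powr (- 5 / 4)"
          using a1 G c(1) by (intro mult_left_mono) auto
        moreover have "0 \<le> G * c * a powr (- 5 / 4)" using G c(1) by simp
        ultimately show ?thesis by linarith
      qed
      then have "4 * ?S * ?B * N^2 \<le> 4 * (C3 * (2 * (16 * G * c) * a powr (- 5 / 4)) * N^2) * ?B * N^2"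
        using C3(1) G c(1) by (intro mult_left_mono mult_right_mono) auto
      also have "\<dots> = 2 * Q * (N^2)^2 * (a powr (- 5 / 4) * a powr (- 1 / 2))"
        by (simp add: Q_def power2_eq_square mult_ac)
      also have "a powr (- 5 / 4) * a powr (- 1 / 2) = (a powr (- 7 / 8))^2"
        unfolding power2_eq_square[of "a powr _"] powr_add[symmetric] by simp
      also have "2 * Q * (N^2)^2 * (a powr (- 7 / 8))^2 \<le> 2 * Q * (N^2)^2 * (2 * (t powr (- 7 / 8))^2 * 2)"
      proof (intro mult_left_mono)
        have "a powr (- 7 / 8) \<le> (t / 2) powr (- 7 / 8)"
          using a t by (intro powr_mono2') auto
        also have "\<dots> = 2 powr (7 / 8) * t powr (- 7 / 8)"
          by (simp add: powr_divide powr_minus field_simps)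
        also have "\<dots> \<le> 2 powr 1 * t powr (- 7 / 8)"
          by (intro mult_right_mono powr_mono) auto
        finally have "a powr (- 7 / 8) \<le> 2 * t powr (- 7 / 8)" by simp
        then have "(a powr (- 7 / 8))^2 \<le> (2 * t powr (- 7 / 8))^2" by (intro power_mono) auto
        then show "(a powr (- 7 / 8))^2 \<le> 2 * (t powr (- 7 / 8))^2 * 2" by (simp add: power_mult_distrib)
      qed (use Q in auto)
      also have "\<dots> = 8 * Q * (N^2)^2 * (t powr (- 7 / 8))^2" by simp
      also have "\<dots> \<le> 9 * Q * (N^2)^2 * (t powr (- 7 / 8))^2"
        using Q by (intro mult_right_mono) auto
      also have "\<dots> = (C * t powr (- 7 / 8) * N^2)^2"
        using Q by (simp add: C_def power_mult_distrib)
      finally show "4 * ?S * ?B * N^2 \<le> (C * t powr (- 7 / 8) * N^2)^2" .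
    qed
    finally show "(NN x. ennreal ((rho x powr m * flux_conv (exp (- t / 2)) i j w x)^2))
      \<le> ennreal ((C * t powr (- 7 / 8) * N^2)^2)"
      unfolding a_def \<epsilon>_def .
  qed
qed

section \<open>Dependence of the nonlinear term on time\<close>

lemma two_ennreal_sum3:
  "x \<ge> 0 \<Longrightarrow> y \<ge> 0 \<Longrightarrow> z \<ge> 0 \<Longrightarrow> 2 * (ennreal x + ennreal y + ennreal z) = ennreal (2 * (x + y + z))"
  by (simp add: ennreal_mult)

text \<open>
  The flux is a quadratic form in \<open>w\<close>: with \<open>d = w' - w\<close> the difference consists of the terms of
  bidegree \<open>(d, w)\<close>, \<open>(w, d)\<close> and \<open>(d, d)\<close>.
\<close>

lemma vort_flux_difference_L1:
  assumes m: "m > 3 / 2"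
  shows "\<exists>C\<ge>1. \<forall>w N w' D i j N'. weighted_bound m w N \<longrightarrow> weighted_bound m w' N' \<longrightarrow>
    weighted_bound m (\<lambda>x. w' x - w x) D \<longrightarrow>
    (NN x. ennreal \<bar>vort_flux i j w' x - vort_flux i j w x\<bar>) \<le> ennreal (C * D * (2 * N + D))"
proof -
  obtain C where C: "C \<ge> 1" "\<And>w N w' N'. weighted_bound m w N \<Longrightarrow> weighted_bound m w' N' \<Longrightarrow>
    (NN x. ennreal (norm (w x)) * riesz w' x) \<le> ennreal (C * N * N')"
    using field_times_riesz_bound[OF m] by blast
  show ?thesis
  proof (intro exI[of _ "2 * C"] conjI allI impI)
    show "2 * C \<ge> 1" using C(1) by simp
    fix w N w' D N' and i j :: 3
    assume w: "weighted_bound m w N" and w': "weighted_bound m w' N'" and d: "weighted_bound m (\<lambda>x. w' x - w x) D"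
    define d where "d x = w' x - w x" for x
    have d: "weighted_bound m d D" using d by (simp add: d_def[abs_def])
    note [measurable] = weighted_boundD(1)[OF w] weighted_boundD(1)[OF w'] weighted_boundD(1)[OF d]
    have N: "N \<ge> 0" "D \<ge> 0" by (rule weighted_boundD[OF w], rule weighted_boundD[OF d])
    let ?P = "\<lambda>f g x. ennreal (norm (f x)) * riesz g x"
    have "(NN x. ennreal \<bar>vort_flux i j w' x - vort_flux i j w x\<bar>)
       \<le> (NN x. 2 * (?P d w x + ?P d d x + ?P w d x))"
    proof (rule nn_integral_mono_AE)
      show "AE x in lborel. ennreal \<bar>vort_flux i j w' x - vort_flux i j w x\<bar> \<le> 2 * (?P d w x + ?P d d x + ?P w d x)"
        using biot_savart_diff_AE[OF w' w m]
      proof eventually_elim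
        case (elim x)
        define v where "v = biot_savart w x"
        define e where "e = biot_savart d x"
        have v': "biot_savart w' x = v + e"
          using elim by (simp add: v_def e_def d_def[abs_def])
        have w'x: "w' x = w x + d x" by (simp add: d_def)
        have eq: "vort_flux i j w' x - vort_flux i j w x
          = (d x $ j * v $ i + d x $ j * e $ i + w x $ j * e $ i) - (d x $ i * v $ j + d x $ i * e $ j + w x $ i * e $ j)"
          unfolding vort_flux_def v' w'x v_def[symmetric] by (simp add: algebra_simps)
        have p: "\<bar>a $ k * b $ l\<bar> \<le> norm a * norm b" for a b :: "real^3" and k l
          unfolding abs_mult by (intro mult_mono component_le_norm_cart) auto
        have "\<bar>vort_flux i j w' x - vort_flux i j w x\<bar> \<le> 2 * (norm (d x) * norm v + norm (d x) * norm e + norm (w x) * norm e)"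
          unfolding eq using p[of "d x" j v i] p[of "d x" j e i] p[of "w x" j e i] p[of "d x" i v j] p[of "d x" i e j] p[of "w x" i e j]
          unfolding abs_le_iff distrib_left by linarith
        then have "ennreal \<bar>vort_flux i j w' x - vort_flux i j w x\<bar>
          \<le> ennreal (2 * (norm (d x) * norm v + norm (d x) * norm e + norm (w x) * norm e))" by (rule ennreal_leI)
        also have "\<dots> = 2 * (ennreal (norm (d x)) * ennreal (norm v) + ennreal (norm (d x)) * ennreal (norm e) + ennreal (norm (w x)) * ennreal (norm e))"
          by (simp add: ennreal_mult ennreal_plus)
        also have "\<dots> \<le> 2 * (?P d w x + ?P d d x + ?P w d x)"
          unfolding v_def e_def by (intro mult_left_mono add_mono norm_biot_savart_le) auto
        finally show ?case .
      qed
    qed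
    also have "\<dots> = 2 * ((NN x. ?P d w x) + (NN x. ?P d d x) + (NN x. ?P w d x))"
      by (simp add: nn_integral_add nn_integral_cmult)
    also have "\<dots> \<le> 2 * (ennreal (C * D * N) + ennreal (C * D * D) + ennreal (C * N * D))"
      by (intro mult_left_mono add_mono C(2) w d) auto
    also have "\<dots> = ennreal (2 * (C * D * N + C * D * D + C * N * D))"
      using N C(1) by (intro two_ennreal_sum3) auto
    also have "2 * (C * D * N + C * D * D + C * N * D) = 2 * C * D * (2 * N + D)"
      by (simp add: algebra_simps)
    finally show "(NN x. ennreal \<bar>vort_flux i j w' x - vort_flux i j w x\<bar>) \<le> ennreal (2 * C * D * (2 * N + D))" .
  qed
qed

lemma heat_grad_convolution_tendsto:
  fixes F :: "real^3 \<Rightarrow> real" and Fn :: "nat \<Rightarrow> real^3 \<Rightarrow> real"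
  assumes a: "an \<longlonglongrightarrow> a" "a > 0" "\<And>n. an n > 0" and x: "xn \<longlonglongrightarrow> x" and c: "cn \<longlonglongrightarrow> c"
    and F: "integrable lborel F" "\<And>n. integrable lborel (Fn n)"
    and L1: "(\<lambda>n. LINT y|lborel. \<bar>Fn n y - F y\<bar>) \<longlonglongrightarrow> 0"
  shows "(\<lambda>n. LINT y|lborel. heat_grad (an n) u (xn n - cn n *\<^sub>R y) * Fn n y)
    \<longlonglongrightarrow> (LINT y|lborel. heat_grad a u (x - c *\<^sub>R y) * F y)"
proof -
  have [measurable]: "F \<in> borel_measurable borel" "Fn n \<in> borel_measurable borel" for n
    using F by auto
  define b where "b a = norm u * ((4 * pi * a) powr (- 3 / 2) * (1 + 4 * a) / (2 * a))" for a :: real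
  have b: "(\<lambda>n. b (an n)) \<longlonglongrightarrow> b a"
    unfolding b_def using a by (intro tendsto_intros) auto
  have b_bd: "\<bar>heat_grad (an n) u z\<bar> \<le> b (an n)" for n z
    unfolding b_def by (rule heat_grad_bounded[OF a(3)])
  obtain B where B: "\<And>n. \<bar>b (an n)\<bar> \<le> B"
    using convergent_imp_Bseq[of "\<lambda>n. b (an n)"] b by (auto simp: convergent_def Bseq_def)
  define k where "k n y = heat_grad (an n) u (xn n - cn n *\<^sub>R y)" for n y
  define k0 where "k0 y = heat_grad a u (x - c *\<^sub>R y)" for y
  have [measurable]: "k n \<in> borel_measurable borel" "k0 \<in> borel_measurable borel" for n
    unfolding k_def k0_def by measurable
  have k_int: "integrable lborel (\<lambda>y. k n y * f y)" if "integrable lborel f" for n f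
    by (rule integrable_bounded_mult[OF that]) (use b_bd in \<open>auto simp: k_def\<close>)
  have lim1: "(\<lambda>n. LINT y|lborel. k n y * (Fn n y - F y)) \<longlonglongrightarrow> 0"
  proof (rule Lim_null_comparison)
    show "\<forall>\<^sub>F n in sequentially. norm (LINT y|lborel. k n y * (Fn n y - F y)) \<le> B * (LINT y|lborel. \<bar>Fn n y - F y\<bar>)"
    proof (intro always_eventually allI)
      fix n
      have "norm (LINT y|lborel. k n y * (Fn n y - F y)) \<le> (LINT y|lborel. norm (k n y * (Fn n y - F y)))"
        by (rule integral_norm_bound)
      also have "\<dots> \<le> (LINT y|lborel. B * \<bar>Fn n y - F y\<bar>)"
      proof (rule integral_mono)
        show "integrable lborel (\<lambda>y. norm (k n y * (Fn n y - F y)))"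
          by (intro integrable_norm k_int Bochner_Integration.integrable_diff F)
        show "integrable lborel (\<lambda>y. B * \<bar>Fn n y - F y\<bar>)"
          by (intro integrable_mult_right integrable_abs Bochner_Integration.integrable_diff F)
        show "norm (k n y * (Fn n y - F y)) \<le> B * \<bar>Fn n y - F y\<bar>" for y
        proof -
          have "\<bar>k n y\<bar> \<le> B" using b_bd[of n] B[of n] unfolding k_def by (meson abs_le_iff order_trans)
          then show ?thesis unfolding real_norm_def abs_mult by (intro mult_right_mono) auto
        qed
      qed
      finally show "norm (LINT y|lborel. k n y * (Fn n y - F y)) \<le> B * (LINT y|lborel. \<bar>Fn n y - F y\<bar>)"
        by simp
    qed
    show "(\<lambda>n. B * (LINT y|lborel. \<bar>Fn n y - F y\<bar>)) \<longlonglongrightarrow> 0"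
      using tendsto_mult[OF tendsto_const[of B] L1] by simp
  qed
  have lim2: "(\<lambda>n. LINT y|lborel. k n y * F y) \<longlonglongrightarrow> (LINT y|lborel. k0 y * F y)"
  proof (rule integral_dominated_convergence)
    show "integrable lborel (\<lambda>y. B * \<bar>F y\<bar>)" using F(1) by simp
    show "AE y in lborel. (\<lambda>n. k n y * F y) \<longlonglongrightarrow> k0 y * F y"
    proof (intro always_eventually allI)
      fix y
      have z: "(\<lambda>n. xn n - cn n *\<^sub>R y) \<longlonglongrightarrow> x - c *\<^sub>R y"
        by (intro tendsto_intros x c)
      show "(\<lambda>n. k n y * F y) \<longlonglongrightarrow> k0 y * F y"
        unfolding k_def k0_def heat_grad_def heat_def using a
        by (intro tendsto_intros z) auto
    qed
    show "AE y in lborel. norm (k n y * F y) \<le> B * \<bar>F y\<bar>" for n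
    proof (intro always_eventually allI)
      fix y
      have "\<bar>k n y\<bar> \<le> B" using b_bd[of n] B[of n] unfolding k_def by (meson abs_le_iff order_trans)
      then show "norm (k n y * F y) \<le> B * \<bar>F y\<bar>"
        unfolding real_norm_def abs_mult by (intro mult_right_mono) auto
    qed
  qed measurable
  have "(LINT y|lborel. k n y * Fn n y) = (LINT y|lborel. k n y * (Fn n y - F y)) + (LINT y|lborel. k n y * F y)" for n
    using k_int[OF F(2)[of n], of n] k_int[OF F(1), of n]
    by (simp add: right_diff_distrib)
  then show ?thesis
    using tendsto_add[OF lim1 lim2] by (simp add: k_def k0_def)
qed

text \<open>
  The integrand of the mild equation. It is controlled for \<open>s < \<tau>\<close> only: at \<open>s = \<tau>\<close> the semigroup
  is the identity, and the flux may fail to be differentiable.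
\<close>

definition duhamel :: "(real \<Rightarrow> real^3 \<Rightarrow> real^3) \<Rightarrow> real \<Rightarrow> 3 \<Rightarrow> 3 \<Rightarrow> real \<Rightarrow> real^3 \<Rightarrow> real"
  where "duhamel w \<tau> i j s x = partial j (exp_Lambda_half (\<tau> - s) (vort_flux i j (w s))) x"

lemma weighted_norm_nonneg: "weighted_norm m w \<ge> 0"
  by (simp add: weighted_norm_def L2_norm_def)

text \<open>
  Continuity of the solution in the weighted norm makes the flux continuous in time with values in
  \<open>L\<^sup>1\<close>, and the kernel depends continuously on all its parameters as long as its width stays
  positive.
\<close>

lemma duhamel_continuous_on:
  assumes m: "m > 5 / 2" and w: "continuous_in_L2 m w"
  shows "continuous_on ({0..<\<tau>} \<times> UNIV) (\<lambda>(s, x). duhamel w \<tau> i j s x)"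
  unfolding continuous_on_sequentially
proof (intro allI ballI impI, elim conjE)
  fix p :: "nat \<Rightarrow> real \<times> (real^3)" and q
  assume q: "q \<in> {0..<\<tau>} \<times> UNIV" and p: "\<forall>n. p n \<in> {0..<\<tau>} \<times> UNIV" and lim: "p \<longlonglongrightarrow> q"
  have m32: "m > 3 / 2" using m by simp
  define s where "s = fst q"
  define x where "x = snd q"
  define sn where "sn n = fst (p n)" for n
  define xn where "xn n = snd (p n)" for n
  have s: "0 \<le> s" "s < \<tau>" and sn: "\<And>n. 0 \<le> sn n" "\<And>n. sn n < \<tau>"
    using q p by (auto simp: s_def sn_def mem_Times_iff)
  have slim: "sn \<longlonglongrightarrow> s" and xlim: "xn \<longlonglongrightarrow> x"
    unfolding sn_def s_def xn_def x_def by (intro tendsto_fst tendsto_snd lim)+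
  have sol: "w t \<in> solenoidal_L2 m" if "t \<ge> 0" for t
    using w that by (simp add: continuous_in_L2_def)
  have comp: "(\<lambda>\<xi>. w t \<xi> $ i) \<in> weighted_L2 m" if "t \<ge> 0" for t i
    using sol[OF that] by (simp add: solenoidal_L2_def)
  have wb: "weighted_bound m (w t) (weighted_norm m (w t))" if "t \<ge> 0" for t
    by (rule solenoidal_weighted_bound[OF sol[OF that]])
  define D where "D n = weighted_norm m (\<lambda>\<xi>. w (sn n) \<xi> - w s \<xi>)" for n
  have Db: "weighted_bound m (\<lambda>\<xi>. w (sn n) \<xi> - w s \<xi>) (D n)" for n
    unfolding D_def using weighted_L2_diff[OF comp[OF sn(1)[of n]] comp[OF s(1)]]
    by (intro weighted_bound_of_components) simp
  have Dlim: "D \<longlonglongrightarrow> 0"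
  proof -
    have "((\<lambda>t. weighted_norm m (\<lambda>\<xi>. w t \<xi> - w s \<xi>)) \<longlongrightarrow> 0) (at s within {0..})"
      using w s by (simp add: continuous_in_L2_def)
    moreover have "weighted_norm m (\<lambda>\<xi>. w s \<xi> - w s \<xi>) = 0"
      by (simp add: weighted_norm_def L2_norm_def)
    ultimately have "continuous (at s within {0..}) (\<lambda>t. weighted_norm m (\<lambda>\<xi>. w t \<xi> - w s \<xi>))"
      by (simp add: continuous_within)
    then show ?thesis
      unfolding continuous_within_sequentially D_def using sn slim
        \<open>weighted_norm m (\<lambda>\<xi>. w s \<xi> - w s \<xi>) = 0\<close>
      by (auto simp: comp_def)
  qed
  obtain C where C: "C \<ge> 1" "\<And>w N w' D i j N'. weighted_bound m w N \<Longrightarrow> weighted_bound m w' N' \<Longrightarrow>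
    weighted_bound m (\<lambda>x. w' x - w x) D \<Longrightarrow>
    (NN x. ennreal \<bar>vort_flux i j w' x - vort_flux i j w x\<bar>) \<le> ennreal (C * D * (2 * N + D))"
    using vort_flux_difference_L1[OF m32] by blast
  define N where "N = weighted_norm m (w s)"
  have D0: "D n \<ge> 0" for n by (simp add: D_def weighted_norm_nonneg)
  have N0: "N \<ge> 0" by (simp add: N_def weighted_norm_nonneg)
  have Fint: "integrable lborel (vort_flux i j (w t))" if "t \<ge> 0" for t
    by (rule vort_flux_integrable[OF wb[OF that] m32])
  have L1: "(\<lambda>n. LINT y|lborel. \<bar>vort_flux i j (w (sn n)) y - vort_flux i j (w s) y\<bar>) \<longlonglongrightarrow> 0"
  proof (rule Lim_null_comparison)
    show "\<forall>\<^sub>F n in sequentially. norm (LINT y|lborel. \<bar>vort_flux i j (w (sn n)) y - vort_flux i j (w s) y\<bar>) \<le> C * D n * (2 * N + D n)"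
    proof (intro always_eventually allI)
      fix n
      have int: "integrable lborel (\<lambda>y. \<bar>vort_flux i j (w (sn n)) y - vort_flux i j (w s) y\<bar>)"
        by (intro integrable_abs Bochner_Integration.integrable_diff Fint s sn)
      have "ennreal (LINT y|lborel. \<bar>vort_flux i j (w (sn n)) y - vort_flux i j (w s) y\<bar>) \<le> ennreal (C * D n * (2 * N + D n))"
        using C(2)[OF wb[OF s(1)] wb[OF sn(1)[of n]] Db[of n], where i=i and j=j] nn_integral_eq_integral[OF int] by (simp add: N_def)
      moreover have "0 \<le> C * D n * (2 * N + D n)" using C(1) D0 N0 by simp
      ultimately show "norm (LINT y|lborel. \<bar>vort_flux i j (w (sn n)) y - vort_flux i j (w s) y\<bar>) \<le> C * D n * (2 * N + D n)"
        by (simp add: ennreal_le_iff)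
    qed
    have "(\<lambda>n. C * D n * (2 * N + D n)) \<longlonglongrightarrow> C * 0 * (2 * N + 0)"
      by (intro tendsto_intros Dlim)
    then show "(\<lambda>n. C * D n * (2 * N + D n)) \<longlonglongrightarrow> 0" by simp
  qed
  define e where "e t = exp (- (\<tau> - t) / 2)" for t
  have e_lim: "(\<lambda>n. e (sn n)) \<longlonglongrightarrow> e s"
    unfolding e_def by (intro tendsto_intros slim) simp
  have a_pos: "1 - (e t)^2 > 0" if "t < \<tau>" for t
  proof -
    have "(e t)^2 = exp (- (\<tau> - t))"
      by (simp add: e_def power2_eq_square exp_add[symmetric])
    then show ?thesis using that by simp
  qed
  have eq: "duhamel w \<tau> i j t z = (e t)^2 * (LINT y|lborel. heat_grad (1 - (e t)^2) (axis j 1) (z - e t *\<^sub>R y) * vort_flux i j (w t) y)"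
    if "0 \<le> t" "t < \<tau>" for t z
    unfolding duhamel_def e_def using that by (intro partial_exp_Lambda_half Fint) auto
  have "(\<lambda>n. (e (sn n))^2 * (LINT y|lborel. heat_grad (1 - (e (sn n))^2) (axis j 1) (xn n - e (sn n) *\<^sub>R y) * vort_flux i j (w (sn n)) y))
     \<longlonglongrightarrow> (e s)^2 * (LINT y|lborel. heat_grad (1 - (e s)^2) (axis j 1) (x - e s *\<^sub>R y) * vort_flux i j (w s) y)"
    by (intro tendsto_mult tendsto_power e_lim heat_grad_convolution_tendsto tendsto_diff tendsto_const
        xlim Fint s sn L1 a_pos)
  then show "((\<lambda>(s, x). duhamel w \<tau> i j s x) \<circ> p) \<longlonglongrightarrow> (\<lambda>(s, x). duhamel w \<tau> i j s x) q"
    using eq[OF sn(1) sn(2)] eq[OF s] by (simp add: comp_def case_prod_beta sn_def xn_def s_def x_def)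
qed

text \<open>
  Measurability in both variables jointly, as needed to exchange the integrals over time and
  space.
\<close>

lemma duhamel_measurable:
  assumes "m > 5 / 2" "continuous_in_L2 m w"
  shows "(\<lambda>(s, x). indicator {0..<\<tau>} s * duhamel w \<tau> i j s x) \<in> borel_measurable (lborel \<Otimes>\<^sub>M lborel)"
proof -
  have "(\<lambda>z. indicator ({0..<\<tau>} \<times> UNIV) z *\<^sub>R (\<lambda>(s, x). duhamel w \<tau> i j s x) z)
      \<in> borel_measurable (borel :: (real \<times> (real^3)) measure)"
    by (rule borel_measurable_continuous_on_indicator[OF _ duhamel_continuous_on[OF assms]])
       (simp add: borel_Times)
  also have "(\<lambda>z. indicator ({0..<\<tau>} \<times> UNIV) z *\<^sub>R (\<lambda>(s, x). duhamel w \<tau> i j s x) z)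
      = (\<lambda>(s, x). indicator {0..<\<tau>} s * duhamel w \<tau> i j s x)"
    by (auto simp: fun_eq_iff indicator_def)
  finally show ?thesis
    by (simp add: borel_prod[symmetric] cong: measurable_cong_sets)
qed

text \<open>
  Minkowski's integral inequality, in the case where the norm of \<open>\<Phi> s\<close> is dominated by \<open>M \<beta> s\<close>
  with an explicit integrable \<open>\<beta>\<close>: Cauchy-Schwarz in time with weight \<open>\<beta>\<close>, applied to \<open>\<Phi> / \<beta>\<close>.
\<close>

lemma nn_Minkowski_weighted:
  fixes \<Phi> :: "real \<Rightarrow> real^3 \<Rightarrow> real" and \<beta> :: "real \<Rightarrow> real"
  assumes [measurable]: "case_prod \<Phi> \<in> borel_measurable (lborel \<Otimes>\<^sub>M lborel)" "\<beta> \<in> borel_measurable borel"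
    and \<beta>: "\<And>s. \<beta> s \<ge> 0" "\<And>s x. \<beta> s = 0 \<Longrightarrow> \<Phi> s x = 0"
    and \<Phi>: "\<And>s. (NN x. ennreal ((rho x powr m * \<Phi> s x)^2)) \<le> ennreal ((M * \<beta> s)^2)"
    and b: "(NN s. ennreal (\<beta> s)) \<le> ennreal b" "b \<ge> 0"
  shows "(NN x. (NN s. ennreal (rho x powr m * \<bar>\<Phi> s x\<bar>))^2) \<le> ennreal ((M * b)^2)"
proof -
  define g where "g s x = rho x powr m * \<bar>\<Phi> s x\<bar> / \<beta> s" for s x
  have [measurable]: "(\<lambda>(s, x). g s x) \<in> borel_measurable (lborel \<Otimes>\<^sub>M lborel)"
    unfolding g_def by measurable
  have g0: "g s x \<ge> 0" for s x using \<beta>(1)[of s] by (simp add: g_def)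
  have bg: "\<beta> s * g s x = rho x powr m * \<bar>\<Phi> s x\<bar>" for s x
    using \<beta>(2)[of s x] by (cases "\<beta> s = 0") (simp_all add: g_def)
  have "(NN x. (NN s. ennreal (rho x powr m * \<bar>\<Phi> s x\<bar>))^2)
     \<le> (NN x. (NN s. ennreal (\<beta> s) * (ennreal (g s x))^2) * ennreal b)"
  proof (rule nn_integral_mono)
    fix x
    have "(NN s. ennreal (rho x powr m * \<bar>\<Phi> s x\<bar>))^2 = (NN s. ennreal (\<beta> s) * ennreal (g s x) * 1)^2"
      using \<beta>(1) g0 by (simp add: bg[symmetric] ennreal_mult)
    also have "\<dots> \<le> (NN s. ennreal (\<beta> s) * (ennreal (g s x))^2) * (NN s. ennreal (\<beta> s) * 1^2)"
      by (rule weighted_Cauchy_Schwarz) measurable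
    also have "\<dots> \<le> (NN s. ennreal (\<beta> s) * (ennreal (g s x))^2) * ennreal b"
      using b by (intro mult_left_mono) auto
    finally show "(NN s. ennreal (rho x powr m * \<bar>\<Phi> s x\<bar>))^2
       \<le> (NN s. ennreal (\<beta> s) * (ennreal (g s x))^2) * ennreal b" .
  qed
  also have "\<dots> = (NN x. (NN s. ennreal (\<beta> s) * (ennreal (g s x))^2)) * ennreal b"
    by (rule nn_integral_multc) measurable
  also have "(NN x. (NN s. ennreal (\<beta> s) * (ennreal (g s x))^2))
      = (NN s. (NN x. ennreal (\<beta> s) * (ennreal (g s x))^2))"
    by (rule nn_Tonelli) measurable
  also have "\<dots> \<le> (NN s. ennreal (M^2) * ennreal (\<beta> s))"
  proof (rule nn_integral_mono)
    fix s
    show "(NN x. ennreal (\<beta> s) * (ennreal (g s x))^2) \<le> ennreal (M^2) * ennreal (\<beta> s)"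
    proof (cases "\<beta> s = 0")
      case False
      then have pos: "\<beta> s > 0" using \<beta>(1)[of s] by simp
      have "ennreal (\<beta> s) * (ennreal (g s x))^2 = ennreal (1 / \<beta> s) * ennreal ((rho x powr m * \<Phi> s x)^2)" for x
      proof -
        have "ennreal (\<beta> s) * (ennreal (g s x))^2 = ennreal (\<beta> s * (g s x)^2)"
          using pos g0 by (simp add: ennreal_power ennreal_mult)
        also have "\<beta> s * (g s x)^2 = 1 / \<beta> s * (rho x powr m * \<Phi> s x)^2"
          using pos by (simp add: g_def power_divide power_mult_distrib) (simp add: power2_eq_square)
        also have "ennreal \<dots> = ennreal (1 / \<beta> s) * ennreal ((rho x powr m * \<Phi> s x)^2)"
          using pos by (intro ennreal_mult) auto
        finally show ?thesis .
      qed
      then have "(NN x. ennreal (\<beta> s) * (ennreal (g s x))^2)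
          = ennreal (1 / \<beta> s) * (NN x. ennreal ((rho x powr m * \<Phi> s x)^2))"
        by (simp only:) (rule nn_integral_cmult, measurable)
      also have "\<dots> \<le> ennreal (1 / \<beta> s) * ennreal ((M * \<beta> s)^2)"
        by (intro mult_left_mono \<Phi>) simp
      also have "\<dots> = ennreal (1 / \<beta> s * (M * \<beta> s)^2)"
        using pos by (intro ennreal_mult[symmetric]) auto
      also have "1 / \<beta> s * (M * \<beta> s)^2 = M^2 * \<beta> s"
        using pos by (simp add: power2_eq_square)
      also have "ennreal (M^2 * \<beta> s) = ennreal (M^2) * ennreal (\<beta> s)"
        using pos by (intro ennreal_mult) auto
      finally show ?thesis .
    qed simp
  qed
  also have "\<dots> = ennreal (M^2) * (NN s. ennreal (\<beta> s))"
    by (rule nn_integral_cmult) measurable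
  finally have "(NN x. (NN s. ennreal (rho x powr m * \<bar>\<Phi> s x\<bar>))^2)
     \<le> ennreal (M^2) * (NN s. ennreal (\<beta> s)) * ennreal b"
    by (simp add: mult_right_mono)
  also have "\<dots> \<le> ennreal (M^2) * ennreal b * ennreal b"
    using b by (intro mult_right_mono mult_left_mono) auto
  also have "\<dots> = ennreal ((M * b)^2)"
  proof -
    have "ennreal (M^2) * ennreal b * ennreal b = ennreal (M^2 * b * b)"
      using b by (simp add: ennreal_mult)
    then show ?thesis by (simp add: power2_eq_square mult_ac)
  qed
  finally show ?thesis .
qed

section \<open>The time weight\<close>

text \<open>
  A majorant of the norm of the integrand of the mild equation at time \<open>s\<close>, up to constants; its
  integral is at most a constant times \<open>exp (- \<nu>\<tau>)\<close>. It is positive on \<open>[0, \<tau>)\<close> and vanishes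
  elsewhere, like that integrand restricted to \<open>[0, \<tau>)\<close>.
\<close>

definition time_weight :: "real \<Rightarrow> real \<Rightarrow> real \<Rightarrow> real"
  where "time_weight \<nu> \<tau> s = (if 0 \<le> s \<and> s < \<tau> then
    exp (- \<nu> * \<tau>) * ((if \<tau> - s \<le> 1 then exp 2 * (\<tau> - s) powr (- 7 / 8) else 0) + exp (- (s / 2))) else 0)"

lemma time_weight_integral:
  "(NN s. ennreal (time_weight \<nu> \<tau> s)) \<le> ennreal ((8 * exp 2 + 2) * exp (- \<nu> * \<tau>))"
proof -
  have I1: "(NN s. ennreal ((\<tau> - s) powr (- 7 / 8)) * indicator {0..1} (\<tau> - s)) = ennreal 8"
  proof -
    have "((\<lambda>x. x powr (- 7 / 8)) has_integral (1 powr (- 7 / 8 + 1) / (- 7 / 8 + 1))) {0..1::real}"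
      by (rule has_integral_powr_from_0) auto
    then have "((\<lambda>x. x powr (- 7 / 8)) has_integral 8) {0..1::real}" by simp
    then have "(NN x. ennreal (x powr (- 7 / 8)) * indicator {0..1} x) = ennreal 8"
      by (intro nn_integral_has_integral_lebesgue') auto
    moreover have "(NN x. ennreal (x powr (- 7 / 8)) * indicator {0..1} x)
       = ennreal \<bar>-1\<bar> * (NN s. ennreal ((\<tau> + (-1) * s) powr (- 7 / 8)) * indicator {0..1} (\<tau> + (-1) * s))"
      by (rule nn_integral_real_affine) auto
    ultimately show ?thesis by simp
  qed
  have I2: "(NN s. ennreal (exp (- (s / 2))) * indicator {0..} s) = ennreal 2"
    using has_integral_exp_minus_to_infinity[of "1/2" 0]
    by (intro nn_integral_has_integral_lebesgue') auto
  have "(NN s. ennreal (time_weight \<nu> \<tau> s))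
     \<le> (NN s. ennreal (exp (- \<nu> * \<tau>)) * (ennreal (exp 2) * (ennreal ((\<tau> - s) powr (- 7 / 8)) * indicator {0..1} (\<tau> - s))
          + ennreal (exp (- (s / 2))) * indicator {0..} s))"
    by (intro nn_integral_mono)
       (auto simp: time_weight_def indicator_def ennreal_mult[symmetric] ennreal_plus[symmetric] simp del: ennreal_plus)
  also have "\<dots> = ennreal (exp (- \<nu> * \<tau>)) * (ennreal (exp 2) * (NN s. ennreal ((\<tau> - s) powr (- 7 / 8)) * indicator {0..1} (\<tau> - s))
      + (NN s. ennreal (exp (- (s / 2))) * indicator {0..} s))"
    by (simp add: nn_integral_cmult nn_integral_add)
  also have "\<dots> = ennreal (exp (- \<nu> * \<tau>)) * (ennreal (exp 2) * ennreal 8 + ennreal 2)"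
    unfolding I1 I2 ..
  also have "\<dots> = ennreal (exp (- \<nu> * \<tau>) * (exp 2 * 8 + 2))"
    by (simp only: ennreal_mult ennreal_plus exp_ge_zero zero_le_numeral mult_nonneg_nonneg add_nonneg_nonneg)
  finally show ?thesis by (simp add: mult_ac)
qed

text \<open>
  The factor \<open>exp (- 2s)\<close> is the decay of the quadratic flux. If \<open>\<tau> - s \<le> 1\<close> then it is at most
  \<open>exp (2 - \<nu>\<tau>)\<close>; in general \<open>exp (- 2s) exp (- \<nu>(\<tau> - s)) = exp (- \<nu>\<tau>) exp (- (2 - \<nu>) s)\<close>, where
  \<open>2 - \<nu> \<ge> 1/2\<close>.
\<close>

lemma time_weight_lower:
  assumes \<nu>: "0 \<le> \<nu>" "\<nu> \<le> 3 / 2" and s: "0 \<le> s" "s < \<tau>"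
  shows "\<tau> - s \<le> 1 \<Longrightarrow> exp (- 2 * s) * (\<tau> - s) powr (- 7 / 8) \<le> time_weight \<nu> \<tau> s"
    and "exp (- 2 * s) * exp (- \<nu> * (\<tau> - s)) \<le> time_weight \<nu> \<tau> s"
proof -
  show "exp (- 2 * s) * exp (- \<nu> * (\<tau> - s)) \<le> time_weight \<nu> \<tau> s"
  proof -
    have "\<nu> * s \<le> 3 / 2 * s" using \<nu> s by (intro mult_right_mono) auto
    then have "- 2 * s + - \<nu> * (\<tau> - s) \<le> - \<nu> * \<tau> + - (s / 2)"
      by (simp add: algebra_simps)
    then have "exp (- 2 * s) * exp (- \<nu> * (\<tau> - s)) \<le> exp (- \<nu> * \<tau>) * exp (- (s / 2))"
      unfolding exp_add[symmetric] by simp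
    also have "\<dots> \<le> time_weight \<nu> \<tau> s"
      using s by (simp add: time_weight_def)
    finally show ?thesis .
  qed
  assume t: "\<tau> - s \<le> 1"
  show "exp (- 2 * s) * (\<tau> - s) powr (- 7 / 8) \<le> time_weight \<nu> \<tau> s"
  proof -
    have "\<nu> * \<tau> \<le> 2 * \<tau>" using \<nu> s by (intro mult_right_mono) auto
    then have "- 2 * s \<le> - \<nu> * \<tau> + 2" using t by simp
    then have "exp (- 2 * s) \<le> exp (- \<nu> * \<tau>) * exp 2"
      unfolding exp_add[symmetric] by simp
    then have "exp (- 2 * s) * (\<tau> - s) powr (- 7 / 8) \<le> exp (- \<nu> * \<tau>) * exp 2 * (\<tau> - s) powr (- 7 / 8)"
      by (rule mult_right_mono) simp
    also have "\<dots> \<le> time_weight \<nu> \<tau> s"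
      using s t by (simp add: time_weight_def mult.assoc)
    finally show ?thesis .
  qed
qed

section \<open>The linear part\<close>

lemma zeroth_moment_integrable:
  assumes b: "weighted_bound m w N" and m: "m > 3 / 2"
  shows "integrable lborel (\<lambda>y. w y $ k)"
proof (rule Bochner_Integration.integrable_bound)
  note [measurable] = weighted_boundD(1)[OF b]
  show "integrable lborel (\<lambda>x. rho x powr 0 * norm (w x))"
    by (rule weighted_moment_integrable[OF b]) (use m in simp)
  show "AE x in lborel. norm (w x $ k) \<le> norm (rho x powr 0 * norm (w x))"
    by (simp add: component_le_norm_cart)
  show "(\<lambda>y. w y $ k) \<in> borel_measurable lborel" by measurable
qed

lemma first_moment_integrable:
  assumes b: "weighted_bound m w N" and m: "m > 5 / 2"
  shows "integrable lborel (\<lambda>y. y $ l * w y $ k)"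
proof (rule Bochner_Integration.integrable_bound)
  note [measurable] = weighted_boundD(1)[OF b]
  show "integrable lborel (\<lambda>x. rho x powr 1 * norm (w x))"
    by (rule weighted_moment_integrable[OF b]) (use m in simp)
  have "\<bar>x $ l\<bar> * \<bar>w x $ k\<bar> \<le> rho x * norm (w x)" for x
    by (intro mult_mono component_le_rho component_le_norm_cart) auto
  then show "AE x in lborel. norm (x $ l * w x $ k) \<le> norm (rho x powr 1 * norm (w x))"
    by (simp add: abs_mult)
  have [measurable]: "(\<lambda>x::real^3. x $ l) \<in> borel_measurable borel"
    by (rule measurable_component) simp
  show "(\<lambda>x. x $ l * w x $ k) \<in> borel_measurable lborel" by measurable
qed

text \<open>
  The profile is the first order Taylor term of the Gaussian: by antisymmetry of the matrix of
  first moments, its three independent entries are the numbers \<open>first_moment k w\<close>, and applying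
  the matrix to \<open>x\<close> is a cross product.
\<close>

lemma profile_component:
  assumes sol: "w \<in> solenoidal_L2 m" and m: "m > 5 / 2"
  shows "(\<Sum>k\<in>UNIV. first_moment k w *\<^sub>R f_field k x) $ i = gaussian x / 2 * (LINT y|lborel. (x \<bullet> y) * w y $ i)"
proof -
  note b = solenoidal_weighted_bound[OF sol]
  note [measurable] = weighted_boundD(1)[OF b]
  define M where "M l k = (LINT y|lborel. y $ l * w y $ k)" for l k
  have int: "integrable lborel (\<lambda>y. y $ l * w y $ k)" for l k
    by (rule first_moment_integrable[OF b]) (use m in simp)
  have anti: "M l k = - M k l" for l k
    unfolding M_def by (rule solenoidal_first_moments_antisym[OF sol m])
  have diag: "M l l = 0" for l using anti[of l l] by simp
  have half: "first_moment k w = (1 / 2) * (M l l' - M l' l)"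
    if "\<And>y. p_field k y \<bullet> w y = (1 / 2) * (y $ l * w y $ l' - y $ l' * w y $ l)" for k l l'
    unfolding first_moment_def that M_def using int[of l l'] int[of l' l] by simp
  have "p_field 1 y \<bullet> v = (1 / 2) * (y $ 2 * v $ 3 - y $ 3 * v $ 2)" for y v
    by (simp add: p_field_def cross3_def axis_def inner_vec_def sum_3)
  from half[OF this] have b1: "first_moment 1 w = M 2 3" using anti[of 3 2] by simp
  have "p_field 2 y \<bullet> v = (1 / 2) * (y $ 3 * v $ 1 - y $ 1 * v $ 3)" for y v
    by (simp add: p_field_def cross3_def axis_def inner_vec_def sum_3)
  from half[OF this] have b2: "first_moment 2 w = M 3 1" using anti[of 1 3] by simp
  have "p_field 3 y \<bullet> v = (1 / 2) * (y $ 1 * v $ 2 - y $ 2 * v $ 1)" for y v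
    by (simp add: p_field_def cross3_def axis_def inner_vec_def sum_3)
  from half[OF this] have b3: "first_moment 3 w = M 1 2" using anti[of 2 1] by simp
  have "(LINT y|lborel. (x \<bullet> y) * w y $ i) = (LINT y|lborel. x $ 1 * (y $ 1 * w y $ i) + x $ 2 * (y $ 2 * w y $ i) + x $ 3 * (y $ 3 * w y $ i))"
    by (simp add: inner_vec_def sum_3 algebra_simps)
  also have "\<dots> = x $ 1 * M 1 i + x $ 2 * M 2 i + x $ 3 * M 3 i"
    unfolding M_def using int by simp
  finally have rhs: "(LINT y|lborel. (x \<bullet> y) * w y $ i) = x $ 1 * M 1 i + x $ 2 * M 2 i + x $ 3 * M 3 i" .
  have lhs: "(\<Sum>k\<in>UNIV. first_moment k w *\<^sub>R f_field k x) $ i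
     = gaussian x * (M 2 3 * p_field 1 x $ i + M 3 1 * p_field 2 x $ i + M 1 2 * p_field 3 x $ i)"
    by (simp add: sum_3 f_field_eq b1 b2 b3 algebra_simps)
  show ?thesis
    unfolding lhs rhs
    using exhaust_3[of i] diag anti[of 2 1] anti[of 3 2] anti[of 1 3]
    by (auto simp: p_field_def cross3_def axis_def algebra_simps)
qed

text \<open>
  Integrated against \<open>w\<close>, the zeroth order term of the kernel vanishes and the first order term is
  the profile.
\<close>

lemma linear_part_eq:
  assumes sol: "w \<in> solenoidal_L2 m" and m: "m > 5 / 2" and t: "\<tau> > 0"
  defines "\<epsilon> \<equiv> exp (- \<tau> / 2)"
  shows "exp_Lambda \<tau> (\<lambda>\<eta>. w \<eta> $ i) x - (\<Sum>k\<in>UNIV. (first_moment k w * exp (- \<tau>)) *\<^sub>R f_field k x) $ i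
    = \<epsilon> * (LINT y|lborel. heat_remainder \<epsilon> x y * w y $ i)"
proof -
  note b = solenoidal_weighted_bound[OF sol]
  note [measurable] = weighted_boundD(1)[OF b]
  have e2: "\<epsilon>^2 = exp (- \<tau>)"
    by (simp add: \<epsilon>_def power2_eq_square exp_add[symmetric])
  have a: "1 - \<epsilon>^2 > 0" unfolding e2 using t by simp
  have int0: "integrable lborel (\<lambda>y. w y $ i)"
    by (rule zeroth_moment_integrable[OF b]) (use m in simp)
  have int1: "integrable lborel (\<lambda>y. (x \<bullet> y) * w y $ i)"
  proof -
    have "integrable lborel (\<lambda>y. \<Sum>l\<in>UNIV. x $ l * (y $ l * w y $ i))"
      by (intro Bochner_Integration.integrable_sum integrable_mult_right first_moment_integrable[OF b]) (use m in simp)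
    then show ?thesis by (simp add: inner_vec_def sum_distrib_right mult.assoc)
  qed
  have intH: "integrable lborel (\<lambda>y. heat (1 - \<epsilon>^2) (x - \<epsilon> *\<^sub>R y) * w y $ i)"
    by (rule integrable_bounded_mult[OF int0 _ heat_bounded[OF a]]) measurable
  have split: "heat_remainder \<epsilon> x y * w y $ i
      = heat (1 - \<epsilon>^2) (x - \<epsilon> *\<^sub>R y) * w y $ i - heat (1 - \<epsilon>^2) x * w y $ i - (\<epsilon> / 2 * heat 1 x) * ((x \<bullet> y) * w y $ i)" for y
    by (simp add: algebra_simps)
  have "(LINT y|lborel. heat_remainder \<epsilon> x y * w y $ i)
     = (LINT y|lborel. heat (1 - \<epsilon>^2) (x - \<epsilon> *\<^sub>R y) * w y $ i) - heat (1 - \<epsilon>^2) x * (LINT y|lborel. w y $ i)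
       - (\<epsilon> / 2 * heat 1 x) * (LINT y|lborel. (x \<bullet> y) * w y $ i)"
    unfolding split
    by (simp only: Bochner_Integration.integral_diff[OF Bochner_Integration.integrable_diff[OF intH integrable_mult_right[OF int0]] integrable_mult_right[OF int1]]
        Bochner_Integration.integral_diff[OF intH integrable_mult_right[OF int0]] integral_mult_right_zero)
  also have "(LINT y|lborel. w y $ i) = 0" by (rule solenoidal_mean_zero[OF sol m])
  finally have R: "(LINT y|lborel. heat_remainder \<epsilon> x y * w y $ i)
     = (LINT y|lborel. heat (1 - \<epsilon>^2) (x - \<epsilon> *\<^sub>R y) * w y $ i) - (\<epsilon> / 2 * heat 1 x) * (LINT y|lborel. (x \<bullet> y) * w y $ i)"
    by simp
  have P: "(\<Sum>k\<in>UNIV. (first_moment k w * exp (- \<tau>)) *\<^sub>R f_field k x) $ i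
     = \<epsilon> * ((\<epsilon> / 2 * heat 1 x) * (LINT y|lborel. (x \<bullet> y) * w y $ i))"
  proof -
    have "(\<Sum>k\<in>UNIV. (first_moment k w * exp (- \<tau>)) *\<^sub>R f_field k x) $ i
        = exp (- \<tau>) * (\<Sum>k\<in>UNIV. first_moment k w *\<^sub>R f_field k x) $ i"
      by (simp add: sum_distrib_left mult_ac)
    then show ?thesis
      unfolding profile_component[OF sol m] heat_1 e2[symmetric] by (simp add: power2_eq_square)
  qed
  have E: "exp_Lambda \<tau> (\<lambda>\<eta>. w \<eta> $ i) x = \<epsilon> * (LINT y|lborel. heat (1 - \<epsilon>^2) (x - \<epsilon> *\<^sub>R y) * w y $ i)"
    unfolding \<epsilon>_def by (rule exp_Lambda_eq) (use t in auto)
  show ?thesis unfolding R P E by (simp add: right_diff_distrib)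
qed

lemma weighted_norm_le:
  assumes "(NN x. ennreal ((rho x powr m * norm (g x))^2)) \<le> ennreal (B^2)" "B \<ge> 0"
  shows "weighted_norm m g \<le> B"
proof -
  let ?f = "\<lambda>x. (norm (rho x powr m *\<^sub>R g x))^2"
  have "ennreal \<bar>LINT x|lborel. ?f x\<bar> \<le> (NN x. ennreal \<bar>?f x\<bar>)"
    by (rule ennreal_abs_integral_le)
  also have "\<dots> \<le> ennreal (B^2)" using assms(1) by simp
  finally have "(LINT x|lborel. ?f x) \<le> B^2"
    by (simp add: ennreal_le_iff)
  then show ?thesis
    unfolding weighted_norm_def L2_norm_def using assms(2) by (intro real_le_lsqrt) auto
qed

lemma norm_p_field_le: "norm (p_field k x) \<le> norm x"
proof -
  have "norm (cross3 (axis k 1) x) \<le> 1 * norm x"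
    using norm_cross3_le[of "axis k 1" x] by simp
  moreover have "norm (p_field k x) = norm (cross3 (axis k 1) x) / 2" by (simp add: p_field_def)
  moreover have "0 \<le> norm (cross3 (axis k 1) x)" by simp
  ultimately show ?thesis by linarith
qed

lemma profile_bound:
  assumes m: "m > 5 / 2"
  shows "\<exists>C\<ge>1. \<forall>w N \<tau> x. weighted_bound m w N \<longrightarrow> \<tau> \<ge> 0 \<longrightarrow>
    rho x powr m * norm (\<Sum>k\<in>UNIV. (first_moment k w * exp (- \<tau>)) *\<^sub>R f_field k x) \<le> C * N * rho x powr (-2)"
proof -
  have "2 * (m - 1) > 3" using m by simp
  from weighted_moment_bound[OF this] obtain C1 where C1: "C1 \<ge> 1" "\<And>w N. weighted_bound m w N \<Longrightarrow>
    (NN x. ennreal (rho x powr 1 * norm (w x))) \<le> ennreal (C1 * N)" by blast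
  define A where "A = exp ((m + 2 + 2)^2)"
  have A: "A \<ge> 1" by (simp add: A_def)
  have C_ge: "3 * C1 * A \<ge> 1" using C1(1) A by (intro mult_ge1_I) auto
  show ?thesis
  proof (intro exI[of _ "3 * C1 * A"] conjI allI impI C_ge)
    fix w and N \<tau> :: real and x
    assume w: "weighted_bound m w N" and t: "\<tau> \<ge> 0"
    have N: "N \<ge> 0" by (rule weighted_boundD[OF w])
    have fm: "\<bar>first_moment k w\<bar> \<le> C1 * N" for k
    proof -
      have "ennreal \<bar>first_moment k w\<bar> \<le> (NN x. ennreal \<bar>p_field k x \<bullet> w x\<bar>)"
        unfolding first_moment_def by (rule ennreal_abs_integral_le)
      also have "\<dots> \<le> (NN x. ennreal (rho x powr 1 * norm (w x)))"
      proof (intro nn_integral_mono ennreal_leI)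
        fix x
        have "\<bar>p_field k x \<bullet> w x\<bar> \<le> norm (p_field k x) * norm (w x)" by (rule Cauchy_Schwarz_ineq2)
        also have "\<dots> \<le> rho x powr 1 * norm (w x)"
          using norm_p_field_le[of k x] by (intro mult_right_mono) (auto simp: rho_def intro: order_trans)
        finally show "\<bar>p_field k x \<bullet> w x\<bar> \<le> rho x powr 1 * norm (w x)" .
      qed
      also have "\<dots> \<le> ennreal (C1 * N)" by (rule C1(2)[OF w])
      finally show ?thesis using C1(1) N by (simp add: ennreal_le_iff)
    qed
    have f: "norm (f_field k x) \<le> A * rho x powr (- (m + 2))" for k
    proof -
      have "norm x \<le> (norm x)^2 + 1"
        using zero_le_power2[of "norm x - 1/2"] by (simp add: power2_eq_square algebra_simps)
      then have p: "norm (p_field k x) \<le> (norm x)^2 + 1" using norm_p_field_le[of k x] by linarith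
      have "norm (f_field k x) = heat 1 x * norm (p_field k x)"
        using heat_nonneg[of 1 x] by (simp add: f_field_eq heat_1)
      also have "\<dots> \<le> heat 1 x * ((norm x)^2 + 1)"
        by (intro mult_left_mono p heat_nonneg)
      also have "\<dots> \<le> A * rho x powr (- (m + 2))"
        unfolding A_def mult.commute[of "heat 1 x"] by (rule quadratic_heat_le) (use m in auto)
      finally show ?thesis .
    qed
    have each: "norm ((first_moment k w * exp (- \<tau>)) *\<^sub>R f_field k x) \<le> (C1 * N) * (A * rho x powr (- (m + 2)))" for k
    proof -
      have "\<bar>first_moment k w * exp (- \<tau>)\<bar> \<le> (C1 * N) * 1"
        unfolding abs_mult using fm[of k] t by (intro mult_mono) auto
      then show ?thesis unfolding norm_scaleR using f[of k] by (intro mult_mono) auto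
    qed
    have "norm (\<Sum>k\<in>UNIV. (first_moment k w * exp (- \<tau>)) *\<^sub>R f_field k x)
        \<le> (\<Sum>k\<in>(UNIV :: 3 set). (C1 * N) * (A * rho x powr (- (m + 2))))"
      by (intro order_trans[OF norm_sum] sum_mono each)
    also have "\<dots> = 3 * C1 * A * N * rho x powr (- (m + 2))" by simp
    finally have "rho x powr m * norm (\<Sum>k\<in>UNIV. (first_moment k w * exp (- \<tau>)) *\<^sub>R f_field k x)
        \<le> rho x powr m * (3 * C1 * A * N * rho x powr (- (m + 2)))"
      by (rule mult_left_mono) simp
    also have "\<dots> = 3 * C1 * A * N * (rho x powr m * rho x powr (- (m + 2)))" by (simp only: mult_ac)
    finally show "rho x powr m * norm (\<Sum>k\<in>UNIV. (first_moment k w * exp (- \<tau>)) *\<^sub>R f_field k x)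
        \<le> 3 * C1 * A * N * rho x powr (-2)"
      unfolding weighted_powr_cancel .
  qed
qed

section \<open>The nonlinear part\<close>

text \<open>
  Both estimates of the flux, times the factor \<open>\<epsilon>^2\<close> of the semigroup and with
  \<open>weighted_norm m (w s) \<le> K exp (- s)\<close>, are dominated by the time weight; then Minkowski's
  inequality applies.
\<close>

lemma duhamel_estimate:
  assumes m: "m > 5 / 2" and \<nu>: "1 < \<nu>" "\<nu> \<le> 3 / 2"
  shows "\<exists>C\<ge>1. \<forall>w \<tau> i j K. continuous_in_L2 m w \<longrightarrow> (\<forall>s\<ge>0. weighted_norm m (w s) \<le> K * exp (- s)) \<longrightarrow>
    (NN x. (NN s. ennreal (rho x powr m * \<bar>indicator {0..<\<tau>} s * duhamel w \<tau> i j s x\<bar>))^2)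
    \<le> ennreal ((C * K^2 * exp (- \<nu> * \<tau>))^2)"
proof -
  have p: "0 \<le> 2 * \<nu> - 2" "2 * \<nu> - 2 \<le> 1" using \<nu> by auto
  have m32: "m > 3 / 2" using m by simp
  obtain C1 where C1: "C1 \<ge> 1" "\<And>w \<epsilon> i j. w \<in> solenoidal_L2 m \<Longrightarrow> 0 < \<epsilon> \<Longrightarrow> \<epsilon>^2 \<le> 1 / 2 \<Longrightarrow>
    (NN x. ennreal ((rho x powr m * flux_conv \<epsilon> i j w x)^2))
    \<le> ennreal ((C1 * \<epsilon> powr (2 * \<nu> - 2) * (weighted_norm m w)^2)^2)"
    using flux_long_time_estimate[OF m p] by blast
  obtain C2 where C2: "C2 \<ge> 1" "\<And>w N t i j. weighted_bound m w N \<Longrightarrow> 0 < t \<Longrightarrow> t \<le> 1 \<Longrightarrow>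
    (NN x. ennreal ((rho x powr m * flux_conv (exp (- t / 2)) i j w x)^2))
    \<le> ennreal ((C2 * t powr (- 7 / 8) * N^2)^2)"
    using flux_short_time_estimate[OF m] by blast
  define B where "B = 8 * exp 2 + (2::real)"
  have B: "B \<ge> 1" unfolding B_def by (simp add: add_increasing)
  define C where "C = (C1 + C2) * B"
  have C_ge: "C \<ge> 1" unfolding C_def using C1(1) C2(1) B by (intro mult_ge1_I) auto
  show ?thesis
  proof (intro exI[of _ C] conjI allI impI C_ge)
    fix w and \<tau> K :: real and i j :: 3
    assume w: "continuous_in_L2 m w" and K: "\<forall>s\<ge>0. weighted_norm m (w s) \<le> K * exp (- s)"
    have sol: "w s \<in> solenoidal_L2 m" if "s \<ge> 0" for s
      using w that by (simp add: continuous_in_L2_def)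
    have wb: "weighted_bound m (w s) (weighted_norm m (w s))" if "s \<ge> 0" for s
      by (rule solenoidal_weighted_bound[OF sol[OF that]])
    have n2: "(weighted_norm m (w s))^2 \<le> K^2 * exp (- 2 * s)" if "s \<ge> 0" for s
    proof -
      have "(weighted_norm m (w s))^2 \<le> (K * exp (- s))^2"
        using K that by (intro power_mono weighted_norm_nonneg) auto
      also have "\<dots> = K^2 * exp (- 2 * s)"
        by (simp add: power_mult_distrib power2_eq_square[of "exp _"] exp_add[symmetric])
      finally show ?thesis .
    qed
    define e where "e s = exp (- (\<tau> - s) / 2)" for s
    have e2: "(e s)^2 = exp (- (\<tau> - s))" for s
      by (simp add: e_def power2_eq_square exp_add[symmetric])
    have eq: "duhamel w \<tau> i j s x = (e s)^2 * (LINT y|lborel. heat_grad (1 - (e s)^2) (axis j 1) (x - e s *\<^sub>R y) * vort_flux i j (w s) y)"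
      if "0 \<le> s" "s < \<tau>" for s x
      unfolding duhamel_def e_def using that
      by (intro partial_exp_Lambda_half vort_flux_integrable[OF wb m32]) auto
    define I where "I s x = (LINT y|lborel. heat_grad (1 - (e s)^2) (axis j 1) (x - e s *\<^sub>R y) * vort_flux i j (w s) y)" for s x
    have eqI: "duhamel w \<tau> i j s x = (e s)^2 * I s x" if "0 \<le> s" "s < \<tau>" for s x
      unfolding I_def by (rule eq[OF that])
    \<comment> \<open>Reduction to the convolution \<open>I\<close>, which lacks the factor \<open>(e s)^2\<close> of the semigroup.\<close>
    have scale: "(NN x. ennreal ((rho x powr m * (indicator {0..<\<tau>} s * duhamel w \<tau> i j s x))^2)) \<le> ennreal ((c * Y)^2)"
      if s: "0 \<le> s" "s < \<tau>" and bd: "(NN x. ennreal ((rho x powr m * I s x)^2)) \<le> ennreal (X^2)"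
        and X: "0 \<le> X" "(e s)^2 * X \<le> c * Y" for s X c Y
    proof -
      have "(NN x. ennreal ((rho x powr m * (indicator {0..<\<tau>} s * duhamel w \<tau> i j s x))^2))
          \<le> (NN x. ennreal (((e s)^2)^2) * ennreal ((rho x powr m * I s x)^2))"
        using s by (intro nn_integral_mono) (simp add: eqI ennreal_mult[symmetric] power_mult_distrib mult_ac)
      also have "\<dots> = ennreal (((e s)^2)^2) * (NN x. ennreal ((rho x powr m * I s x)^2))"
      proof (rule nn_integral_cmult)
        note [measurable] = weighted_boundD(1)[OF wb[OF s(1)]]
        have [measurable]: "I s \<in> borel_measurable borel" unfolding I_def by measurable
        show "(\<lambda>x. ennreal ((rho x powr m * I s x)^2)) \<in> borel_measurable lborel" by measurable
      qed
      also have "\<dots> \<le> ennreal (((e s)^2)^2) * ennreal (X^2)"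
        by (intro mult_left_mono bd) simp
      also have "\<dots> = ennreal (((e s)^2 * X)^2)"
        by (simp only: power_mult_distrib ennreal_mult[OF zero_le_power2 zero_le_power2])
      also have "\<dots> \<le> ennreal ((c * Y)^2)"
        using X by (intro ennreal_leI power_mono) auto
      finally show ?thesis .
    qed
    have "(NN x. (NN s. ennreal (rho x powr m * \<bar>indicator {0..<\<tau>} s * duhamel w \<tau> i j s x\<bar>))^2)
      \<le> ennreal ((((C1 + C2) * K^2) * (B * exp (- \<nu> * \<tau>)))^2)"
    proof (rule nn_Minkowski_weighted[where \<beta>="time_weight \<nu> \<tau>"])
      show "(\<lambda>(s, x). indicator {0..<\<tau>} s * duhamel w \<tau> i j s x) \<in> borel_measurable (lborel \<Otimes>\<^sub>M lborel)"
        by (rule duhamel_measurable[OF m w])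
      show "time_weight \<nu> \<tau> \<in> borel_measurable borel"
        unfolding time_weight_def by measurable
      show "time_weight \<nu> \<tau> s \<ge> 0" for s
        by (auto simp: time_weight_def)
      show "indicator {0..<\<tau>} s * duhamel w \<tau> i j s x = 0" if "time_weight \<nu> \<tau> s = 0" for s x
      proof -
        have "\<not> (0 \<le> s \<and> s < \<tau>)"
        proof
          assume s: "0 \<le> s \<and> s < \<tau>"
          have "0 < exp (- \<nu> * \<tau>) * ((if \<tau> - s \<le> 1 then exp 2 * (\<tau> - s) powr (- 7 / 8) else 0) + exp (- (s / 2)))"
            by (intro mult_pos_pos add_nonneg_pos) auto
          then show False using that s by (simp add: time_weight_def split: if_splits)
        qed
        then show ?thesis by auto
      qed
      show "(NN s. ennreal (time_weight \<nu> \<tau> s)) \<le> ennreal (B * exp (- \<nu> * \<tau>))"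
        unfolding B_def by (rule time_weight_integral)
      show "0 \<le> B * exp (- \<nu> * \<tau>)" using B by simp
      show "(NN x. ennreal ((rho x powr m * (indicator {0..<\<tau>} s * duhamel w \<tau> i j s x))^2))
          \<le> ennreal (((C1 + C2) * K^2 * time_weight \<nu> \<tau> s)^2)" for s
      proof (cases "0 \<le> s \<and> s < \<tau>")
        case False
        then have "indicator {0..<\<tau>} s = (0::real)" by auto
        then show ?thesis by simp
      next
        case True
        then have s: "0 \<le> s" "s < \<tau>" by auto
        define n where "n = weighted_norm m (w s)"
        have n: "n^2 \<le> K^2 * exp (- 2 * s)" unfolding n_def by (rule n2[OF s(1)])
        have tw: "time_weight \<nu> \<tau> s \<ge> 0" by (auto simp: time_weight_def)
        show ?thesis
        proof (cases "\<tau> - s \<le> 1")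
          case True
          show ?thesis
          proof (rule scale[OF s])
            show "(NN x. ennreal ((rho x powr m * I s x)^2)) \<le> ennreal ((C2 * (\<tau> - s) powr (- 7 / 8) * n^2)^2)"
              unfolding I_def e_def n_def using s True by (intro C2(2) wb) auto
            show "0 \<le> C2 * (\<tau> - s) powr (- 7 / 8) * n^2" using C2(1) by simp
            have "(e s)^2 * (C2 * (\<tau> - s) powr (- 7 / 8) * n^2) \<le> 1 * (C2 * (\<tau> - s) powr (- 7 / 8) * n^2)"
              unfolding e2 using s C2(1) by (intro mult_right_mono) auto
            also have "\<dots> \<le> C2 * (\<tau> - s) powr (- 7 / 8) * (K^2 * exp (- 2 * s))"
              using n C2(1) by (simp add: mult_left_mono)
            also have "\<dots> = C2 * K^2 * (exp (- 2 * s) * (\<tau> - s) powr (- 7 / 8))" by (simp only: mult_ac)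
            also have "\<dots> \<le> C2 * K^2 * time_weight \<nu> \<tau> s"
              using C2(1) \<nu> s True by (intro mult_left_mono time_weight_lower(1)) auto
            also have "\<dots> \<le> (C1 + C2) * K^2 * time_weight \<nu> \<tau> s"
              using C1(1) tw by (intro mult_right_mono) auto
            finally show "(e s)^2 * (C2 * (\<tau> - s) powr (- 7 / 8) * n^2) \<le> (C1 + C2) * K^2 * time_weight \<nu> \<tau> s" .
          qed
        next
          case False
          have half: "(e s)^2 \<le> 1 / 2"
          proof -
            have "2 \<le> exp (1::real)" using exp_ge_add_one_self[of 1] by simp
            also have "\<dots> \<le> exp (\<tau> - s)" using False by simp
            finally have "inverse (exp (\<tau> - s)) \<le> inverse 2" by (intro le_imp_inverse_le) auto
            then show ?thesis unfolding e2 exp_minus by simp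
          qed
          show ?thesis
          proof (rule scale[OF s])
            show "(NN x. ennreal ((rho x powr m * I s x)^2)) \<le> ennreal ((C1 * e s powr (2 * \<nu> - 2) * n^2)^2)"
              unfolding I_def n_def using half by (intro C1(2) sol s) (auto simp: e_def)
            show "0 \<le> C1 * e s powr (2 * \<nu> - 2) * n^2" using C1(1) by simp
            have "(e s)^2 * e s powr (2 * \<nu> - 2) = exp (- \<nu> * (\<tau> - s))"
              unfolding e2 by (simp add: e_def powr_def exp_add[symmetric] field_simps)
            then have "(e s)^2 * (C1 * e s powr (2 * \<nu> - 2) * n^2) = C1 * exp (- \<nu> * (\<tau> - s)) * n^2"
              by (simp add: mult_ac)
            also have "\<dots> \<le> C1 * exp (- \<nu> * (\<tau> - s)) * (K^2 * exp (- 2 * s))"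
              using n C1(1) by (intro mult_left_mono) auto
            also have "\<dots> = C1 * K^2 * (exp (- 2 * s) * exp (- \<nu> * (\<tau> - s)))" by (simp only: mult_ac)
            also have "\<dots> \<le> C1 * K^2 * time_weight \<nu> \<tau> s"
              using C1(1) \<nu> s by (intro mult_left_mono time_weight_lower(2)) auto
            also have "\<dots> \<le> (C1 + C2) * K^2 * time_weight \<nu> \<tau> s"
              using C2(1) tw by (intro mult_right_mono) auto
            finally show "(e s)^2 * (C1 * e s powr (2 * \<nu> - 2) * n^2) \<le> (C1 + C2) * K^2 * time_weight \<nu> \<tau> s" .
          qed
        qed
      qed
    qed
    also have "(C1 + C2) * K^2 * (B * exp (- \<nu> * \<tau>)) = C * K^2 * exp (- \<nu> * \<tau>)"
      by (simp add: C_def mult_ac)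
    finally show "(NN x. (NN s. ennreal (rho x powr m * \<bar>indicator {0..<\<tau>} s * duhamel w \<tau> i j s x\<bar>))^2)
      \<le> ennreal ((C * K^2 * exp (- \<nu> * \<tau>))^2)" .
  qed
qed

text \<open>
  The endpoint \<open>s = \<tau>\<close>, at which nothing is known about the integrand, is a null set.
\<close>

lemma duhamel_integral_le:
  "ennreal (rho x powr m * \<bar>LINT s:{0..\<tau>}|lborel. duhamel w \<tau> i j s x\<bar>)
    \<le> (NN s. ennreal (rho x powr m * \<bar>indicator {0..<\<tau>} s * duhamel w \<tau> i j s x\<bar>))"
proof -
  have "rho x powr m * \<bar>LINT s:{0..\<tau>}|lborel. duhamel w \<tau> i j s x\<bar>
      = \<bar>LINT s|lborel. rho x powr m * (indicator {0..\<tau>} s * duhamel w \<tau> i j s x)\<bar>"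
    unfolding set_lebesgue_integral_def by (simp add: abs_mult)
  also have "ennreal \<dots> \<le> (NN s. ennreal \<bar>rho x powr m * (indicator {0..\<tau>} s * duhamel w \<tau> i j s x)\<bar>)"
    by (rule ennreal_abs_integral_le)
  also have "\<dots> = (NN s. ennreal (rho x powr m * \<bar>indicator {0..<\<tau>} s * duhamel w \<tau> i j s x\<bar>))"
  proof (rule nn_integral_cong_AE)
    have "AE s in lborel. s \<noteq> \<tau>" by (rule AE_lborel_singleton)
    then show "AE s in lborel. ennreal \<bar>rho x powr m * (indicator {0..\<tau>} s * duhamel w \<tau> i j s x)\<bar>
        = ennreal (rho x powr m * \<bar>indicator {0..<\<tau>} s * duhamel w \<tau> i j s x\<bar>)"
      by eventually_elim (auto simp: indicator_def abs_mult)
  qed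
  finally show ?thesis .
qed

lemma ennreal_sum3_square_le: "(\<Sum>i\<in>(UNIV::3 set). f i)^2 \<le> 4 * (\<Sum>i\<in>UNIV. (f i :: ennreal)^2)"
proof -
  have "(f 1 + f 2 + f 3)^2 \<le> 2 * (f 1 + f 2)^2 + 2 * (f 3)^2"
    by (rule ennreal_square_add_le)
  also have "\<dots> \<le> 2 * (2 * (f 1)^2 + 2 * (f 2)^2) + 4 * (f 3)^2"
    by (intro add_mono mult_left_mono ennreal_square_add_le mult_right_mono) auto
  also have "\<dots> = 4 * ((f 1)^2 + (f 2)^2 + (f 3)^2)"
    by (simp add: distrib_left mult.assoc[symmetric])
  finally show ?thesis by (simp add: sum_3)
qed

lemma weighted_norm_cong_AE:
  assumes "AE x in lborel. f x = g x" "f \<in> borel_measurable borel" "g \<in> borel_measurable borel"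
  shows "weighted_norm m f = weighted_norm m (g :: real^3 \<Rightarrow> real^3)"
  unfolding weighted_norm_def L2_norm_def
proof (rule arg_cong[where f=sqrt], rule integral_cong_AE)
  show "AE x in lborel. (norm (rho x powr m *\<^sub>R f x))^2 = (norm (rho x powr m *\<^sub>R g x))^2"
    using assms(1) by eventually_elim simp
qed (use assms(2,3) in measurable)

section \<open>The asymptotic profile\<close>

lemma nn_integral_sum_terms_le:
  fixes U :: "3 \<Rightarrow> real^3 \<Rightarrow> ennreal" and V :: "3 \<Rightarrow> 3 \<Rightarrow> real^3 \<Rightarrow> ennreal"
  assumes [measurable]: "\<And>i. U i \<in> borel_measurable lborel" "\<And>i j. V i j \<in> borel_measurable lborel"
    and U: "\<And>i. (NN x. (U i x)^2) \<le> ennreal (A^2)"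
    and V: "\<And>i j. (NN x. (V i j x)^2) \<le> ennreal (B^2)"
    and AB: "A \<ge> 0" "B \<ge> 0"
  shows "(NN x. (\<Sum>i\<in>UNIV. U i x + (\<Sum>j\<in>UNIV. V i j x))^2) \<le> ennreal ((17 * (A + B))^2)"
proof -
  have "(NN x. (\<Sum>i\<in>UNIV. U i x + (\<Sum>j\<in>UNIV. V i j x))^2)
     \<le> (NN x. 4 * (\<Sum>i\<in>UNIV. 2 * (U i x)^2 + 8 * (\<Sum>j\<in>UNIV. (V i j x)^2)))"
  proof (rule nn_integral_mono)
    fix x
    have "(U i x + (\<Sum>j\<in>UNIV. V i j x))^2 \<le> 2 * (U i x)^2 + 8 * (\<Sum>j\<in>UNIV. (V i j x)^2)" for i
    proof -
      have "(U i x + (\<Sum>j\<in>UNIV. V i j x))^2 \<le> 2 * (U i x)^2 + 2 * (\<Sum>j\<in>UNIV. V i j x)^2"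
        by (rule ennreal_square_add_le)
      also have "\<dots> \<le> 2 * (U i x)^2 + 2 * (4 * (\<Sum>j\<in>UNIV. (V i j x)^2))"
        by (intro add_mono mult_left_mono ennreal_sum3_square_le) auto
      finally show ?thesis by (simp add: mult.assoc[symmetric])
    qed
    then have "4 * (\<Sum>i\<in>UNIV. (U i x + (\<Sum>j\<in>UNIV. V i j x))^2) \<le> 4 * (\<Sum>i\<in>UNIV. 2 * (U i x)^2 + 8 * (\<Sum>j\<in>UNIV. (V i j x)^2))"
      by (intro mult_left_mono sum_mono) auto
    with ennreal_sum3_square_le[of "\<lambda>i. U i x + (\<Sum>j\<in>UNIV. V i j x)"]
    show "(\<Sum>i\<in>UNIV. U i x + (\<Sum>j\<in>UNIV. V i j x))^2 \<le> 4 * (\<Sum>i\<in>UNIV. 2 * (U i x)^2 + 8 * (\<Sum>j\<in>UNIV. (V i j x)^2))"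
      by (rule order_trans)
  qed
  also have "\<dots> = 4 * (\<Sum>i\<in>UNIV. 2 * (NN x. (U i x)^2) + 8 * (\<Sum>j\<in>UNIV. (NN x. (V i j x)^2)))"
    by (simp add: nn_integral_cmult nn_integral_sum nn_integral_add)
  also have "\<dots> \<le> 4 * (\<Sum>i\<in>(UNIV::3 set). 2 * ennreal (A^2) + 8 * (\<Sum>j\<in>(UNIV::3 set). ennreal (B^2)))"
    by (intro mult_left_mono sum_mono add_mono U V) auto
  also have "\<dots> = ennreal (4 * (3 * (2 * A^2 + 8 * (3 * B^2))))"
    by (simp add: ennreal_mult ennreal_plus)
  \<comment> \<open>\<open>24 A^2 + 288 B^2 \<le> (17 (A + B))^2\<close>, where \<open>17^2 = 289\<close>.\<close>
  also have "\<dots> \<le> ennreal ((17 * (A + B))^2)"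
  proof (rule ennreal_leI)
    have "0 \<le> 265 * A^2 + B^2 + 578 * (A * B)" using AB by simp
    then show "4 * (3 * (2 * A^2 + 8 * (3 * B^2))) \<le> (17 * (A + B))^2"
      by (simp add: power2_eq_square algebra_simps)
  qed
  finally show ?thesis .
qed

text \<open>
  The restriction \<open>\<tau> \<ge> 1\<close> ensures \<open>\<epsilon>^2 = exp (- \<tau>) \<le> 1/2\<close>, so that the width of the kernel stays
  away from 0.
\<close>

lemma mild_solution_asymptotics:
  assumes m: "m > 2 * \<nu> + 1 / 2" and \<nu>: "1 < \<nu>" "\<nu> \<le> 3 / 2"
  shows "\<exists>C\<ge>1. \<forall>w K \<tau>. continuous_in_L2 m w \<longrightarrow> mild_equation w \<longrightarrow> K \<ge> 0 \<longrightarrow>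
    (\<forall>s\<ge>0. weighted_norm m (w s) \<le> K * exp (- s)) \<longrightarrow> \<tau> \<ge> 1 \<longrightarrow>
    weighted_norm m (\<lambda>\<xi>. w \<tau> \<xi> - (\<Sum>i\<in>UNIV. (first_moment i (w 0) * exp (- \<tau>)) *\<^sub>R f_field i \<xi>))
      \<le> C * (K + K^2) * exp (- \<nu> * \<tau>)"
proof -
  have m52: "m > 5 / 2" and m0: "m \<ge> 0" using m \<nu> by auto
  have p: "1 \<le> 2 * \<nu> - 1" "2 * \<nu> - 1 \<le> 2" "2 * (m - (2 * \<nu> - 1)) > 3" using m \<nu> by auto
  obtain C1 where C1: "C1 \<ge> 1" "\<And>w N \<epsilon> i. weighted_bound m w N \<Longrightarrow> 0 < \<epsilon> \<Longrightarrow> \<epsilon>^2 \<le> 1 / 2 \<Longrightarrow>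
    (NN x. ennreal ((rho x powr m * (LINT y|lborel. heat_remainder \<epsilon> x y * w y $ i))^2)) \<le> ennreal ((C1 * \<epsilon> powr (2 * \<nu> - 1) * N)^2)"
    using linear_remainder_estimate[OF m0 p] by blast
  obtain C2 where C2: "C2 \<ge> 1" "\<And>w \<tau> i j K. continuous_in_L2 m w \<Longrightarrow> (\<forall>s\<ge>0. weighted_norm m (w s) \<le> K * exp (- s)) \<Longrightarrow>
    (NN x. (NN s. ennreal (rho x powr m * \<bar>indicator {0..<\<tau>} s * duhamel w \<tau> i j s x\<bar>))^2)
    \<le> ennreal ((C2 * K^2 * exp (- \<nu> * \<tau>))^2)"
    using duhamel_estimate[OF m52 \<nu>] by blast
  show ?thesis
  proof (intro exI[of _ "17 * (C1 + C2)"] conjI allI impI)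
    show "17 * (C1 + C2) \<ge> 1" using C1(1) C2(1) by simp
    fix w and K \<tau> :: real
    assume w: "continuous_in_L2 m w" and mild: "mild_equation w" and K0: "K \<ge> 0"
      and K: "\<forall>s\<ge>0. weighted_norm m (w s) \<le> K * exp (- s)" and \<tau>: "\<tau> \<ge> 1"
    have sol: "w 0 \<in> solenoidal_L2 m"
      using w by (simp add: continuous_in_L2_def)
    define N where "N = weighted_norm m (w 0)"
    have wb: "weighted_bound m (w 0) N" unfolding N_def by (rule solenoidal_weighted_bound[OF sol])
    note [measurable] = weighted_boundD(1)[OF wb]
    have N: "0 \<le> N" "N \<le> K" using weighted_boundD(2)[OF wb] K[rule_format, of 0] by (auto simp: N_def)
    define \<epsilon> where "\<epsilon> = exp (- \<tau> / 2)"
    have e0: "\<epsilon> > 0" by (simp add: \<epsilon>_def)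
    have e2: "\<epsilon>^2 \<le> 1 / 2"
    proof -
      have "2 \<le> exp (1::real)" using exp_ge_add_one_self[of 1] by simp
      also have "\<dots> \<le> exp \<tau>" using \<tau> by simp
      finally have "exp (- \<tau>) \<le> 1 / 2" by (simp add: exp_minus field_simps)
      moreover have "\<epsilon>^2 = exp (- \<tau>)" by (simp add: \<epsilon>_def power2_eq_square exp_add[symmetric])
      ultimately show ?thesis by simp
    qed
    define R where "R i x = (LINT y|lborel. heat_remainder \<epsilon> x y * w 0 y $ i)" for i x
    have [measurable]: "R i \<in> borel_measurable borel" for i unfolding R_def by measurable
    define U where "U i x = ennreal (rho x powr m * \<bar>\<epsilon> * R i x\<bar>)" for i x
    define V where "V i j x = (NN s. ennreal (rho x powr m * \<bar>indicator {0..<\<tau>} s * duhamel w \<tau> i j s x\<bar>))" for i j x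
    define P where "P x = (\<Sum>i\<in>UNIV. (first_moment i (w 0) * exp (- \<tau>)) *\<^sub>R f_field i x)" for x
    have comp: "AE x in lborel. w \<tau> x $ i - P x $ i = \<epsilon> * R i x + (\<Sum>j\<in>UNIV. LINT s:{0..\<tau>}|lborel. duhamel w \<tau> i j s x)" for i
    proof -
      have "AE x in lborel. w \<tau> x $ i = exp_Lambda \<tau> (\<lambda>\<eta>. w 0 \<eta> $ i) x + (\<Sum>j\<in>UNIV. LINT s:{0..\<tau>}|lborel.
            partial j (exp_Lambda_half (\<tau> - s)
              (\<lambda>\<eta>. w s \<eta> $ j * biot_savart (w s) \<eta> $ i - biot_savart (w s) \<eta> $ j * w s \<eta> $ i)) x)"
        using mild \<tau> by (simp add: mild_equation_def)
      then show ?thesis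
      proof eventually_elim
        case (elim x)
        have "exp_Lambda \<tau> (\<lambda>\<eta>. w 0 \<eta> $ i) x - P x $ i = \<epsilon> * R i x"
          unfolding P_def R_def \<epsilon>_def by (rule linear_part_eq[OF sol m52]) (use \<tau> in simp)
        with elim show ?case
          by (simp add: duhamel_def vort_flux_def[abs_def])
      qed
    qed
    have ptw: "AE x in lborel. ennreal (rho x powr m * norm (w \<tau> x - P x)) \<le> (\<Sum>i\<in>UNIV. U i x + (\<Sum>j\<in>UNIV. V i j x))"
    proof -
      have "AE x in lborel. \<forall>i. w \<tau> x $ i - P x $ i = \<epsilon> * R i x + (\<Sum>j\<in>UNIV. LINT s:{0..\<tau>}|lborel. duhamel w \<tau> i j s x)"
        using comp by (simp add: AE_all_countable)
      then show ?thesis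
      proof eventually_elim
        case (elim x)
        define D where "D i j = (LINT s:{0..\<tau>}|lborel. duhamel w \<tau> i j s x)" for i j
        have "norm (w \<tau> x - P x) \<le> (\<Sum>i\<in>UNIV. \<bar>(w \<tau> x - P x) $ i\<bar>)"
          by (rule norm_le_l1_cart)
        also have "\<dots> \<le> (\<Sum>i\<in>UNIV. \<bar>\<epsilon> * R i x\<bar> + (\<Sum>j\<in>UNIV. \<bar>D i j\<bar>))"
        proof (rule sum_mono)
          fix i
          have "\<bar>(w \<tau> x - P x) $ i\<bar> = \<bar>\<epsilon> * R i x + (\<Sum>j\<in>UNIV. D i j)\<bar>"
            using elim by (simp add: D_def)
          also have "\<dots> \<le> \<bar>\<epsilon> * R i x\<bar> + \<bar>\<Sum>j\<in>UNIV. D i j\<bar>" by (rule abs_triangle_ineq)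
          also have "\<dots> \<le> \<bar>\<epsilon> * R i x\<bar> + (\<Sum>j\<in>UNIV. \<bar>D i j\<bar>)" by (intro add_left_mono sum_abs)
          finally show "\<bar>(w \<tau> x - P x) $ i\<bar> \<le> \<bar>\<epsilon> * R i x\<bar> + (\<Sum>j\<in>UNIV. \<bar>D i j\<bar>)" .
        qed
        finally have "rho x powr m * norm (w \<tau> x - P x) \<le> rho x powr m * (\<Sum>i\<in>UNIV. \<bar>\<epsilon> * R i x\<bar> + (\<Sum>j\<in>UNIV. \<bar>D i j\<bar>))"
          by (rule mult_left_mono) simp
        also have "\<dots> = (\<Sum>i\<in>UNIV. rho x powr m * \<bar>\<epsilon> * R i x\<bar> + (\<Sum>j\<in>UNIV. rho x powr m * \<bar>D i j\<bar>))"
          by (simp only: sum_distrib_left distrib_left)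
        finally have "ennreal (rho x powr m * norm (w \<tau> x - P x))
           \<le> ennreal (\<Sum>i\<in>UNIV. rho x powr m * \<bar>\<epsilon> * R i x\<bar> + (\<Sum>j\<in>UNIV. rho x powr m * \<bar>D i j\<bar>))"
          by (rule ennreal_leI)
        also have "\<dots> = (\<Sum>i\<in>UNIV. ennreal (rho x powr m * \<bar>\<epsilon> * R i x\<bar>) + (\<Sum>j\<in>UNIV. ennreal (rho x powr m * \<bar>D i j\<bar>)))"
          unfolding sum_3 by simp
        also have "\<dots> \<le> (\<Sum>i\<in>UNIV. U i x + (\<Sum>j\<in>UNIV. V i j x))"
          unfolding U_def V_def D_def by (intro sum_mono add_mono order_refl duhamel_integral_le)
        finally show ?case .
      qed
    qed
    have "(NN x. ennreal ((rho x powr m * norm (w \<tau> x - P x))^2))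
        \<le> (NN x. (\<Sum>i\<in>UNIV. U i x + (\<Sum>j\<in>UNIV. V i j x))^2)"
    proof (rule nn_integral_mono_AE)
      show "AE x in lborel. ennreal ((rho x powr m * norm (w \<tau> x - P x))^2) \<le> (\<Sum>i\<in>UNIV. U i x + (\<Sum>j\<in>UNIV. V i j x))^2"
        using ptw
      proof eventually_elim
        case (elim x)
        have "ennreal ((rho x powr m * norm (w \<tau> x - P x))^2) = (ennreal (rho x powr m * norm (w \<tau> x - P x)))^2"
          by (rule ennreal_power[symmetric]) simp
        also have "\<dots> \<le> (\<Sum>i\<in>UNIV. U i x + (\<Sum>j\<in>UNIV. V i j x))^2"
          by (intro power_mono elim) simp
        finally show ?case .
      qed
    qed
    also have "\<dots> \<le> ennreal ((17 * (C1 * exp (- \<nu> * \<tau>) * N + C2 * K^2 * exp (- \<nu> * \<tau>)))^2)"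
    proof (rule nn_integral_sum_terms_le)
      show "U i \<in> borel_measurable lborel" for i unfolding U_def by measurable
      show "V i j \<in> borel_measurable lborel" for i j
      proof -
        note [measurable] = duhamel_measurable[OF m52 w, of \<tau> i j]
        have "(\<lambda>x. NN s. ennreal (rho x powr m * \<bar>(\<lambda>(s, x). indicator {0..<\<tau>} s * duhamel w \<tau> i j s x) (s, x)\<bar>)) \<in> borel_measurable lborel"
          by measurable
        then show ?thesis by (simp add: V_def[abs_def])
      qed
      show "(NN x. (V i j x)^2) \<le> ennreal ((C2 * K^2 * exp (- \<nu> * \<tau>))^2)" for i j
        unfolding V_def by (rule C2(2)[OF w K])
      show "(NN x. (U i x)^2) \<le> ennreal ((C1 * exp (- \<nu> * \<tau>) * N)^2)" for i
      proof -
        have "(NN x. (U i x)^2) = (NN x. ennreal (\<epsilon>^2) * ennreal ((rho x powr m * R i x)^2))"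
        proof (rule nn_integral_cong)
          fix x
          have "(U i x)^2 = ennreal ((rho x powr m * \<bar>\<epsilon> * R i x\<bar>)^2)"
            unfolding U_def by (rule ennreal_power) simp
          also have "(rho x powr m * \<bar>\<epsilon> * R i x\<bar>)^2 = \<epsilon>^2 * (rho x powr m * R i x)^2"
            by (simp add: power_mult_distrib)
          finally show "(U i x)^2 = ennreal (\<epsilon>^2) * ennreal ((rho x powr m * R i x)^2)"
            by (simp only: ennreal_mult[OF zero_le_power2 zero_le_power2])
        qed
        also have "\<dots> = ennreal (\<epsilon>^2) * (NN x. ennreal ((rho x powr m * R i x)^2))"
          by (rule nn_integral_cmult) measurable
        also have "\<dots> \<le> ennreal (\<epsilon>^2) * ennreal ((C1 * \<epsilon> powr (2 * \<nu> - 1) * N)^2)"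
          unfolding R_def by (intro mult_left_mono C1(2) wb e0 e2) simp
        also have "\<dots> = ennreal ((\<epsilon> * (C1 * \<epsilon> powr (2 * \<nu> - 1) * N))^2)"
          by (simp only: power_mult_distrib[of \<epsilon>] ennreal_mult[OF zero_le_power2 zero_le_power2])
        also have "\<epsilon> * (C1 * \<epsilon> powr (2 * \<nu> - 1) * N) = C1 * (\<epsilon> * \<epsilon> powr (2 * \<nu> - 1)) * N"
          by (simp only: mult_ac)
        also have "\<epsilon> * \<epsilon> powr (2 * \<nu> - 1) = exp (- \<nu> * \<tau>)"
          by (simp add: \<epsilon>_def powr_def exp_add[symmetric] field_simps)
        finally show ?thesis .
      qed
    qed (use C1(1) C2(1) N in auto)
    also have "\<dots> \<le> ennreal ((17 * (C1 + C2) * (K + K^2) * exp (- \<nu> * \<tau>))^2)"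
    proof (intro ennreal_leI power_mono)
      have "C1 * N \<le> C1 * K" using N C1(1) by (intro mult_left_mono) auto
      moreover have "0 \<le> C1 * K^2" "0 \<le> C2 * K" using C1(1) C2(1) K0 by auto
      ultimately have "C1 * N + C2 * K^2 \<le> (C1 + C2) * (K + K^2)" by (simp add: algebra_simps)
      then have "17 * exp (- \<nu> * \<tau>) * (C1 * N + C2 * K^2) \<le> 17 * exp (- \<nu> * \<tau>) * ((C1 + C2) * (K + K^2))"
        by (intro mult_left_mono) auto
      then show "17 * (C1 * exp (- \<nu> * \<tau>) * N + C2 * K^2 * exp (- \<nu> * \<tau>)) \<le> 17 * (C1 + C2) * (K + K^2) * exp (- \<nu> * \<tau>)"
        by (simp add: algebra_simps)
      show "0 \<le> 17 * (C1 * exp (- \<nu> * \<tau>) * N + C2 * K^2 * exp (- \<nu> * \<tau>))"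
        using C1(1) C2(1) N by (intro mult_nonneg_nonneg add_nonneg_nonneg) auto
    qed
    finally have "(NN x. ennreal ((rho x powr m * norm (w \<tau> x - P x))^2))
       \<le> ennreal ((17 * (C1 + C2) * (K + K^2) * exp (- \<nu> * \<tau>))^2)" .
    then show "weighted_norm m (\<lambda>\<xi>. w \<tau> \<xi> - (\<Sum>i\<in>UNIV. (first_moment i (w 0) * exp (- \<tau>)) *\<^sub>R f_field i \<xi>))
      \<le> 17 * (C1 + C2) * (K + K^2) * exp (- \<nu> * \<tau>)"
      unfolding P_def by (rule weighted_norm_le) (use C1(1) C2(1) K0 in auto)
  qed
qed

text \<open>
  For bounded times only the size of the two fields matters.
\<close>

lemma difference_from_profile_bound:
  assumes m: "m > 5 / 2"
  shows "\<exists>C\<ge>1. \<forall>w w0 N L \<tau>. weighted_bound m w L \<longrightarrow> weighted_bound m w0 N \<longrightarrow> \<tau> \<ge> 0 \<longrightarrow>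
    weighted_norm m (\<lambda>\<xi>. w \<xi> - (\<Sum>i\<in>UNIV. (first_moment i w0 * exp (- \<tau>)) *\<^sub>R f_field i \<xi>)) \<le> C * (L + N)"
proof -
  obtain C1 where C1: "C1 \<ge> 1" "\<And>w N \<tau> x. weighted_bound m w N \<Longrightarrow> \<tau> \<ge> 0 \<Longrightarrow>
    rho x powr m * norm (\<Sum>k\<in>UNIV. (first_moment k w * exp (- \<tau>)) *\<^sub>R f_field k x) \<le> C1 * N * rho x powr (-2)"
    using profile_bound[OF m] by blast
  obtain c where c: "c \<ge> 1" "(NN x. ennreal (rho x powr (-4))) \<le> ennreal (c^2)"
    using finite_ennreal_bound[OF nn_integral_rho_powr_finite[of 4]] by force
  have Cc: "C1 * c \<ge> 1" using C1(1) c(1) by (rule mult_ge1_I)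
  show ?thesis
  proof (intro exI[of _ "2 * (C1 * c)"] conjI allI impI)
    show "2 * (C1 * c) \<ge> 1" using Cc by simp
    fix w w0 and N L \<tau> :: real
    assume w: "weighted_bound m w L" and w0: "weighted_bound m w0 N" and \<tau>: "\<tau> \<ge> 0"
    note [measurable] = weighted_boundD(1)[OF w]
    have NL: "N \<ge> 0" "L \<ge> 0" by (rule weighted_boundD[OF w0], rule weighted_boundD[OF w])
    define P where "P x = (\<Sum>i\<in>UNIV. (first_moment i w0 * exp (- \<tau>)) *\<^sub>R f_field i x)" for x
    have "(NN x. ennreal ((rho x powr m * norm (w x - P x))^2))
       \<le> (NN x. 2 * ennreal ((rho x powr m * norm (w x))^2) + ennreal (2 * (C1 * N)^2) * ennreal (rho x powr (-4)))"
    proof (rule nn_integral_mono)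
      fix x
      have "rho x powr m * norm (w x - P x) \<le> rho x powr m * (norm (w x) + norm (P x))"
        by (intro mult_left_mono norm_triangle_ineq4) simp
      also have "\<dots> \<le> rho x powr m * norm (w x) + C1 * N * rho x powr (-2)"
        unfolding distrib_left P_def by (intro add_left_mono C1(2)[OF w0 \<tau>])
      finally have "(rho x powr m * norm (w x - P x))^2 \<le> (rho x powr m * norm (w x) + C1 * N * rho x powr (-2))^2"
        by (intro power_mono) auto
      also have "\<dots> \<le> 2 * (rho x powr m * norm (w x))^2 + 2 * (C1 * N * rho x powr (-2))^2"
        using zero_le_power2[of "rho x powr m * norm (w x) - C1 * N * rho x powr (-2)"]
        by (simp add: power2_sum power2_diff)
      also have "(C1 * N * rho x powr (-2))^2 = (C1 * N)^2 * rho x powr (-4)"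
        unfolding power_mult_distrib[of "C1 * N"] power2_eq_square[of "rho x powr _"] powr_add[symmetric] by simp
      finally have "ennreal ((rho x powr m * norm (w x - P x))^2)
         \<le> ennreal (2 * (rho x powr m * norm (w x))^2 + 2 * ((C1 * N)^2 * rho x powr (-4)))"
        by (rule ennreal_leI)
      also have "\<dots> = 2 * ennreal ((rho x powr m * norm (w x))^2) + ennreal (2 * (C1 * N)^2) * ennreal (rho x powr (-4))"
        by (simp add: ennreal_mult ennreal_plus mult.assoc)
      finally show "ennreal ((rho x powr m * norm (w x - P x))^2)
        \<le> 2 * ennreal ((rho x powr m * norm (w x))^2) + ennreal (2 * (C1 * N)^2) * ennreal (rho x powr (-4))" .
    qed
    also have "\<dots> = 2 * (NN x. ennreal ((rho x powr m * norm (w x))^2))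
        + ennreal (2 * (C1 * N)^2) * (NN x. ennreal (rho x powr (-4)))"
      by (simp add: nn_integral_add nn_integral_cmult)
    also have "\<dots> \<le> 2 * ennreal (L^2) + ennreal (2 * (C1 * N)^2) * ennreal (c^2)"
      using w by (intro add_mono mult_left_mono c) (auto simp: weighted_bound_def)
    also have "\<dots> = ennreal (2 * L^2 + 2 * (C1 * N)^2 * c^2)"
      by (simp add: ennreal_mult ennreal_plus)
    also have "\<dots> \<le> ennreal ((2 * (C1 * c) * (L + N))^2)"
    proof (rule ennreal_leI)
      have "L \<le> C1 * c * L" using mult_right_mono[OF Cc NL(2)] by simp
      then have "L^2 \<le> (C1 * c * L)^2" using NL by (intro power_mono) auto
      moreover have "(C1 * N)^2 * c^2 = (C1 * c * N)^2" by (simp add: power_mult_distrib)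
      moreover have "(2 * (C1 * c) * (L + N))^2 = 4 * (C1 * c * L)^2 + 4 * (C1 * c * N)^2 + 8 * ((C1 * c)^2 * (L * N))"
        by (simp add: power2_eq_square algebra_simps)
      moreover have "0 \<le> (C1 * c)^2 * (L * N)" using NL by simp
      moreover have "0 \<le> (C1 * c * L)^2" "0 \<le> (C1 * c * N)^2" by simp_all
      ultimately show "2 * L^2 + 2 * (C1 * N)^2 * c^2 \<le> (2 * (C1 * c) * (L + N))^2" by linarith
    qed
    finally have "(NN x. ennreal ((rho x powr m * norm (w x - P x))^2)) \<le> ennreal ((2 * (C1 * c) * (L + N))^2)" .
    then show "weighted_norm m (\<lambda>\<xi>. w \<xi> - (\<Sum>i\<in>UNIV. (first_moment i w0 * exp (- \<tau>)) *\<^sub>R f_field i \<xi>)) \<le> 2 * (C1 * c) * (L + N)"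
      unfolding P_def by (rule weighted_norm_le) (use C1(1) c(1) NL in auto)
  qed
qed

theorem theorem3p2:
  fixes \<nu> m r0 K0 :: real
  assumes "1 < \<nu>" and "\<nu> \<le> 3 / 2" and "m > 2 * \<nu> + 1 / 2"
    and "global_existence_constants m r0 K0"
  shows "\<exists>K3\<ge>1. \<forall>w0\<in>solenoidal_L2 m. weighted_norm m w0 \<le> r0 \<longrightarrow>
    (\<forall>w. global_solution m w0 w \<longrightarrow>
      (\<forall>\<tau>\<ge>0. weighted_norm m
           (\<lambda>\<xi>. w \<tau> \<xi> - (\<Sum>i\<in>UNIV. (first_moment i w0 * exp (- \<tau>)) *\<^sub>R f_field i \<xi>))
         \<le> K3 * exp (- \<nu> * \<tau>) * weighted_norm m w0))"
proof -
  note \<nu> = assms(1,2) and m = assms(3)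
  have m52: "m > 5 / 2" using m \<nu> by auto
  have r0: "r0 > 0" and K0: "K0 \<ge> 1"
    using assms(4) by (auto simp: global_existence_constants_def)
  obtain C1 where C1: "C1 \<ge> 1" "\<And>w K \<tau>. continuous_in_L2 m w \<Longrightarrow> mild_equation w \<Longrightarrow> K \<ge> 0 \<Longrightarrow>
    (\<forall>s\<ge>0. weighted_norm m (w s) \<le> K * exp (- s)) \<Longrightarrow> \<tau> \<ge> 1 \<Longrightarrow>
    weighted_norm m (\<lambda>\<xi>. w \<tau> \<xi> - (\<Sum>i\<in>UNIV. (first_moment i (w 0) * exp (- \<tau>)) *\<^sub>R f_field i \<xi>))
      \<le> C1 * (K + K^2) * exp (- \<nu> * \<tau>)"
    using mild_solution_asymptotics[OF m \<nu>] by blast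
  obtain C2 where C2: "C2 \<ge> 1" "\<And>w w0 N L \<tau>. weighted_bound m w L \<Longrightarrow> weighted_bound m w0 N \<Longrightarrow> \<tau> \<ge> 0 \<Longrightarrow>
    weighted_norm m (\<lambda>\<xi>. w \<xi> - (\<Sum>i\<in>UNIV. (first_moment i w0 * exp (- \<tau>)) *\<^sub>R f_field i \<xi>)) \<le> C2 * (L + N)"
    using difference_from_profile_bound[OF m52] by blast
  \<comment> \<open>\<open>A\<close> is the constant for \<open>\<tau> \<ge> 1\<close> and \<open>B\<close> the one for \<open>\<tau> \<le> 1\<close>, where \<open>exp (- \<nu>\<tau>) \<ge> exp (- \<nu>)\<close>.\<close>
  define A where "A = C1 * (K0 + K0^2 * r0)"
  define B where "B = C2 * (K0 + 1) * exp \<nu>"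
  have A0: "A \<ge> 0" unfolding A_def using C1(1) K0 r0 by simp
  have B1: "B \<ge> 1" unfolding B_def using C2(1) K0 \<nu> by (intro mult_ge1_I) auto
  show ?thesis
  proof (intro exI[of _ "A + B"] conjI ballI allI impI)
    show "1 \<le> A + B" using A0 B1 by simp
    fix w0 w and \<tau> :: real
    assume sol0: "w0 \<in> solenoidal_L2 m" and small: "weighted_norm m w0 \<le> r0"
      and sol: "global_solution m w0 w" and \<tau>: "0 \<le> \<tau>"
    define N where "N = weighted_norm m w0"
    have N0: "N \<ge> 0" unfolding N_def by (rule weighted_norm_nonneg)
    have cont: "continuous_in_L2 m w" and mild: "mild_equation w" and init: "AE \<xi> in lborel. w 0 \<xi> = w0 \<xi>"
      using sol by (auto simp: global_solution_def)
    have meas: "v \<in> borel_measurable borel" if "v \<in> solenoidal_L2 m" for v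
      using weighted_boundD(1)[OF solenoidal_weighted_bound[OF that]] .
    have sols: "w s \<in> solenoidal_L2 m" if "s \<ge> 0" for s
      using cont that by (simp add: continuous_in_L2_def)
    \<comment> \<open>The decay is known for one solution with the given initial value; by uniqueness it holds
      for all.\<close>
    have decay: "weighted_norm m (w s) \<le> K0 * N * exp (- s)" if s: "s \<ge> 0" for s
    proof -
      obtain v where v: "global_solution m w0 v"
        "\<And>w' s. global_solution m w0 w' \<Longrightarrow> s \<ge> 0 \<Longrightarrow> AE \<xi> in lborel. w' s \<xi> = v s \<xi>"
        "\<And>s. s \<ge> 0 \<Longrightarrow> weighted_norm m (v s) \<le> K0 * exp (- s) * N"
        using assms(4) sol0 small unfolding global_existence_constants_def N_def by blast
      have "v s \<in> solenoidal_L2 m"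
        using v(1) s by (simp add: global_solution_def continuous_in_L2_def)
      then have "weighted_norm m (w s) = weighted_norm m (v s)"
        by (intro weighted_norm_cong_AE v(2) sol s meas sols)
      then show ?thesis using v(3)[OF s] by (simp add: mult_ac)
    qed
    have fm: "first_moment i (w 0) = first_moment i w0" for i
      unfolding first_moment_def
    proof (rule integral_cong_AE)
      note [measurable] = meas[OF sols[OF order_refl]] meas[OF sol0]
      have [measurable]: "p_field i \<in> borel_measurable borel" unfolding p_field_def by measurable
      show "(\<lambda>\<xi>. p_field i \<xi> \<bullet> w 0 \<xi>) \<in> borel_measurable lborel" by measurable
      show "(\<lambda>\<xi>. p_field i \<xi> \<bullet> w0 \<xi>) \<in> borel_measurable lborel" by measurable
      show "AE \<xi> in lborel. p_field i \<xi> \<bullet> w 0 \<xi> = p_field i \<xi> \<bullet> w0 \<xi>"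
        using init by eventually_elim simp
    qed
    show "weighted_norm m (\<lambda>\<xi>. w \<tau> \<xi> - (\<Sum>i\<in>UNIV. (first_moment i w0 * exp (- \<tau>)) *\<^sub>R f_field i \<xi>))
         \<le> (A + B) * exp (- \<nu> * \<tau>) * weighted_norm m w0"
    proof (cases "\<tau> \<ge> 1")
      case True
      have "weighted_norm m (\<lambda>\<xi>. w \<tau> \<xi> - (\<Sum>i\<in>UNIV. (first_moment i w0 * exp (- \<tau>)) *\<^sub>R f_field i \<xi>))
          \<le> C1 * (K0 * N + (K0 * N)^2) * exp (- \<nu> * \<tau>)"
        using C1(2)[OF cont mild _ _ True, of "K0 * N"] decay K0 N0 by (simp add: fm)
      also have "\<dots> \<le> C1 * ((K0 + K0^2 * r0) * N) * exp (- \<nu> * \<tau>)"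
      proof (intro mult_right_mono mult_left_mono)
        \<comment> \<open>Smallness of the initial value makes the quadratic term linear.\<close>
        have "N * N \<le> r0 * N" using small N0 by (intro mult_right_mono) (auto simp: N_def)
        then have "K0^2 * (N * N) \<le> K0^2 * (r0 * N)" by (intro mult_left_mono) auto
        then show "K0 * N + (K0 * N)^2 \<le> (K0 + K0^2 * r0) * N"
          by (simp add: power2_eq_square algebra_simps)
      qed (use C1(1) in auto)
      also have "\<dots> = A * exp (- \<nu> * \<tau>) * N" by (simp add: A_def mult_ac)
      also have "\<dots> \<le> (A + B) * exp (- \<nu> * \<tau>) * N"
        using B1 N0 by (intro mult_right_mono) auto
      finally show ?thesis by (simp add: N_def)
    next
      case False
      have wb: "weighted_bound m (w \<tau>) (weighted_norm m (w \<tau>))"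
        by (rule solenoidal_weighted_bound[OF sols[OF \<tau>]])
      have wb0: "weighted_bound m w0 N"
        unfolding N_def by (rule solenoidal_weighted_bound[OF sol0])
      have "weighted_norm m (\<lambda>\<xi>. w \<tau> \<xi> - (\<Sum>i\<in>UNIV. (first_moment i w0 * exp (- \<tau>)) *\<^sub>R f_field i \<xi>))
          \<le> C2 * (weighted_norm m (w \<tau>) + N)"
        by (rule C2(2)[OF wb wb0 \<tau>])
      also have "\<dots> \<le> C2 * ((K0 + 1) * N)"
      proof (intro mult_left_mono)
        have "K0 * N * exp (- \<tau>) \<le> K0 * N * 1"
          using K0 N0 \<tau> by (intro mult_left_mono) auto
        then show "weighted_norm m (w \<tau>) + N \<le> (K0 + 1) * N"
          using decay[OF \<tau>] by (simp add: distrib_right)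
      qed (use C2(1) in simp)
      also have "\<dots> = C2 * (K0 + 1) * 1 * N" by simp
      also have "\<dots> \<le> C2 * (K0 + 1) * (exp \<nu> * exp (- \<nu> * \<tau>)) * N"
      proof (intro mult_right_mono mult_left_mono)
        have "\<nu> * \<tau> \<le> \<nu> * 1" using False \<nu> by (intro mult_left_mono) auto
        then have "0 \<le> \<nu> + - \<nu> * \<tau>" by simp
        then show "1 \<le> exp \<nu> * exp (- \<nu> * \<tau>)" unfolding exp_add[symmetric] by simp
      qed (use C2(1) K0 N0 in auto)
      also have "\<dots> = B * exp (- \<nu> * \<tau>) * N" by (simp add: B_def mult_ac)
      also have "\<dots> \<le> (A + B) * exp (- \<nu> * \<tau>) * N"
        using A0 N0 by (intro mult_right_mono) auto
      finally show ?thesis by (simp add: N_def)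
    qed
  qed
qed

end
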